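(* For every time step size $\delta t>0$, the scheme $$\frac{\phi^{n+1}-\phi^n}{\delta t}+M\big(-\epsilon^2\Delta\phi^{n+1}+H^nU^{n+1}\big)=0,\qquad U^{n+1}-U^n=\tfrac12H^n(\phi^{n+1}-\phi^n),$$ with $H^n=H(\phi^n)$ and boundary conditions either (i) $\phi^{n+1}$ periodic, or (ii) $\partial_{\boldsymbol n}\phi^{n+1}|_{\partial\Omega}=0$, is unconditionally energy stable in the sense that its solutions satisfy $$E(\phi^{n+1},U^{n+1})\le E(\phi^n,U^n)-\frac{1}{M\delta t}\|\phi^{n+1}-\phi^n\|^2 .$$
   Context: $\Omega\subset\mathbb R^d$ ($d=2,3$) is a bounded domain (a rectangular box in the periodic case (i); with boundary regular enough for integration by parts in case (ii)), and $\boldsymbol n$ is the outward normal. $\|\cdot\|$ is the $L^2(\Omega)$ norm. $M>0$ and $\epsilon>0$ are constants. $F$ is a nonlinear potential, continuously differentiable on an open interval $I\subseteq\mathbb R$ (for example $I=\mathbb R$ or $I=(0,1)$), bounded from below: $F(x)>-A$ for all $x\in I$, for some constant $A>0$. $B$ is a constant with $B>A$. Put $f=F'$ and $$H(\phi)=\frac{f(\phi)}{\sqrt{F(\phi)+B}} .$$ The scheme discretizes the Allen-Cahn system $\phi_t+M(-\epsilon^2\Delta\phi+H(\phi)U)=0$, $U_t=\frac12H(\phi)\phi_t$. The energy is $$E(\phi,U)=\int_\Omega\Big(\frac{\epsilon^2}{2}|\nabla\phi|^2+U^2\Big)\,d\boldsymbol x .$$ The functions satisfy: $\phi^n,\phi^{n+1}\in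 H^2(\Omega)$ with the stated boundary condition, $\phi^n$ takes values in $I$, $H^n\in L^\infty(\Omega)$, $U^n,U^{n+1}\in L^2(\Omega)$, and the scheme equations hold in $L^2(\Omega)$. *)

theory Defs
  imports "HOL-Analysis.Analysis"
begin

text \<open>The normalisation by the volume of the \<open>s\<close>-dimensional unit ball makes the
  \<open>(d - 1)\<close>-dimensional Hausdorff measure agree with the surface area of hypersurfaces.
  The library's \<^const>\<open>outer_measure\<close> is an infimum over disjoint countable covers; since the
  gauge below is monotone, this equals the infimum over all countable covers by sets of diameter
  at most \<open>\<delta>\<close>.\<close>

definition hausdorff_gauge :: "nat \<Rightarrow> real \<Rightarrow> 'a::metric_space set \<Rightarrow> ennreal" where
  "hausdorff_gauge s \<delta> C =
     (if C = {} then 0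
      else if bounded C \<and> diameter C \<le> \<delta>
        then ennreal (unit_ball_vol (real s) * (diameter C / 2) ^ s)
      else top)"

definition hausdorff_outer :: "nat \<Rightarrow> 'a::metric_space set \<Rightarrow> ennreal" where
  "hausdorff_outer s A = (SUP \<delta>\<in>{0<..}. outer_measure (Pow UNIV) (hausdorff_gauge s \<delta>) A)"

definition hausdorff_measure :: "nat \<Rightarrow> 'a::metric_space measure" where
  "hausdorff_measure s = measure_of UNIV (sets borel) (hausdorff_outer s)"

lemma sets_hausdorff_measure [measurable_cong, simp]:
  "sets (hausdorff_measure s) = sets borel"
  unfolding hausdorff_measure_def
  by (metis sets.sets_measure_of_eq space_borel)

lemma space_hausdorff_measure [simp]: "space (hausdorff_measure s) = UNIV"
  unfolding hausdorff_measure_def by (simp add: space_measure_of_conv)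

text \<open>\<^const>\<open>measure_of\<close> returns the zero measure when its argument is not countably additive.
  The following lemmas show, by Caratheodory's criterion for metric outer measures, that this
  does not happen.\<close>

lemma hausdorff_gauge_empty [simp]: "hausdorff_gauge s \<delta> {} = 0"
  by (simp add: hausdorff_gauge_def)

lemma hausdorff_gauge_mono:
  assumes "C \<subseteq> D"
  shows "hausdorff_gauge s \<delta> C \<le> hausdorff_gauge s \<delta> D"
proof (cases "C \<noteq> {} \<and> bounded D \<and> diameter D \<le> \<delta>")
  case True
  then have b: "bounded C" and d: "diameter C \<le> diameter D"
    using assms bounded_subset diameter_subset by blast+
  have "0 \<le> diameter C"
    using b by (rule diameter_ge_0)
  then have "(diameter C / 2) ^ s \<le> (diameter D / 2) ^ s"
    using d by (intro power_mono) auto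
  then have "unit_ball_vol (real s) * (diameter C / 2) ^ s
      \<le> unit_ball_vol (real s) * (diameter D / 2) ^ s"
    by (intro mult_left_mono) auto
  then show ?thesis
    using True assms b d by (auto simp: hausdorff_gauge_def intro!: ennreal_leI)
qed (use assms in \<open>auto simp: hausdorff_gauge_def\<close>)

lemma outer_measure_space_hausdorff_gauge:
  "outer_measure_space (Pow UNIV) (outer_measure (Pow UNIV) (hausdorff_gauge s \<delta>))"
proof -
  interpret algebra UNIV "Pow UNIV" by (rule algebra_Pow)
  show ?thesis
    by (rule outer_measure_space_outer_measure)
       (auto simp: positive_def increasing_def hausdorff_gauge_mono)
qed

lemma hausdorff_outer_empty [simp]: "hausdorff_outer s {} = 0"
proof -
  have "outer_measure (Pow UNIV) (hausdorff_gauge s \<delta>) {} = 0" for \<delta>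
    by (rule outer_measure_empty) (auto simp: positive_def)
  then show ?thesis
    by (auto simp: hausdorff_outer_def intro!: SUP_eq_const)
qed

lemma hausdorff_outer_mono:
  assumes "A \<subseteq> B"
  shows "hausdorff_outer s A \<le> hausdorff_outer s B"
proof -
  have "outer_measure (Pow UNIV) (hausdorff_gauge s \<delta>) A
      \<le> outer_measure (Pow UNIV) (hausdorff_gauge s \<delta>) B" for \<delta>
    using outer_measure_space_hausdorff_gauge [of s \<delta>] assms
    unfolding outer_measure_space_def by (blast intro: increasingD)
  then show ?thesis
    unfolding hausdorff_outer_def by (intro SUP_mono) blast
qed

lemma outer_measure_space_hausdorff_outer:
  "outer_measure_space (Pow UNIV) (hausdorff_outer s)"
proof -
  have "hausdorff_outer s (\<Union>i. A i) \<le> (\<Sum>i. hausdorff_outer s (A i))"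
    if dis: "disjoint_family A" for A :: "nat \<Rightarrow> 'a set"
    unfolding hausdorff_outer_def [of s "\<Union>i. A i"]
  proof (rule SUP_least)
    fix \<delta> :: real assume \<delta>: "\<delta> \<in> {0<..}"
    have "outer_measure (Pow UNIV) (hausdorff_gauge s \<delta>) (\<Union>i. A i)
        \<le> (\<Sum>i. outer_measure (Pow UNIV) (hausdorff_gauge s \<delta>) (A i))"
      using outer_measure_space_hausdorff_gauge [of s \<delta>] dis
      unfolding outer_measure_space_def countably_subadditive_def by blast
    also have "\<dots> \<le> (\<Sum>i. hausdorff_outer s (A i))"
      unfolding hausdorff_outer_def using \<delta>
      by (intro suminf_le allI SUP_upper) auto
    finally show "outer_measure (Pow UNIV) (hausdorff_gauge s \<delta>) (\<Union>i. A i)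
        \<le> (\<Sum>i. hausdorff_outer s (A i))" .
  qed
  then show ?thesis
    by (auto simp: outer_measure_space_def positive_def increasing_def
        countably_subadditive_def hausdorff_outer_mono)
qed

lemma hausdorff_outer_subadditive:
  "hausdorff_outer s (\<Union>i. A i) \<le> (\<Sum>i. hausdorff_outer s (A i))" for A :: "nat \<Rightarrow> _"
proof -
  have "hausdorff_outer s (\<Union>i. disjointed A i) \<le> (\<Sum>i. hausdorff_outer s (disjointed A i))"
    using outer_measure_space_hausdorff_outer disjoint_family_disjointed
    unfolding outer_measure_space_def countably_subadditive_def by blast
  also have "\<dots> \<le> (\<Sum>i. hausdorff_outer s (A i))"
    by (intro suminf_le allI hausdorff_outer_mono disjointed_subset) auto
  finally show ?thesis
    by (simp add: UN_disjointed_eq)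
qed

lemma hausdorff_outer_Un:
  "hausdorff_outer s (A \<union> B) \<le> hausdorff_outer s A + hausdorff_outer s B"
proof -
  have sa: "subadditive (Pow UNIV) (hausdorff_outer s)"
    using outer_measure_space_hausdorff_outer [of s]
    unfolding outer_measure_space_def
    by (meson ring_of_sets.countably_subadditive_subadditive algebra.axioms(1) algebra_Pow)
  have "A \<union> B = A \<union> (B - A)" by auto
  then have "hausdorff_outer s (A \<union> B) \<le> hausdorff_outer s A + hausdorff_outer s (B - A)"
    using subadditiveD [OF sa, of A "B - A"] by auto
  also have "\<dots> \<le> hausdorff_outer s A + hausdorff_outer s B"
    by (intro add_left_mono hausdorff_outer_mono) auto
  finally show ?thesis .
qed

lemma outer_measure_gauge_separated:
  assumes sep: "\<And>x y. x \<in> A \<Longrightarrow> y \<in> B \<Longrightarrow> dist x y > \<delta>"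
  shows "outer_measure (Pow UNIV) (hausdorff_gauge s \<delta>) A
      + outer_measure (Pow UNIV) (hausdorff_gauge s \<delta>) B
    \<le> outer_measure (Pow UNIV) (hausdorff_gauge s \<delta>) (A \<union> B)"
  unfolding outer_measure_def [of _ _ "A \<union> B"]
proof (rule INF_greatest)
  fix C :: "nat \<Rightarrow> 'a set"
  assume "C \<in> {C. range C \<subseteq> Pow UNIV \<and> disjoint_family C \<and> A \<union> B \<subseteq> (\<Union>i. C i)}"
  then have C: "disjoint_family C" "A \<subseteq> (\<Union>i. C i)" "B \<subseteq> (\<Union>i. C i)"
    by auto
  have *: "outer_measure (Pow UNIV) (hausdorff_gauge s \<delta>) D
      \<le> (\<Sum>i. hausdorff_gauge s \<delta> (C i \<inter> D))" if "D \<subseteq> (\<Union>i. C i)" for D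
    unfolding outer_measure_def using that C(1)
    by (intro INF_lower) (auto simp: disjoint_family_on_def)
  have g: "hausdorff_gauge s \<delta> (C i \<inter> A) + hausdorff_gauge s \<delta> (C i \<inter> B)
      \<le> hausdorff_gauge s \<delta> (C i)" for i
  proof (cases "C i \<inter> A = {} \<or> C i \<inter> B = {}")
    case True
    then show ?thesis
      by (auto simp: hausdorff_gauge_mono)
  next
    case False
    then obtain x y where xy: "x \<in> C i" "x \<in> A" "y \<in> C i" "y \<in> B" by auto
    have "\<not> (bounded (C i) \<and> diameter (C i) \<le> \<delta>)"
      using diameter_bounded_bound [of "C i" x y] sep [of x y] xy by auto
    with xy show ?thesis
      by (auto simp: hausdorff_gauge_def)
  qed
  have "outer_measure (Pow UNIV) (hausdorff_gauge s \<delta>) A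
      + outer_measure (Pow UNIV) (hausdorff_gauge s \<delta>) B
    \<le> (\<Sum>i. hausdorff_gauge s \<delta> (C i \<inter> A)) + (\<Sum>i. hausdorff_gauge s \<delta> (C i \<inter> B))"
    using C by (intro add_mono *)
  also have "\<dots> = (\<Sum>i. hausdorff_gauge s \<delta> (C i \<inter> A) + hausdorff_gauge s \<delta> (C i \<inter> B))"
    by (rule suminf_add) auto
  also have "\<dots> \<le> (\<Sum>i. hausdorff_gauge s \<delta> (C i))"
    by (intro suminf_le allI g) auto
  finally show "outer_measure (Pow UNIV) (hausdorff_gauge s \<delta>) A
      + outer_measure (Pow UNIV) (hausdorff_gauge s \<delta>) B \<le> (\<Sum>i. hausdorff_gauge s \<delta> (C i))" .
qed

lemma hausdorff_gauge_antimono: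
  "\<delta> \<le> \<delta>' \<Longrightarrow> hausdorff_gauge s \<delta>' C \<le> hausdorff_gauge s \<delta> C"
  by (auto simp: hausdorff_gauge_def)

lemma outer_measure_gauge_antimono:
  assumes "\<delta> \<le> \<delta>'"
  shows "outer_measure (Pow UNIV) (hausdorff_gauge s \<delta>') A
    \<le> outer_measure (Pow UNIV) (hausdorff_gauge s \<delta>) A"
  unfolding outer_measure_def
  by (rule INF_mono, rule bexI, rule suminf_le) (auto intro: hausdorff_gauge_antimono assms)

lemma hausdorff_outer_separated:
  assumes "0 < r" and sep: "\<And>x y. x \<in> A \<Longrightarrow> y \<in> B \<Longrightarrow> dist x y > r"
  shows "hausdorff_outer s A + hausdorff_outer s B \<le> hausdorff_outer s (A \<union> B)"
proof -
  let ?m = "\<lambda>\<delta>. outer_measure (Pow UNIV) (hausdorff_gauge s \<delta>)"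
  have "hausdorff_outer s A + hausdorff_outer s B
      = (SUP \<delta>\<in>{0<..}. ?m \<delta> A + ?m \<delta> B)"
    unfolding hausdorff_outer_def
  proof (rule SUP_add_directed_ennreal [symmetric])
    fix \<delta> \<delta>' :: real assume "\<delta> \<in> {0<..}" "\<delta>' \<in> {0<..}"
    then show "\<exists>k\<in>{0<..}. ?m \<delta> A + ?m \<delta>' B \<le> ?m k A + ?m k B"
      by (intro bexI [of _ "min \<delta> \<delta>'"] add_mono outer_measure_gauge_antimono) auto
  qed
  also have "\<dots> \<le> hausdorff_outer s (A \<union> B)"
  proof (rule SUP_least)
    fix \<delta> :: real assume \<delta>: "\<delta> \<in> {0<..}"
    have "?m \<delta> A + ?m \<delta> B \<le> ?m (min \<delta> r) A + ?m (min \<delta> r) B"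
      by (intro add_mono outer_measure_gauge_antimono) auto
    also have "\<dots> \<le> ?m (min \<delta> r) (A \<union> B)"
    proof (rule outer_measure_gauge_separated)
      fix x y assume "x \<in> A" "y \<in> B"
      then show "dist x y > min \<delta> r" using sep [of x y] by auto
    qed
    also have "\<dots> \<le> hausdorff_outer s (A \<union> B)"
      unfolding hausdorff_outer_def using \<delta> \<open>0 < r\<close> by (intro SUP_upper) auto
    finally show "?m \<delta> A + ?m \<delta> B \<le> hausdorff_outer s (A \<union> B)" .
  qed
  finally show ?thesis .
qed

lemma hausdorff_outer_closed_caratheodory:
  fixes F X :: "'a::metric_space set"
  assumes "closed F"
  shows "hausdorff_outer s (X \<inter> F) + hausdorff_outer s (X - F) \<le> hausdorff_outer s X"
proof (cases "F = {} \<or> hausdorff_outer s X = top")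
  case True
  then show ?thesis by auto
next
  case False
  then have "F \<noteq> {}" and fin: "hausdorff_outer s X \<noteq> top" by auto
  let ?\<mu> = "hausdorff_outer s"
  define G where "G n = {x \<in> X. 1 / real (Suc n) \<le> infdist x F}" for n
  define R where "R n = {x \<in> X. 1 / real (Suc (Suc n)) \<le> infdist x F \<and> infdist x F < 1 / real (Suc n)}" for n
  have sep: "?\<mu> A + ?\<mu> B \<le> ?\<mu> (A \<union> B)"
    if "\<And>x. x \<in> A \<Longrightarrow> a \<le> infdist x F" "\<And>y. y \<in> B \<Longrightarrow> infdist y F \<le> b" "b < a" for A B a b
  proof (rule hausdorff_outer_separated)
    show "0 < (a - b) / 2" using that by simp
    fix x y assume "x \<in> A" "y \<in> B"
    then have "a \<le> infdist x F" "infdist y F \<le> b" using that by auto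
    moreover have "infdist x F \<le> infdist y F + dist x y" by (rule infdist_triangle)
    ultimately show "dist x y > (a - b) / 2" using \<open>b < a\<close> by (simp add: field_simps)
  qed
  have GF: "?\<mu> (X \<inter> F) + ?\<mu> (G n) \<le> ?\<mu> X" for n
  proof -
    have "?\<mu> (G n) + ?\<mu> (X \<inter> F) \<le> ?\<mu> (G n \<union> X \<inter> F)"
      by (rule sep [of _ "1 / real (Suc n)" _ 0]) (auto simp: G_def)
    also have "\<dots> \<le> ?\<mu> X" by (rule hausdorff_outer_mono) (auto simp: G_def)
    finally show ?thesis by (simp add: add.commute)
  qed
  have "1 / real (Suc (Suc j)) \<le> 1 / real (Suc i)" if "i \<le> Suc j" for i j
    using that by (simp add: frac_le)
  note frac = this
  have alt: "(\<Sum>i<n. ?\<mu> (R (2 * i + c))) \<le> ?\<mu> (\<Union>i<n. R (2 * i + c))" for n c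
  proof (induction n)
    case (Suc n)
    have "(\<Sum>i<Suc n. ?\<mu> (R (2 * i + c))) \<le> ?\<mu> (\<Union>i<n. R (2 * i + c)) + ?\<mu> (R (2 * n + c))"
      using Suc by (simp add: add_right_mono)
    also have "\<dots> \<le> ?\<mu> ((\<Union>i<n. R (2 * i + c)) \<union> R (2 * n + c))"
    proof (cases "n = 0")
      case True
      then show ?thesis by simp
    next
      case False
      show ?thesis
      proof (rule sep)
        fix x assume "x \<in> (\<Union>i<n. R (2 * i + c))"
        then obtain i where i: "i < n" "1 / real (Suc (Suc (2 * i + c))) \<le> infdist x F"
          by (auto simp: R_def)
        have "1 / real (2 * n + c) \<le> 1 / real (Suc (Suc (2 * i + c)))"
          using i(1) by (intro divide_left_mono) auto
        with i(2) show "1 / real (2 * n + c) \<le> infdist x F" by linarith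
      next
        fix y assume "y \<in> R (2 * n + c)"
        then show "infdist y F \<le> 1 / real (Suc (2 * n + c))" by (auto simp: R_def)
      next
        show "1 / real (Suc (2 * n + c)) < 1 / real (2 * n + c)"
          using False by (intro divide_strict_left_mono) auto
      qed
    qed
    also have "(\<Union>i<n. R (2 * i + c)) \<union> R (2 * n + c) = (\<Union>i<Suc n. R (2 * i + c))"
      by (auto simp: less_Suc_eq)
    finally show ?case .
  qed simp
  have alt': "(\<Sum>i<n. ?\<mu> (R (2 * i + c))) \<le> ?\<mu> X" for n c
    by (rule order_trans [OF alt]) (auto intro!: hausdorff_outer_mono simp: R_def)
  have split: "(\<Sum>i<2 * n. ?\<mu> (R i)) = (\<Sum>i<n. ?\<mu> (R (2 * i + 0))) + (\<Sum>i<n. ?\<mu> (R (2 * i + 1)))" for n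
    by (induction n) (auto simp: ac_simps)
  define T where "T = (\<Sum>i. ?\<mu> (R i))"
  have "T \<le> ?\<mu> X + ?\<mu> X"
    unfolding T_def
  proof (rule suminf_le_const)
    fix n
    have "(\<Sum>i<n. ?\<mu> (R i)) \<le> (\<Sum>i<2 * n. ?\<mu> (R i))"
      by (intro sum_mono2) auto
    also have "\<dots> \<le> ?\<mu> X + ?\<mu> X"
      unfolding split by (intro add_mono alt')
    finally show "(\<Sum>i<n. ?\<mu> (R i)) \<le> ?\<mu> X + ?\<mu> X" .
  qed auto
  with fin have T: "T \<noteq> top"
    by (metis ennreal_add_eq_top top.extremum_unique)
  have cover: "X - F \<subseteq> G n \<union> (\<Union>k. R (k + n))" for n
  proof
    fix x assume x: "x \<in> X - F"
    then have pos: "0 < infdist x F"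
      using \<open>closed F\<close> \<open>F \<noteq> {}\<close> by (simp add: infdist_pos_not_in_closed)
    show "x \<in> G n \<union> (\<Union>k. R (k + n))"
    proof (cases "1 / real (Suc n) \<le> infdist x F")
      case True
      then show ?thesis using x by (auto simp: G_def)
    next
      case False
      obtain m where m: "1 / real (Suc m) < infdist x F"
        using pos nat_approx_posE by blast
      define l where "l = (LEAST l. 1 / real (Suc l) \<le> infdist x F)"
      have l: "1 / real (Suc l) \<le> infdist x F"
        unfolding l_def by (rule LeastI [of _ m]) (use m in simp)
      have l': "infdist x F < 1 / real (Suc k)" if "k < l" for k
        using not_less_Least [OF that [unfolded l_def]] by simp
      have "n < l"
      proof (rule ccontr)
        assume "\<not> n < l"
        then have "1 / real (Suc n) \<le> 1 / real (Suc l)" by (simp add: frac_le)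
        with l False show False by linarith
      qed
      then obtain k where k: "l = Suc (k + n)"
        by (metis add.commute less_imp_Suc_add)
      have "x \<in> R (k + n)"
        using x l l' [of "k + n"] unfolding R_def k by auto
      then show ?thesis by auto
    qed
  qed
  have "T + (?\<mu> (X \<inter> F) + ?\<mu> (X - F)) \<le> ?\<mu> X + T"
  proof (subst (1) T_def, rule ennreal_suminf_bound_add)
    fix n
    have "?\<mu> (X - F) \<le> ?\<mu> (G n) + ?\<mu> (\<Union>k. R (k + n))"
      by (rule order_trans [OF hausdorff_outer_mono [OF cover] hausdorff_outer_Un])
    also have "\<dots> \<le> ?\<mu> (G n) + (\<Sum>k. ?\<mu> (R (k + n)))"
      by (intro add_left_mono hausdorff_outer_subadditive)
    finally have "(\<Sum>i<n. ?\<mu> (R i)) + (?\<mu> (X \<inter> F) + ?\<mu> (X - F))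
        \<le> (?\<mu> (X \<inter> F) + ?\<mu> (G n)) + ((\<Sum>k. ?\<mu> (R (k + n))) + (\<Sum>i<n. ?\<mu> (R i)))"
      by (simp add: ac_simps add_left_mono)
    also have "(\<Sum>k. ?\<mu> (R (k + n))) + (\<Sum>i<n. ?\<mu> (R i)) = T"
      unfolding T_def by (rule suminf_offset [symmetric]) auto
    also have "(?\<mu> (X \<inter> F) + ?\<mu> (G n)) + T \<le> ?\<mu> X + T"
      by (intro add_right_mono GF)
    finally show "(\<Sum>i<n. ?\<mu> (R i)) + (?\<mu> (X \<inter> F) + ?\<mu> (X - F)) \<le> ?\<mu> X + T" .
  qed
  also have "?\<mu> X + T = T + ?\<mu> X"
    by (rule add.commute)
  finally show ?thesis
    using T by (simp add: ennreal_add_left_cancel_le)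
qed

theorem emeasure_hausdorff_measure:
  fixes A :: "'a::metric_space set"
  assumes "A \<in> sets borel"
  shows "emeasure (hausdorff_measure s) A = hausdorff_outer s A"
proof -
  define L :: "'a set set" where "L = lambda_system UNIV (Pow UNIV) (hausdorff_outer s)"
  have L: "measure_space UNIV L (hausdorff_outer s)"
    unfolding L_def
    by (rule sigma_algebra.caratheodory_lemma
        [OF sigma_algebra_Pow outer_measure_space_hausdorff_outer])
  then have sa: "sigma_algebra UNIV L"
    by (simp add: measure_space_def)
  have "F \<in> L" if "closed F" for F
    unfolding L_def algebra.lambda_system_eq [OF algebra_Pow]
  proof (clarsimp, rule antisym)
    fix X
    show "hausdorff_outer s (X \<inter> F) + hausdorff_outer s (X - F) \<le> hausdorff_outer s X"
      by (rule hausdorff_outer_closed_caratheodory [OF that])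
    show "hausdorff_outer s X \<le> hausdorff_outer s (X \<inter> F) + hausdorff_outer s (X - F)"
      using hausdorff_outer_Un [of s "X \<inter> F" "X - F"] by (simp add: Int_Diff_Un)
  qed
  then have "sigma_sets UNIV (Collect closed) \<subseteq> L"
    by (intro sigma_algebra.sigma_sets_subset [OF sa]) auto
  then have sub: "sets (borel :: 'a measure) \<subseteq> L"
    by (simp add: borel_eq_closed)
  have "countably_additive (sets (borel :: 'a measure)) (hausdorff_outer s)"
  proof (rule countably_additiveI)
    fix B :: "nat \<Rightarrow> 'a set"
    assume B: "range B \<subseteq> sets borel" "disjoint_family B" "(\<Union>i. B i) \<in> sets borel"
    have "countably_additive L (hausdorff_outer s)"
      using L by (simp add: measure_space_def)
    moreover have "range B \<subseteq> L" "(\<Union>i. B i) \<in> L"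
      using B sub by auto
    ultimately show "(\<Sum>i. hausdorff_outer s (B i)) = hausdorff_outer s (\<Union>i. B i)"
      using B(2) by (simp add: countably_additive_def)
  qed
  moreover have "positive (sets (borel :: 'a measure)) (hausdorff_outer s)"
    by (simp add: positive_def)
  ultimately show ?thesis
    unfolding hausdorff_measure_def using assms
    using sets.sigma_algebra_axioms [of "borel :: 'a measure"]
    by (intro emeasure_measure_of_sigma) (simp_all only: space_borel)
qed

text \<open>Elements of \<open>L\<^sup>2(\<Omega>)\<close> and \<open>H\<^sup>k(\<Omega>)\<close> are represented by functions on the whole space
  whose values outside \<open>\<Omega>\<close> are irrelevant.\<close>

definition square_integrable :: "'a measure \<Rightarrow> ('a \<Rightarrow> real) \<Rightarrow> bool" where
  "square_integrable N u \<longleftrightarrow> u \<in> borel_measurable N \<and> integrable N (\<lambda>x. (u x)\<^sup>2)"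

definition L2 :: "'a::euclidean_space set \<Rightarrow> ('a \<Rightarrow> real) \<Rightarrow> bool" where
  "L2 \<Omega> u \<longleftrightarrow> square_integrable (lebesgue_on \<Omega>) u"

definition L2_norm :: "'a::euclidean_space set \<Rightarrow> ('a \<Rightarrow> real) \<Rightarrow> real" where
  "L2_norm \<Omega> u = sqrt (LINT x|lebesgue_on \<Omega>. (u x)\<^sup>2)"

definition L_infinity :: "'a::euclidean_space set \<Rightarrow> ('a \<Rightarrow> real) \<Rightarrow> bool" where
  "L_infinity \<Omega> u \<longleftrightarrow>
     u \<in> borel_measurable (lebesgue_on \<Omega>) \<and> (\<exists>C. AE x in lebesgue_on \<Omega>. \<bar>u x\<bar> \<le> C)"

definition partial_deriv :: "'a::euclidean_space \<Rightarrow> ('a \<Rightarrow> real) \<Rightarrow> 'a \<Rightarrow> real" where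
  "partial_deriv i f x = frechet_derivative f (at x) i"

primrec C_k :: "nat \<Rightarrow> ('a::euclidean_space \<Rightarrow> real) \<Rightarrow> bool" where
  "C_k 0 f \<longleftrightarrow> continuous_on UNIV f"
| "C_k (Suc k) f \<longleftrightarrow>
     (\<forall>x. f differentiable (at x)) \<and> (\<forall>i\<in>Basis. C_k k (partial_deriv i f))"

definition test_function :: "'a::euclidean_space set \<Rightarrow> ('a \<Rightarrow> real) \<Rightarrow> bool" where
  "test_function \<Omega> \<eta> \<longleftrightarrow>
     (\<forall>k. C_k k \<eta>) \<and> compact (closure {x. \<eta> x \<noteq> 0}) \<and> closure {x. \<eta> x \<noteq> 0} \<subseteq> \<Omega>"

definition locally_integrable :: "'a::euclidean_space set \<Rightarrow> ('a \<Rightarrow> real) \<Rightarrow> bool" where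
  "locally_integrable \<Omega> u \<longleftrightarrow> (\<forall>K. compact K \<and> K \<subseteq> \<Omega> \<longrightarrow> integrable (lebesgue_on K) u)"

definition has_weak_partial ::
  "'a::euclidean_space set \<Rightarrow> 'a \<Rightarrow> ('a \<Rightarrow> real) \<Rightarrow> ('a \<Rightarrow> real) \<Rightarrow> bool" where
  "has_weak_partial \<Omega> i u g \<longleftrightarrow>
     locally_integrable \<Omega> u \<and> locally_integrable \<Omega> g \<and>
     (\<forall>\<eta>. test_function \<Omega> \<eta> \<longrightarrow>
        (LINT x|lebesgue_on \<Omega>. u x * partial_deriv i \<eta> x) = - (LINT x|lebesgue_on \<Omega>. g x * \<eta> x))"

text \<open>Weak derivatives are unique up to null sets; this picks a representative.\<close>

definition weak_partial ::
  "'a::euclidean_space set \<Rightarrow> 'a \<Rightarrow> ('a \<Rightarrow> real) \<Rightarrow> 'a \<Rightarrow> real" where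
  "weak_partial \<Omega> i u = (SOME g. has_weak_partial \<Omega> i u g)"

definition weak_gradient :: "'a::euclidean_space set \<Rightarrow> ('a \<Rightarrow> real) \<Rightarrow> 'a \<Rightarrow> 'a" where
  "weak_gradient \<Omega> u x = (\<Sum>i\<in>Basis. weak_partial \<Omega> i u x *\<^sub>R i)"

definition weak_laplacian :: "'a::euclidean_space set \<Rightarrow> ('a \<Rightarrow> real) \<Rightarrow> 'a \<Rightarrow> real" where
  "weak_laplacian \<Omega> u x = (\<Sum>i\<in>Basis. weak_partial \<Omega> i (weak_partial \<Omega> i u) x)"

definition H1 :: "'a::euclidean_space set \<Rightarrow> ('a \<Rightarrow> real) \<Rightarrow> bool" where
  "H1 \<Omega> u \<longleftrightarrow> L2 \<Omega> u \<and> (\<forall>i\<in>Basis. \<exists>g. L2 \<Omega> g \<and> has_weak_partial \<Omega> i u g)"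

definition H2 :: "'a::euclidean_space set \<Rightarrow> ('a \<Rightarrow> real) \<Rightarrow> bool" where
  "H2 \<Omega> u \<longleftrightarrow> H1 \<Omega> u \<and> (\<forall>i\<in>Basis. H1 \<Omega> (weak_partial \<Omega> i u))"

definition H1_norm :: "'a::euclidean_space set \<Rightarrow> ('a \<Rightarrow> real) \<Rightarrow> real" where
  "H1_norm \<Omega> u = sqrt (LINT x|lebesgue_on \<Omega>. (u x)\<^sup>2 + (norm (weak_gradient \<Omega> u x))\<^sup>2)"

text \<open>The space of periodic \<open>H\<^sup>2\<close> functions on the box: restrictions of functions in
  \<open>H\<^sup>2\<^sub>l\<^sub>o\<^sub>c\<close> of the whole space whose periods are the side lengths of the box.\<close>

definition periodic_bc :: "'a::euclidean_space \<Rightarrow> 'a \<Rightarrow> ('a \<Rightarrow> real) \<Rightarrow> bool" where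
  "periodic_bc a b u \<longleftrightarrow>
     (\<exists>v. (\<forall>x\<in>box a b. v x = u x) \<and>
          (\<forall>x. \<forall>i\<in>Basis. v (x + ((b - a) \<bullet> i) *\<^sub>R i) = v x) \<and>
          (\<forall>V. open V \<and> bounded V \<longrightarrow> H2 V v))"

definition surface_measure :: "'a::euclidean_space set \<Rightarrow> 'a measure" where
  "surface_measure \<Omega> = restrict_space (hausdorff_measure (DIM('a) - 1)) (frontier \<Omega>)"

text \<open>\<open>\<nu>\<close> is the outward unit normal at \<open>x\<close>: near \<open>x\<close> the set \<open>\<Omega>\<close> is, to first order, the half-space
  \<open>{y. (y - x) \<bullet> \<nu> < 0}\<close>. There is at most one such \<open>\<nu>\<close>; for a set lying locally below the
  graph of a function it exists wherever that function is differentiable.\<close>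

definition is_outward_normal :: "'a::euclidean_space set \<Rightarrow> 'a \<Rightarrow> 'a \<Rightarrow> bool" where
  "is_outward_normal \<Omega> x \<nu> \<longleftrightarrow>
     norm \<nu> = 1 \<and>
     (\<forall>e>0. \<exists>r>0. \<forall>y\<in>ball x r.
        ((y - x) \<bullet> \<nu> < - e * norm (y - x) \<longrightarrow> y \<in> \<Omega>) \<and>
        ((y - x) \<bullet> \<nu> > e * norm (y - x) \<longrightarrow> y \<notin> \<Omega>))"

definition outward_normal :: "'a::euclidean_space set \<Rightarrow> 'a \<Rightarrow> 'a" where
  "outward_normal \<Omega> x = (SOME \<nu>. is_outward_normal \<Omega> x \<nu>)"

text \<open>What integration by parts asks of the boundary: it has finite area and almost everywhere an
  outward normal, the divergence theorem holds for fields that are continuously differentiable up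
  to the boundary, such functions are dense in \<open>H\<^sup>1(\<Omega>)\<close>, and restriction to the boundary is bounded
  from \<open>H\<^sup>1(\<Omega>)\<close> to \<open>L\<^sup>2(\<partial>\<Omega>)\<close>. Bounded Lipschitz domains have these properties.\<close>

definition regular_boundary :: "'a::euclidean_space set \<Rightarrow> bool" where
  "regular_boundary \<Omega> \<longleftrightarrow>
     emeasure (hausdorff_measure (DIM('a) - 1)) (frontier \<Omega>) < \<infinity> \<and>
     (AE x in surface_measure \<Omega>. \<exists>\<nu>. is_outward_normal \<Omega> x \<nu>) \<and>
     outward_normal \<Omega> \<in> borel_measurable (surface_measure \<Omega>) \<and>
     (\<forall>w. \<forall>i\<in>Basis. C_k 1 w \<longrightarrow>
        (LINT x|lebesgue_on \<Omega>. partial_deriv i w x)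
          = (LINT x|surface_measure \<Omega>. w x * (outward_normal \<Omega> x \<bullet> i))) \<and>
     (\<forall>u. H1 \<Omega> u \<longrightarrow> (\<forall>e>0. \<exists>w. C_k 1 w \<and> H1_norm \<Omega> (\<lambda>x. w x - u x) < e)) \<and>
     (\<exists>C. \<forall>w. C_k 1 w \<longrightarrow>
        sqrt (LINT x|surface_measure \<Omega>. (w x)\<^sup>2) \<le> C * H1_norm \<Omega> w)"

definition has_trace :: "'a::euclidean_space set \<Rightarrow> ('a \<Rightarrow> real) \<Rightarrow> ('a \<Rightarrow> real) \<Rightarrow> bool" where
  "has_trace \<Omega> u g \<longleftrightarrow>
     H1 \<Omega> u \<and> square_integrable (surface_measure \<Omega>) g \<and>
     (\<exists>w :: nat \<Rightarrow> 'a \<Rightarrow> real.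
        (\<forall>k. C_k 1 (w k)) \<and>
        (\<lambda>k. H1_norm \<Omega> (\<lambda>x. w k x - u x)) \<longlonglongrightarrow> 0 \<and>
        (\<lambda>k. LINT x|surface_measure \<Omega>. (w k x - g x)\<^sup>2) \<longlonglongrightarrow> 0)"

definition neumann_bc :: "'a::euclidean_space set \<Rightarrow> ('a \<Rightarrow> real) \<Rightarrow> bool" where
  "neumann_bc \<Omega> u \<longleftrightarrow>
     (\<exists>g :: 'a \<Rightarrow> 'a \<Rightarrow> real.
        (\<forall>i\<in>Basis. has_trace \<Omega> (weak_partial \<Omega> i u) (g i)) \<and>
        (AE x in surface_measure \<Omega>. (\<Sum>i\<in>Basis. g i x * (outward_normal \<Omega> x \<bullet> i)) = 0))"

definition H_fun :: "(real \<Rightarrow> real) \<Rightarrow> real \<Rightarrow> real \<Rightarrow> real" where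
  "H_fun F B s = deriv F s / sqrt (F s + B)"

definition energy ::
  "'a::euclidean_space set \<Rightarrow> real \<Rightarrow> ('a \<Rightarrow> real) \<Rightarrow> ('a \<Rightarrow> real) \<Rightarrow> real" where
  "energy \<Omega> \<epsilon> \<phi> U =
     (LINT x|lebesgue_on \<Omega>. \<epsilon>\<^sup>2 / 2 * (norm (weak_gradient \<Omega> \<phi> x))\<^sup>2 + (U x)\<^sup>2)"

end

theory Submission
  imports Defs
begin

text \<open>Write \<open>w = \<phi>1 - \<phi>0\<close>. Multiplying the first scheme equation by \<open>w / M\<close> and replacing \<open>H w\<close> by
\<open>2 (U1 - U0)\<close>, which is the second equation, gives almost everywhere
\<open>\<epsilon>\<^sup>2 (\<Delta>\<phi>1) w = w\<^sup>2 / (M \<delta>t) + 2 (U1 - U0) U1\<close>. After integration, Green's formula turns the left side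
into \<open>- \<epsilon>\<^sup>2 \<integral> \<nabla>\<phi>1 \<bullet> (\<nabla>\<phi>1 - \<nabla>\<phi>0)\<close>. The identity \<open>2 x (x - y) = x\<^sup>2 - y\<^sup>2 + (x - y)\<^sup>2\<close>, applied to
the gradients and to \<open>U\<close>, then exhibits the energy difference as \<open>- \<parallel>w\<parallel>\<^sup>2 / (M \<delta>t)\<close> minus two squares
(\<open>energy_decay_from_green\<close>). The analytic content is therefore Green's formula
\<open>\<integral> (\<Delta>u) w + \<nabla>u \<bullet> \<nabla>w = 0\<close> under each of the two boundary conditions. It is used for \<open>u = \<phi>1\<close> with
\<open>w = \<phi>1\<close> and \<open>w = \<phi>0\<close>, and the two instances are subtracted (\<open>green_difference\<close>).

Weak derivatives enter as arbitrarily chosen representatives, so their uniqueness up to null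
sets is needed throughout (\<open>weak_partial_unique\<close>). It follows from the fundamental lemma of the
calculus of variations, which in turn rests on smooth test functions that increase to the
indicator of a box (\<open>test_functions_approximating_box\<close>).

In the Neumann case (\<open>green_neumann\<close>) the derivatives of \<open>u\<close> and the function \<open>w\<close> are approximated
in \<open>H\<^sup>1\<close> by \<open>C\<^sup>1\<close> functions, to which the divergence theorem applies. The boundary term tends to
zero because the approximations of the derivatives converge in \<open>L\<^sup>2\<close> of the boundary, to traces
with vanishing normal component, while those of \<open>w\<close> stay bounded there.

In the periodic case (\<open>periodic_integration_by_parts\<close>) no smoothing is used. With
\<open>\<langle>f, k\<rangle> = \<integral>\<^sub>\<Omega> f k\<close> and \<open>\<tau>f = f (\<cdot> + h e)\<close>, periodicity gives \<open>\<langle>\<tau>p, \<tau>w\<rangle> = \<langle>p, w\<rangle>\<close>, that is,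
\<open>\<langle>\<tau>p - p, w\<rangle> + \<langle>p, \<tau>w - w\<rangle> + \<langle>\<tau>p - p, \<tau>w - w\<rangle> = 0\<close>. An \<open>H\<^sup>1\<close> function satisfies
\<open>\<tau>p - p = \<integral>\<^sub>0\<^sup>h (\<partial>p) (\<cdot> + s e) ds\<close> almost everywhere, so the first two terms are \<open>h \<langle>\<partial>p, w\<rangle>\<close> and
\<open>h \<langle>p, \<partial>w\<rangle>\<close> up to \<open>O(h\<^sup>2)\<close> and the third is \<open>O(h\<^sup>2)\<close>. Division by \<open>h\<close> and \<open>h \<rightarrow> 0\<close> give
\<open>\<langle>\<partial>p, w\<rangle> + \<langle>p, \<partial>w\<rangle> = 0\<close>.\<close>

section \<open>Smooth functions and test functions\<close>

lemma partial_deriv_eq: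
  assumes "(f has_derivative f') (at x)"
  shows "partial_deriv i f x = f' i"
  unfolding partial_deriv_def using frechet_derivative_at[OF assms] by simp

lemma C_k_SucD:
  "C_k (Suc k) f \<Longrightarrow> C_k k f"
proof (induction k arbitrary: f)
  case 0
  then show ?case
    by (auto intro!: differentiable_imp_continuous_on simp: differentiable_on_def
        intro: differentiable_at_withinI)
next
  case (Suc k)
  then show ?case by simp
qed

lemma C_k_const: "C_k k (\<lambda>x. c)"
proof (induction k arbitrary: c)
  case (Suc k)
  have "partial_deriv i (\<lambda>x::'a. c) = (\<lambda>x. 0)" for i
    by (rule ext, rule partial_deriv_eq[where f' = "\<lambda>_. 0"]) simp
  with Suc show ?case by simp
qed simp

lemma partial_deriv_add:
  assumes "f differentiable (at x)" "g differentiable (at x)"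
  shows "partial_deriv i (\<lambda>x. f x + g x) x = partial_deriv i f x + partial_deriv i g x"
  using assms unfolding frechet_derivative_works
  by (subst partial_deriv_eq[OF has_derivative_add]) (auto simp: partial_deriv_def)

lemma partial_deriv_mult:
  assumes "f differentiable (at x)" "g differentiable (at x)"
  shows "partial_deriv i (\<lambda>x. f x * g x) x
    = f x * partial_deriv i g x + partial_deriv i f x * g x"
  using assms unfolding frechet_derivative_works
  by (subst partial_deriv_eq[OF has_derivative_mult]) (auto simp: partial_deriv_def)

lemma C_k_add: "C_k k f \<Longrightarrow> C_k k g \<Longrightarrow> C_k k (\<lambda>x. f x + g x)"
proof (induction k arbitrary: f g)
  case (Suc k)
  then have "partial_deriv i (\<lambda>x. f x + g x) = (\<lambda>x. partial_deriv i f x + partial_deriv i g x)" for i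
    by (intro ext partial_deriv_add) auto
  with Suc show ?case by simp
qed (auto intro: continuous_intros)

lemma C_k_mult: "C_k k f \<Longrightarrow> C_k k g \<Longrightarrow> C_k k (\<lambda>x. f x * g x)"
proof (induction k arbitrary: f g)
  case (Suc k)
  have "partial_deriv i (\<lambda>x. f x * g x)
      = (\<lambda>x. f x * partial_deriv i g x + partial_deriv i f x * g x)" for i
    using Suc.prems by (intro ext partial_deriv_mult) auto
  moreover have "C_k k f" "C_k k g"
    using Suc.prems by (auto intro: C_k_SucD)
  ultimately show ?case
    using Suc by (auto intro!: C_k_add)
qed (auto intro: continuous_intros)

lemma C_k_prod:
  assumes "finite J" "\<And>j. j \<in> J \<Longrightarrow> C_k k (f j)"
  shows "C_k k (\<lambda>x. \<Prod>j\<in>J. f j x)"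
  using assms by (induction J) (auto intro!: C_k_const C_k_mult)

lemma partial_deriv_shift:
  assumes "f differentiable (at (x + c))"
  shows "partial_deriv i (\<lambda>x. f (x + c)) x = partial_deriv i f (x + c)"
proof -
  have "(f has_derivative frechet_derivative f (at (x + c))) (at (x + c))"
    using assms by (simp add: frechet_derivative_works)
  moreover have "((\<lambda>x. x + c) has_derivative (\<lambda>x. x)) (at x)"
    by (auto intro!: derivative_eq_intros)
  ultimately have "((\<lambda>x. f (x + c)) has_derivative frechet_derivative f (at (x + c))) (at x)"
    using has_derivative_compose[of "\<lambda>x. x + c" "\<lambda>x. x" x UNIV f] by simp
  then show ?thesis
    by (subst partial_deriv_eq) (auto simp: partial_deriv_def)
qed

lemma C_k_shift: "C_k k f \<Longrightarrow> C_k k (\<lambda>x. f (x + c))"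
proof (induction k arbitrary: f)
  case 0
  then show ?case
    by (auto intro!: continuous_on_compose2[of UNIV f] continuous_intros)
next
  case (Suc k)
  then have "partial_deriv i (\<lambda>x. f (x + c)) = (\<lambda>x. partial_deriv i f (x + c))" for i
    by (intro ext partial_deriv_shift) auto
  moreover have "(\<lambda>x. f (x + c)) differentiable (at x)" for x
  proof -
    have "f differentiable (at (x + c))" using Suc by auto
    then show ?thesis
      using differentiable_chain_at[of "\<lambda>x. x + c" x f] by (simp add: o_def)
  qed
  ultimately show ?case using Suc by auto
qed

text \<open>Ridge functions inherit smoothness from one variable: a partial derivative of \<open>D m\<close> along a
linear form is a constant times \<open>D (Suc m)\<close> along the same form, so the induction must run over
all members of the sequence of derivatives at once.\<close>

lemma C_k_compose_linear:
  assumes D: "\<And>k s. (D k has_real_derivative D (Suc k) s) (at s)"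
  shows "C_k k (\<lambda>x. D m (c * (x \<bullet> j) + d))"
proof -
  have der: "((\<lambda>x. D m (c * (x \<bullet> j) + d)) has_derivative
      (\<lambda>y. D (Suc m) (c * (x \<bullet> j) + d) * (c * (y \<bullet> j)))) (at x)" for m x
  proof -
    have "((\<lambda>x. c * (x \<bullet> j) + d) has_derivative (\<lambda>y. c * (y \<bullet> j))) (at x)"
      by (auto intro!: derivative_eq_intros)
    from has_derivative_compose[OF this D[of m, unfolded has_field_derivative_def]]
    show ?thesis by simp
  qed
  have diff: "(\<lambda>x. D m (c * (x \<bullet> j) + d)) differentiable (at x)" for m x
    using der unfolding differentiable_def by blast
  have pd: "partial_deriv i (\<lambda>x. D m (c * (x \<bullet> j) + d))
      = (\<lambda>x. D (Suc m) (c * (x \<bullet> j) + d) * (c * (i \<bullet> j)))" for i m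
    by (rule ext) (rule partial_deriv_eq[OF der])
  show ?thesis
  proof (induction k arbitrary: m)
    case 0
    then show ?case using diff[of m]
      by (auto intro!: differentiable_imp_continuous_on simp: differentiable_on_def
          intro: differentiable_at_withinI)
  next
    case (Suc k)
    then show ?case using diff by (auto simp: pd intro!: C_k_mult C_k_const)
  qed
qed

text \<open>The functions \<open>q (1 / s) exp (- 1 / s)\<close>, extended by zero to \<open>s \<le> 0\<close>. Allowing a polynomial
factor makes the family closed under differentiation, which is how the flat function
\<open>exp (- 1 / s)\<close> is seen to be smooth.\<close>

definition flat_exp :: "real poly \<Rightarrow> real \<Rightarrow> real" where
  "flat_exp q s = (if s > 0 then poly q (1 / s) * exp (- (1 / s)) else 0)"

lemma poly_times_exp_tendsto_0: "((\<lambda>y::real. poly q y * exp (- y)) \<longlongrightarrow> 0) at_top"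
proof -
  have "((\<lambda>y::real. \<Sum>i\<le>degree q. coeff q i * (y ^ i / exp y)) \<longlongrightarrow> (\<Sum>i\<le>degree q. coeff q i * 0)) at_top"
    by (intro tendsto_intros tendsto_power_div_exp_0)
  then show ?thesis
    by (simp add: poly_altdef sum_distrib_right exp_minus field_simps sum_divide_distrib)
qed

text \<open>For \<open>s > 0\<close> the chain rule gives \<open>(q - q') (1 / s) / s\<^sup>2\<close> as the new polynomial factor. At the
origin the difference quotient tends to zero because the exponential beats every polynomial in
\<open>1 / s\<close>.\<close>

lemma DERIV_flat_exp:
  "(flat_exp q has_real_derivative flat_exp (monom 1 2 * (q - pderiv q)) s) (at s)"
proof -
  consider "s > 0" | "s < 0" | "s = 0" by linarith
  then show ?thesis
  proof cases
    case 1
    have "((\<lambda>s. poly q (1 / s) * exp (- (1 / s))) has_real_derivative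
        flat_exp (monom 1 2 * (q - pderiv q)) s) (at s)"
      using 1 by (auto intro!: derivative_eq_intros poly_DERIV
          simp: flat_exp_def poly_monom field_simps power2_eq_square)
    then show ?thesis
      by (rule has_field_derivative_transform_within_open[of _ _ _ "{0<..}"])
        (use 1 in \<open>auto simp: flat_exp_def\<close>)
  next
    case 2
    have "((\<lambda>s. 0) has_real_derivative flat_exp (monom 1 2 * (q - pderiv q)) s) (at s)"
      using 2 by (simp add: flat_exp_def)
    then show ?thesis
      by (rule has_field_derivative_transform_within_open[of _ _ _ "{..<0}"])
        (use 2 in \<open>auto simp: flat_exp_def\<close>)
  next
    case 3
    have "((\<lambda>y. poly (monom 1 1 * q) y * exp (- y)) \<longlongrightarrow> 0) at_top"
      by (rule poly_times_exp_tendsto_0)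
    then have "((\<lambda>h. poly (monom 1 1 * q) (inverse h) * exp (- (inverse h))) \<longlongrightarrow> 0) (at_right 0)"
      by (rule filterlim_compose[OF _ filterlim_inverse_at_top_right])
    then have r: "((\<lambda>h. (flat_exp q (0 + h) - flat_exp q 0) / h) \<longlongrightarrow> 0) (at_right 0)"
      by (rule Lim_transform_eventually)
        (auto simp: flat_exp_def eventually_at_filter poly_monom field_simps)
    have l: "((\<lambda>h. (flat_exp q (0 + h) - flat_exp q 0) / h) \<longlongrightarrow> 0) (at_left 0)"
      by (rule Lim_transform_eventually[OF tendsto_const])
        (auto simp: flat_exp_def eventually_at_filter)
    show ?thesis
      using filterlim_split_at[OF l r] 3 by (simp add: DERIV_def flat_exp_def)
  qed
qed

lemma C_k_flat_exp:
  "C_k k (\<lambda>x. flat_exp 1 (c * (x \<bullet> j) + d))"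
proof -
  define Q where "Q n = ((\<lambda>q. monom 1 2 * (q - pderiv q)) ^^ n) (1 :: real poly)" for n
  have "(flat_exp (Q k) has_real_derivative flat_exp (Q (Suc k)) s) (at s)" for k s
    using DERIV_flat_exp[of "Q k" s] by (simp add: Q_def)
  from C_k_compose_linear[of "\<lambda>n. flat_exp (Q n)", OF this, of k 0 c j d]
  show ?thesis by (simp add: Q_def)
qed

text \<open>The product over the coordinates of \<open>exp (- 1 / (n (x\<^sub>j - c\<^sub>j)))\<close> and \<open>exp (- 1 / (n (d\<^sub>j - x\<^sub>j)))\<close>
is smooth, vanishes outside the box and tends to one inside it.\<close>

lemma test_functions_approximating_box:
  fixes \<Omega> :: "'a::euclidean_space set"
  assumes "cbox c d \<subseteq> \<Omega>"
  obtains \<eta> :: "nat \<Rightarrow> 'a \<Rightarrow> real"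
  where "\<And>n. test_function \<Omega> (\<eta> n)" "\<And>n x. 0 \<le> \<eta> n x" "\<And>n x. \<eta> n x \<le> 1"
    "\<And>n x. x \<notin> box c d \<Longrightarrow> \<eta> n x = 0"
    "\<And>x. (\<lambda>n. \<eta> n x) \<longlonglongrightarrow> indicator (box c d) x"
proof
  define \<eta> where "\<eta> n x = (\<Prod>j\<in>Basis. flat_exp 1 (real (Suc n) * (x \<bullet> j) + - (real (Suc n) * (c \<bullet> j)))
      * flat_exp 1 (- real (Suc n) * (x \<bullet> j) + real (Suc n) * (d \<bullet> j)))" for n and x :: 'a
  have fe: "0 \<le> flat_exp 1 s" "flat_exp 1 s \<le> 1" for s
    by (auto simp: flat_exp_def)
  have eq: "real (Suc n) * (x \<bullet> j) + - (real (Suc n) * (c \<bullet> j)) = real (Suc n) * ((x - c) \<bullet> j)"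
     "- real (Suc n) * (x \<bullet> j) + real (Suc n) * (d \<bullet> j) = real (Suc n) * ((d - x) \<bullet> j)" for n j and x :: 'a
    by (simp_all add: algebra_simps inner_diff_left)
  show nz: "\<eta> n x = 0" if "x \<notin> box c d" for n x
  proof -
    from that obtain j where "j \<in> Basis" "(x - c) \<bullet> j \<le> 0 \<or> (d - x) \<bullet> j \<le> 0"
      by (auto simp: mem_box inner_diff_left not_less)
    then show ?thesis
      unfolding \<eta>_def eq
      by (intro prod_zero bexI[of _ j])
        (auto simp: flat_exp_def mult_le_0_iff zero_less_mult_iff simp del: of_nat_Suc)
  qed
  show "test_function \<Omega> (\<eta> n)" for n
    unfolding test_function_def
  proof (intro conjI allI)
    show "C_k k (\<eta> n)" for k
      unfolding \<eta>_def by (intro C_k_prod C_k_mult C_k_flat_exp) auto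
    have "{x. \<eta> n x \<noteq> 0} \<subseteq> cbox c d"
      using nz box_subset_cbox by blast
    then have "closure {x. \<eta> n x \<noteq> 0} \<subseteq> cbox c d"
      by (intro closure_minimal closed_cbox)
    then show "compact (closure {x. \<eta> n x \<noteq> 0})" "closure {x. \<eta> n x \<noteq> 0} \<subseteq> \<Omega>"
      using assms bounded_subset[OF bounded_cbox] by (auto simp: compact_eq_bounded_closed)
  qed
  show "0 \<le> \<eta> n x" for n x
    unfolding \<eta>_def by (intro prod_nonneg mult_nonneg_nonneg fe)
  show "\<eta> n x \<le> 1" for n x
    unfolding \<eta>_def by (intro prod_le_1 mult_le_one conjI mult_nonneg_nonneg fe)
  show "(\<lambda>n. \<eta> n x) \<longlonglongrightarrow> indicator (box c d) x" for x
  proof (cases "x \<in> box c d")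
    case True
    have lim: "(\<lambda>n. flat_exp 1 (real (Suc n) * r)) \<longlonglongrightarrow> 1" if "r > 0" for r
    proof -
      have "(\<lambda>n. exp (- (1 / r * (1 / real (Suc n))))) \<longlonglongrightarrow> exp (- (1 / r * 0))"
        by (intro tendsto_intros LIMSEQ_Suc[OF lim_1_over_n])
      then show ?thesis using that by (simp add: flat_exp_def mult.commute zero_less_mult_iff)
    qed
    have "(\<lambda>n. \<eta> n x) \<longlonglongrightarrow> (\<Prod>j\<in>(Basis :: 'a set). 1 * 1)"
      unfolding \<eta>_def eq using True
      by (intro tendsto_prod tendsto_mult lim) (auto simp: mem_box inner_diff_left)
    then show ?thesis using True by simp
  qed (simp add: nz)
qed

section \<open>The fundamental lemma and uniqueness of weak derivatives\<close>

lemma integral_lebesgue_on_indicator: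
  fixes f :: "'a::euclidean_space \<Rightarrow> real"
  assumes "S \<in> sets lebesgue"
  shows "(LINT x|lebesgue_on S. f x) = (LINT x|lebesgue. indicator S x * f x)"
  using assms by (subst integral_restrict_space) auto

lemma integrable_lebesgue_on_indicator:
  fixes f :: "'a::euclidean_space \<Rightarrow> real"
  assumes "S \<in> sets lebesgue"
  shows "integrable (lebesgue_on S) f \<longleftrightarrow> integrable lebesgue (\<lambda>x. indicator S x * f x)"
  using assms by (subst integrable_restrict_space) auto

lemma test_function_support:
  assumes "test_function \<Omega> \<eta>"
  obtains K where "compact K" "K \<subseteq> \<Omega>" "\<And>x. x \<notin> K \<Longrightarrow> \<eta> x = 0"
    "\<And>x i. x \<notin> K \<Longrightarrow> partial_deriv i \<eta> x = 0"
proof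
  let ?K = "closure {x. \<eta> x \<noteq> 0}"
  show "compact ?K" "?K \<subseteq> \<Omega>" using assms by (auto simp: test_function_def)
  show z: "\<eta> x = 0" if "x \<notin> ?K" for x
    using that closure_subset[of "{x. \<eta> x \<noteq> 0}"] by auto
  show "partial_deriv i \<eta> x = 0" if "x \<notin> ?K" for x i
  proof -
    have "((\<lambda>x. 0 :: real) has_derivative (\<lambda>_. 0)) (at x)" by simp
    then have "(\<eta> has_derivative (\<lambda>_. 0)) (at x)"
      by (rule has_derivative_transform_within_open[of _ _ _ _ "- ?K"])
        (rule open_Compl[OF closed_closure], simp only: Compl_iff that not_False_eq_True, rule z[symmetric], erule ComplD)
    then show ?thesis by (rule partial_deriv_eq)
  qed
qed

lemma test_function_continuous:
  assumes "test_function \<Omega> \<eta>"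
  shows "continuous_on UNIV \<eta>" "i \<in> Basis \<Longrightarrow> continuous_on UNIV (partial_deriv i \<eta>)"
    "\<eta> differentiable (at x)"
proof -
  have "C_k 0 \<eta>" "C_k (Suc 0) \<eta>" using assms by (auto simp: test_function_def)
  then show "continuous_on UNIV \<eta>" "i \<in> Basis \<Longrightarrow> continuous_on UNIV (partial_deriv i \<eta>)"
    "\<eta> differentiable (at x)"
    by auto
qed

lemma test_function_mono: "test_function \<Omega> \<eta> \<Longrightarrow> \<Omega> \<subseteq> V \<Longrightarrow> test_function V \<eta>"
  by (auto simp: test_function_def)

lemma continuous_on_UNIV_measurable_lebesgue:
  "continuous_on UNIV f \<Longrightarrow> f \<in> borel_measurable (lebesgue_on S)"
  for f :: "'a::euclidean_space \<Rightarrow> real"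
  by (intro measurable_restrict_space1 measurable_completion) 
     (auto intro: borel_measurable_continuous_onI)

lemma bounded_if_compact_support:
  fixes k :: "'a::euclidean_space \<Rightarrow> real"
  assumes "continuous_on UNIV k" "compact K" "\<And>x. x \<notin> K \<Longrightarrow> k x = 0"
  obtains B where "\<And>x. \<bar>k x\<bar> \<le> B" "B > 0"
proof -
  have "compact (k ` K)" using assms by (intro compact_continuous_image) (auto intro: continuous_on_subset)
  then obtain B where B: "B > 0" "\<And>y. y \<in> k ` K \<Longrightarrow> norm y \<le> B"
    using bounded_pos compact_imp_bounded by metis
  show thesis
  proof
    show "\<bar>k x\<bar> \<le> B" for x using B assms(3)[of x] by (cases "x \<in> K") auto
  qed (rule B)
qed

lemma integrable_mult_compact_support:
  fixes k :: "'a::euclidean_space \<Rightarrow> real"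
  assumes "locally_integrable \<Omega> u" "open \<Omega>"
    and k: "continuous_on UNIV k" "compact K" "K \<subseteq> \<Omega>" "\<And>x. x \<notin> K \<Longrightarrow> k x = 0"
  shows "integrable (lebesgue_on \<Omega>) (\<lambda>x. u x * k x)"
proof -
  obtain B where B: "\<And>x. \<bar>k x\<bar> \<le> B" using bounded_if_compact_support k by metis
  have K: "K \<in> sets lebesgue" "\<Omega> \<in> sets lebesgue"
    using k assms(2) by (auto intro: lmeasurable_compact fmeasurableD)
  have u: "integrable lebesgue (\<lambda>x. indicator K x * u x)"
    using assms k K by (auto simp: locally_integrable_def integrable_lebesgue_on_indicator)
  have "integrable lebesgue (\<lambda>x. (indicator K x * u x) * k x)"
  proof (rule Bochner_Integration.integrable_bound[OF integrable_mult_left[OF u, of B]])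
    show "(\<lambda>x. indicat_real K x * u x * k x) \<in> borel_measurable lebesgue"
      using u k(1) continuous_on_UNIV_measurable_lebesgue[of k UNIV] by auto
    have "\<bar>k x\<bar> \<le> \<bar>B\<bar>" for x using B[of x] by linarith
    then show "AE x in lebesgue. norm (indicat_real K x * u x * k x)
        \<le> norm (indicat_real K x * u x * B)"
      by (intro always_eventually allI) (auto simp: abs_mult intro!: mult_left_mono)
  qed
  also have "(\<lambda>x. (indicator K x * u x) * k x) = (\<lambda>x. indicator \<Omega> x * (u x * k x))"
    using k by (auto simp: fun_eq_iff indicator_def)
  finally show ?thesis using K by (simp add: integrable_lebesgue_on_indicator)
qed

lemma integrable_mult_test_function:
  assumes "locally_integrable \<Omega> u" "open \<Omega>" "test_function \<Omega> \<eta>"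
  shows "integrable (lebesgue_on \<Omega>) (\<lambda>x. u x * \<eta> x)"
    and "i \<in> Basis \<Longrightarrow> integrable (lebesgue_on \<Omega>) (\<lambda>x. u x * partial_deriv i \<eta> x)"
proof -
  obtain K where "compact K" "K \<subseteq> \<Omega>" "\<And>x. x \<notin> K \<Longrightarrow> \<eta> x = 0"
    "\<And>x i. x \<notin> K \<Longrightarrow> partial_deriv i \<eta> x = 0"
    using test_function_support[OF assms(3)] by metis
  with assms show "integrable (lebesgue_on \<Omega>) (\<lambda>x. u x * \<eta> x)"
    "i \<in> Basis \<Longrightarrow> integrable (lebesgue_on \<Omega>) (\<lambda>x. u x * partial_deriv i \<eta> x)"
    using test_function_continuous[OF assms(3)] by (auto intro!: integrable_mult_compact_support)
qed

text \<open>At almost every point the averages of \<open>g\<close> over shrinking cubes converge to the value of \<open>g\<close>, and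
small cubes at a point of an open set lie in that set.\<close>

lemma ae_zero_if_box_integrals_zero:
  fixes g :: "'a::euclidean_space \<Rightarrow> real"
  assumes g: "\<And>a b. integrable (lebesgue_on (cbox a b)) g"
    and z: "\<And>a b. cbox a b \<subseteq> W \<Longrightarrow> (LINT x|lebesgue_on (cbox a b). g x) = 0"
    and "open W"
  shows "AE x in lebesgue. x \<in> W \<longrightarrow> g x = 0"
proof -
  have "g integrable_on cbox a b" for a b
    using g[of a b] by (intro integrable_on_lebesgue_on) auto
  then obtain N where N: "negligible N"
    "\<And>x e. \<lbrakk>x \<notin> N; 0 < e\<rbrakk> \<Longrightarrow> \<exists>d>0. \<forall>h. 0 < h \<and> h < d \<longrightarrow>
        norm (integral (cbox x (x + h *\<^sub>R One)) g /\<^sub>R h ^ DIM('a) - g x) < e"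
    using integrable_ccontinuous_explicit[of g] by auto
  have "g x = 0" if x: "x \<notin> N" "x \<in> W" for x
  proof (rule ccontr)
    assume "g x \<noteq> 0"
    then obtain d where d: "d > 0" "\<And>h. 0 < h \<Longrightarrow> h < d \<Longrightarrow>
        norm (integral (cbox x (x + h *\<^sub>R One)) g /\<^sub>R h ^ DIM('a) - g x) < \<bar>g x\<bar>"
      using N(2)[of x "\<bar>g x\<bar>"] x by auto
    obtain r where r: "r > 0" "cball x r \<subseteq> W"
      using \<open>open W\<close> x open_contains_cball by blast
    define h where "h = min (d / 2) (r / real DIM('a))"
    have h: "0 < h" "h < d" "h * real DIM('a) \<le> r"
      using d r by (auto simp: h_def min_def field_simps)
    have "cbox x (x + h *\<^sub>R One) \<subseteq> cball x r"
    proof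
      fix y assume y: "y \<in> cbox x (x + h *\<^sub>R One)"
      have "norm (y - x) \<le> (\<Sum>i\<in>Basis. \<bar>(y - x) \<bullet> i\<bar>)" by (rule norm_le_l1)
      also have "\<dots> \<le> (\<Sum>i\<in>(Basis::'a set). h)"
        using y by (intro sum_mono) (auto simp: mem_box inner_diff_left inner_add_left abs_le_iff)
      also have "\<dots> \<le> r" using h by (simp add: mult.commute)
      finally show "y \<in> cball x r" by (simp add: dist_norm norm_minus_commute)
    qed
    then have "(LINT x|lebesgue_on (cbox x (x + h *\<^sub>R One)). g x) = 0"
      using r by (intro z) auto
    then have "integral (cbox x (x + h *\<^sub>R One)) g = 0"
      using g by (subst (asm) lebesgue_integral_eq_integral) auto
    with d(2)[OF h(1,2)] show False by simp
  qed
  moreover have "AE x in lebesgue. x \<notin> N"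
    using N(1) by (intro AE_not_in) (simp add: negligible_iff_null_sets)
  ultimately show ?thesis by (auto elim: eventually_mono)
qed

text \<open>The approximating test functions are bounded by one and supported in the fixed box, so
dominated convergence carries the weak identity over to the indicator of the box.\<close>

lemma box_integral_zero_if_weakly_zero:
  fixes f :: "'a::euclidean_space \<Rightarrow> real"
  assumes "open \<Omega>" "locally_integrable \<Omega> f"
    and weak: "\<And>\<eta>. test_function \<Omega> \<eta> \<Longrightarrow> (LINT x|lebesgue_on \<Omega>. f x * \<eta> x) = 0"
    and C: "cbox c d \<subseteq> \<Omega>"
  shows "(LINT x|lebesgue. indicator (cbox c d) x * f x) = 0"
proof -
  obtain \<eta> :: "nat \<Rightarrow> 'a \<Rightarrow> real" where
    \<eta>: "\<And>n. test_function \<Omega> (\<eta> n)" "\<And>n x. 0 \<le> \<eta> n x" "\<And>n x. \<eta> n x \<le> 1"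
    "\<And>n x. x \<notin> box c d \<Longrightarrow> \<eta> n x = 0"
    "\<And>x. (\<lambda>n. \<eta> n x) \<longlonglongrightarrow> indicator (box c d) x"
    using test_functions_approximating_box[OF C] by metis
  have \<Omega>: "\<Omega> \<in> sets lebesgue" using assms(1) by auto
  let ?g = "\<lambda>x. indicator (cbox c d) x * f x"
  have g: "integrable lebesgue ?g"
    using assms(2) C compact_cbox[of c d]
      by (subst integrable_lebesgue_on_indicator[symmetric]) (auto simp: locally_integrable_def)
  have meas: "\<eta> n \<in> borel_measurable lebesgue" for n
    using continuous_on_UNIV_measurable_lebesgue[of "\<eta> n" UNIV] test_function_continuous(1)[OF \<eta>(1)] by simp
  have ms: "(\<lambda>x. ?g x * indicator (box c d) x) \<in> borel_measurable lebesgue"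
    using borel_measurable_times[OF borel_measurable_integrable[OF g] borel_measurable_indicator[of "box c d"]] by auto
  have "(LINT x|lebesgue. ?g x * \<eta> n x) = 0" for n
  proof -
    have eq: "?g x * \<eta> n x = indicator \<Omega> x * (f x * \<eta> n x)" for x
      using \<eta>(4)[of x n] C box_subset_cbox[of c d] by (cases "x \<in> box c d") (auto simp: indicator_def)
    show ?thesis
      unfolding eq using weak[OF \<eta>(1)] \<Omega> by (simp only: integral_lebesgue_on_indicator)
  qed
  moreover have "(\<lambda>n. LINT x|lebesgue. ?g x * \<eta> n x) \<longlonglongrightarrow> (LINT x|lebesgue. ?g x * indicator (box c d) x)"
  proof (rule integral_dominated_convergence[where w = "\<lambda>x. \<bar>?g x\<bar>"])
    show "AE x in lebesgue. (\<lambda>n. ?g x * \<eta> n x) \<longlonglongrightarrow> ?g x * indicator (box c d) x"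
      by (intro always_eventually allI tendsto_mult tendsto_const \<eta>)
    show "AE x in lebesgue. norm (?g x * \<eta> n x) \<le> \<bar>?g x\<bar>" for n
      using \<eta>(2,3)[of n] by (intro always_eventually allI) (auto simp: abs_mult intro!: mult_left_le)
  qed (use g meas ms in auto)
  ultimately have "(LINT x|lebesgue. ?g x * indicator (box c d) x) = 0"
    by (simp add: LIMSEQ_const_iff)
  also have "(LINT x|lebesgue. ?g x * indicator (box c d) x) = (LINT x|lebesgue. ?g x)"
  proof (rule integral_cong_AE)
    have "AE x in lebesgue. x \<notin> cbox c d - box c d"
      by (intro AE_not_in) (metis negligible_frontier_interval negligible_iff_null_sets)
    then show "AE x in lebesgue. ?g x * indicator (box c d) x = ?g x"
      by eventually_elim (auto simp: indicator_def)
  qed (use g ms in auto)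
  finally show ?thesis .
qed

text \<open>All integrals of \<open>f\<close> over boxes inside \<open>\<Omega>\<close> vanish, hence \<open>f\<close> vanishes almost everywhere in each
such box; countably many boxes cover \<open>\<Omega>\<close>.\<close>

lemma fundamental_lemma_calculus_of_variations:
  fixes f :: "'a::euclidean_space \<Rightarrow> real"
  assumes "open \<Omega>" "locally_integrable \<Omega> f"
    and weak: "\<And>\<eta>. test_function \<Omega> \<eta> \<Longrightarrow> (LINT x|lebesgue_on \<Omega>. f x * \<eta> x) = 0"
  shows "AE x in lebesgue_on \<Omega>. f x = 0"
proof -
  have *: "AE x in lebesgue. x \<in> box c d \<longrightarrow> f x = 0" if C: "cbox c d \<subseteq> \<Omega>" for c d
  proof -
    let ?g = "\<lambda>x. indicator (cbox c d) x * f x"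
    have g: "integrable lebesgue ?g"
      using assms(2) C compact_cbox[of c d]
      by (subst integrable_lebesgue_on_indicator[symmetric]) (auto simp: locally_integrable_def)
    have "AE x in lebesgue. x \<in> box c d \<longrightarrow> ?g x = 0"
    proof (rule ae_zero_if_box_integrals_zero)
      show "integrable (lebesgue_on (cbox a b)) ?g" for a b
        using integrable_mult_indicator[of "cbox a b" lebesgue, OF _ g]
        by (subst integrable_lebesgue_on_indicator) auto
      show "(LINT x|lebesgue_on (cbox a b). ?g x) = 0" if "cbox a b \<subseteq> box c d" for a b
      proof -
        have "cbox a b \<subseteq> cbox c d" using that box_subset_cbox by blast
        then have eq: "indicator (cbox a b) x * ?g x = indicator (cbox a b) x * f x" for x
          by (auto simp: indicator_def)
        have "cbox a b \<subseteq> \<Omega>" using \<open>cbox a b \<subseteq> cbox c d\<close> C by blast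
        then show ?thesis
          using box_integral_zero_if_weakly_zero[OF assms, of a b]
          by (subst integral_lebesgue_on_indicator) (auto simp only: eq sets_completionI_sets sets_lborel borel_closed closed_cbox)
      qed
    qed auto
    then show ?thesis
      using box_subset_cbox[of c d] by (auto elim!: eventually_mono simp: indicator_def split: if_splits)
  qed
  \<comment> \<open>The Lindelof property extracts a countable cover by boxes, so the exceptional null sets can be united.\<close>
  define \<F> where "\<F> = {box c d | c d. cbox c d \<subseteq> \<Omega>}"
  obtain \<F>' where F': "\<F>' \<subseteq> \<F>" "countable \<F>'" "\<Union>\<F>' = \<Union>\<F>"
    using Lindelof[of \<F>] by (auto simp: \<F>_def)
  have "\<Omega> \<subseteq> \<Union>\<F>"
  proof
    fix x assume "x \<in> \<Omega>"
    then obtain r where "r > 0" "cball x r \<subseteq> \<Omega>"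
      using \<open>open \<Omega>\<close> open_contains_cball by blast
    moreover obtain a b where "x \<in> box a b" "cbox a b \<subseteq> cball x r"
    proof -
      obtain a b where "x \<in> box a b" "box a b \<subseteq> ball x r"
        using rational_boxes[OF \<open>r > 0\<close>] by metis
      moreover from this have "cbox a b \<subseteq> cball x r"
        by (metis ball_subset_cball closed_cball closure_box closure_minimal empty_iff order_trans)
      ultimately show thesis using that by blast
    qed
    ultimately show "x \<in> \<Union>\<F>" unfolding \<F>_def by (metis (mono_tags, lifting) UnionI mem_Collect_eq order_trans)
  qed
  have "AE x in lebesgue. \<forall>S\<in>\<F>'. x \<in> S \<longrightarrow> f x = 0"
    using F' * by (intro AE_ball_countable') (auto simp: \<F>_def)
  moreover have "\<Omega> \<subseteq> \<Union>\<F>'" using F'(3) \<open>\<Omega> \<subseteq> \<Union>\<F>\<close> by simp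
  ultimately have "AE x in lebesgue. x \<in> \<Omega> \<longrightarrow> f x = 0"
    by (elim eventually_mono) (meson UnionE subsetD)
  then show ?thesis
    using assms(1) by (subst AE_restrict_space_iff) auto
qed

lemma weak_partial_unique:
  assumes "open \<Omega>" "i \<in> Basis"
    and g: "has_weak_partial \<Omega> i u g" and g': "has_weak_partial \<Omega> i u' g'"
    and eq: "AE x in lebesgue_on \<Omega>. u x = u' x"
  shows "AE x in lebesgue_on \<Omega>. g x = g' x"
proof -
  have loc: "locally_integrable \<Omega> u" "locally_integrable \<Omega> u'" "locally_integrable \<Omega> g" "locally_integrable \<Omega> g'"
    using g g' by (auto simp: has_weak_partial_def)
  have "AE x in lebesgue_on \<Omega>. g x - g' x = 0"
  proof (rule fundamental_lemma_calculus_of_variations[OF assms(1)])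
    show "locally_integrable \<Omega> (\<lambda>x. g x - g' x)"
      using loc by (auto simp: locally_integrable_def)
    fix \<eta> assume t: "test_function \<Omega> \<eta>"
    have "(LINT x|lebesgue_on \<Omega>. (g x - g' x) * \<eta> x)
        = (LINT x|lebesgue_on \<Omega>. g x * \<eta> x) - (LINT x|lebesgue_on \<Omega>. g' x * \<eta> x)"
      by (simp add: left_diff_distrib integrable_mult_test_function loc t assms)
    moreover have "(LINT x|lebesgue_on \<Omega>. u x * partial_deriv i \<eta> x)
        = (LINT x|lebesgue_on \<Omega>. u' x * partial_deriv i \<eta> x)"
      using eq by (intro integral_cong_AE borel_measurable_integrable integrable_mult_test_function loc t assms) auto
    ultimately show "(LINT x|lebesgue_on \<Omega>. (g x - g' x) * \<eta> x) = 0"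
      using g g' t by (simp add: has_weak_partial_def)
  qed
  then show ?thesis by simp
qed

lemma has_weak_partial_weak_partial:
  "has_weak_partial \<Omega> i u g \<Longrightarrow> has_weak_partial \<Omega> i u (weak_partial \<Omega> i u)"
  unfolding weak_partial_def by (rule someI[where P = "has_weak_partial \<Omega> i u"])

text \<open>Identifies the chosen representative when the weak derivative is known for a function that
agrees with \<open>u\<close> almost everywhere; that \<open>u\<close> itself has a weak derivative is what makes the choice
meaningful.\<close>

lemma weak_partial_AE_eq:
  assumes "open \<Omega>" "i \<in> Basis" "has_weak_partial \<Omega> i u' g"
    "AE x in lebesgue_on \<Omega>. u x = u' x" "has_weak_partial \<Omega> i u g'"
  shows "AE x in lebesgue_on \<Omega>. weak_partial \<Omega> i u x = g x"
  using weak_partial_unique[OF assms(1,2) has_weak_partial_weak_partial[OF assms(5)] assms(3,4)] .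

section \<open>Square integrable functions\<close>

lemma abs_mult_le_sum_squares: "\<bar>a * b\<bar> \<le> a\<^sup>2 + b\<^sup>2" for a b :: real
proof -
  have "0 \<le> (\<bar>a\<bar> - \<bar>b\<bar>)\<^sup>2" by simp
  then have "2 * (\<bar>a\<bar> * \<bar>b\<bar>) \<le> a\<^sup>2 + b\<^sup>2" by (simp add: power2_diff)
  moreover have "0 \<le> \<bar>a\<bar> * \<bar>b\<bar>" by simp
  ultimately show ?thesis unfolding abs_mult by linarith
qed

lemma square_integrable_mult:
  assumes "square_integrable N u" "square_integrable N v"
  shows "integrable N (\<lambda>x. u x * v x)"
proof (rule Bochner_Integration.integrable_bound)
  show "integrable N (\<lambda>x. (u x)\<^sup>2 + (v x)\<^sup>2)"
    using assms by (auto simp: square_integrable_def)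
  show "(\<lambda>x. u x * v x) \<in> borel_measurable N"
    using assms by (auto simp: square_integrable_def)
  show "AE x in N. norm (u x * v x) \<le> norm ((u x)\<^sup>2 + (v x)\<^sup>2)"
    using abs_mult_le_sum_squares by simp
qed

lemma square_integrable_add:
  assumes "square_integrable N u" "square_integrable N v"
  shows "square_integrable N (\<lambda>x. u x + v x)"
  using assms square_integrable_mult[OF assms]
  by (auto simp: square_integrable_def power2_sum mult.assoc)

lemma square_integrable_cmult:
  "square_integrable N u \<Longrightarrow> square_integrable N (\<lambda>x. c * u x)"
  by (auto simp: square_integrable_def power_mult_distrib)

lemma square_integrable_diff:
  assumes "square_integrable N u" "square_integrable N v"
  shows "square_integrable N (\<lambda>x. u x - v x)"
  using square_integrable_add[OF assms(1) square_integrable_cmult[OF assms(2), of "-1"]] by simp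

lemma square_integrable_sum:
  assumes "\<And>i. i \<in> J \<Longrightarrow> square_integrable N (u i)"
  shows "square_integrable N (\<lambda>x. \<Sum>i\<in>J. u i x)"
  using assms
proof (induction J rule: infinite_finite_induct)
  case (insert j J)
  then show ?case by (auto intro: square_integrable_add)
qed (simp_all add: square_integrable_def)

lemma square_integrable_bounded_mult:
  assumes "square_integrable N u" "v \<in> borel_measurable N" "AE x in N. \<bar>v x\<bar> \<le> C"
  shows "square_integrable N (\<lambda>x. v x * u x)"
  unfolding square_integrable_def
proof
  show "(\<lambda>x. v x * u x) \<in> borel_measurable N"
    using assms by (auto simp: square_integrable_def)
  show "integrable N (\<lambda>x. (v x * u x)\<^sup>2)"
  proof (rule Bochner_Integration.integrable_bound)
    show "integrable N (\<lambda>x. C\<^sup>2 * (u x)\<^sup>2)" using assms by (auto simp: square_integrable_def)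
    show "AE x in N. norm ((v x * u x)\<^sup>2) \<le> norm (C\<^sup>2 * (u x)\<^sup>2)"
      using assms(3)
    proof eventually_elim
      case (elim x)
      then have "(v x)\<^sup>2 \<le> C\<^sup>2" by (simp add: abs_le_square_iff[symmetric])
      then show ?case by (simp add: power_mult_distrib mult_right_mono)
    qed
  qed (use assms in \<open>auto simp: square_integrable_def\<close>)
qed

lemma square_integrable_cong_AE:
  assumes "square_integrable N u" "v \<in> borel_measurable N" "AE x in N. u x = v x"
  shows "square_integrable N v"
proof -
  have "AE x in N. (u x)\<^sup>2 = (v x)\<^sup>2" using assms(3) by eventually_elim simp
  then show ?thesis
    using assms unfolding square_integrable_def
    by (auto intro: integrable_cong_AE_imp)
qed

text \<open>The quadratic \<open>t \<mapsto> \<integral> (u - t v)\<^sup>2\<close> is nonnegative.\<close>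

lemma cauchy_schwarz_square_integrable:
  assumes u: "square_integrable N u" and v: "square_integrable N v"
  shows "(LINT x|N. u x * v x)\<^sup>2 \<le> (LINT x|N. (u x)\<^sup>2) * (LINT x|N. (v x)\<^sup>2)"
proof -
  define A B D where "A = (LINT x|N. (u x)\<^sup>2)" "B = (LINT x|N. (v x)\<^sup>2)" "D = (LINT x|N. u x * v x)"
  have i: "integrable N (\<lambda>x. (u x)\<^sup>2)" "integrable N (\<lambda>x. (v x)\<^sup>2)" "integrable N (\<lambda>x. u x * v x)"
    using u v square_integrable_mult[OF u v] by (auto simp: square_integrable_def)
  have B0: "0 \<le> B" by (simp add: A_B_D_def)
  have q: "0 \<le> A - 2 * t * D + t\<^sup>2 * B" for t
  proof -
    have "0 \<le> (LINT x|N. (u x - t * v x)\<^sup>2)" by simp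
    also have "\<dots> = (LINT x|N. (u x)\<^sup>2 - 2 * t * (u x * v x) + t\<^sup>2 * (v x)\<^sup>2)"
      by (intro Bochner_Integration.integral_cong) (auto simp: power2_eq_square algebra_simps)
    also have "\<dots> = A - 2 * t * D + t\<^sup>2 * B"
      using i by (simp add: A_B_D_def)
    finally show ?thesis .
  qed
  \<comment> \<open>If \<open>B = 0\<close>, the nonnegative function \<open>t \<mapsto> A - 2 t D\<close> must be constant; otherwise \<open>t = D / B\<close>
    is its minimiser.\<close>
  show ?thesis
  proof (cases "B = 0")
    case True
    have "D = 0"
    proof (rule ccontr)
      assume "D \<noteq> 0"
      with q[of "(A + 1) / (2 * D)"] True show False by simp
    qed
    with True show ?thesis by (simp add: A_B_D_def)
  next
    case False
    then have "D\<^sup>2 \<le> A * B"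
      using q[of "D / B"] B0 by (simp add: field_simps power2_eq_square)
    then show ?thesis by (simp add: A_B_D_def)
  qed
qed

lemma integral_mult_tendsto_0:
  assumes "\<And>k. square_integrable N (u k)" "\<And>k. square_integrable N (v k)"
    and u: "(\<lambda>k. LINT x|N. (u k x)\<^sup>2) \<longlonglongrightarrow> 0" and v: "\<And>k. (LINT x|N. (v k x)\<^sup>2) \<le> C"
  shows "(\<lambda>k. LINT x|N. u k x * v k x) \<longlonglongrightarrow> (0::real)"
proof -
  have "(\<lambda>k. (LINT x|N. u k x * v k x)\<^sup>2) \<longlonglongrightarrow> 0"
  proof (rule tendsto_sandwich[OF always_eventually always_eventually tendsto_const])
    show "\<forall>k. (LINT x|N. u k x * v k x)\<^sup>2 \<le> (LINT x|N. (u k x)\<^sup>2) * C"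
    proof
      fix k
      have "(LINT x|N. u k x * v k x)\<^sup>2 \<le> (LINT x|N. (u k x)\<^sup>2) * (LINT x|N. (v k x)\<^sup>2)"
        by (intro cauchy_schwarz_square_integrable assms)
      also have "\<dots> \<le> (LINT x|N. (u k x)\<^sup>2) * C" using v by (intro mult_left_mono) auto
      finally show "(LINT x|N. u k x * v k x)\<^sup>2 \<le> (LINT x|N. (u k x)\<^sup>2) * C" .
    qed
    show "(\<lambda>k. (LINT x|N. (u k x)\<^sup>2) * C) \<longlonglongrightarrow> 0"
      using tendsto_mult_right[OF u, of C] by simp
  qed auto
  from tendsto_real_sqrt[OF this] show ?thesis
    by (simp add: tendsto_rabs_zero_iff)
qed

text \<open>Expand \<open>u\<^sub>k v\<^sub>k = (u' + (u\<^sub>k - u')) (v' + (v\<^sub>k - v'))\<close>; each product containing a difference tends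
to zero by the Cauchy-Schwarz inequality.\<close>

lemma L2_limit_product:
  assumes "\<And>k. square_integrable N (u k)" "\<And>k. square_integrable N (v k)"
    "square_integrable N u'" "square_integrable N v'"
    and u: "(\<lambda>k. LINT x|N. (u k x - u' x)\<^sup>2) \<longlonglongrightarrow> 0"
    and v: "(\<lambda>k. LINT x|N. (v k x - v' x)\<^sup>2) \<longlonglongrightarrow> 0"
  shows "(\<lambda>k. LINT x|N. u k x * v k x) \<longlonglongrightarrow> (LINT x|N. u' x * v' x)"
proof -
  note d = square_integrable_diff
  obtain C where C: "\<And>k. (LINT x|N. (u k x - u' x)\<^sup>2) \<le> C"
    using convergent_imp_Bseq[OF convergentI[OF u]] unfolding Bseq_def real_norm_def by (meson abs_le_D1)
  have "(\<lambda>k. LINT x|N. (v k x - v' x) * (u k x - u' x)) \<longlonglongrightarrow> 0"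
    by (rule integral_mult_tendsto_0[OF d d v C]) (use assms in auto)
  moreover have "(\<lambda>k. LINT x|N. (u k x - u' x) * v' x) \<longlonglongrightarrow> 0"
    by (rule integral_mult_tendsto_0[OF d _ u order_refl]) (use assms in auto)
  moreover have "(\<lambda>k. LINT x|N. (v k x - v' x) * u' x) \<longlonglongrightarrow> 0"
    by (rule integral_mult_tendsto_0[OF d _ v order_refl]) (use assms in auto)
  ultimately have "(\<lambda>k. (LINT x|N. u' x * v' x) + (LINT x|N. (v k x - v' x) * (u k x - u' x))
     + (LINT x|N. (u k x - u' x) * v' x) + (LINT x|N. (v k x - v' x) * u' x)) \<longlonglongrightarrow>
      (LINT x|N. u' x * v' x) + 0 + 0 + 0"
    by (intro tendsto_intros)
  moreover have "(LINT x|N. u' x * v' x) + (LINT x|N. (v k x - v' x) * (u k x - u' x))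
     + (LINT x|N. (u k x - u' x) * v' x) + (LINT x|N. (v k x - v' x) * u' x)
    = (LINT x|N. u k x * v k x)" for k
  proof -
    have "integrable N (\<lambda>x. (v k x - v' x) * (u k x - u' x))" "integrable N (\<lambda>x. (u k x - u' x) * v' x)"
      "integrable N (\<lambda>x. (v k x - v' x) * u' x)" "integrable N (\<lambda>x. u' x * v' x)"
      by (intro square_integrable_mult d assms)+
    then show ?thesis
      by (subst Bochner_Integration.integral_add[symmetric], (simp; fail), (simp; fail))+
        (auto intro!: Bochner_Integration.integral_cong simp: algebra_simps)
  qed
  ultimately show ?thesis by simp
qed

section \<open>Sobolev functions on an open set\<close>

lemma finite_measure_lebesgue_on_bounded:
  fixes \<Omega> :: "'a::euclidean_space set"
  assumes "open \<Omega>" "bounded \<Omega>"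
  shows "finite_measure (lebesgue_on \<Omega>)"
proof (rule finite_measureI)
  have "\<Omega> \<in> lmeasurable" using assms by (simp add: lmeasurable_open)
  then show "emeasure (lebesgue_on \<Omega>) (space (lebesgue_on \<Omega>)) \<noteq> \<infinity>"
    by (auto simp: emeasure_restrict_space fmeasurable_def)
qed

lemma L2_locally_integrable:
  fixes \<Omega> :: "'a::euclidean_space set"
  assumes "open \<Omega>" "L2 \<Omega> u"
  shows "locally_integrable \<Omega> u"
  unfolding locally_integrable_def
proof (intro allI impI)
  fix K :: "'a set" assume K: "compact K \<and> K \<subseteq> \<Omega>"
  have m: "K \<in> sets lebesgue" "\<Omega> \<in> sets lebesgue" "K \<in> lmeasurable"
    using K assms by (auto intro: lmeasurable_compact fmeasurableD)
  have "square_integrable (lebesgue_on \<Omega>) (indicator K)"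
  proof -
    have "integrable lebesgue (indicator K :: 'a \<Rightarrow> real)" using m(3) by (intro integrable_real_indicator) (auto simp: fmeasurable_def)
    moreover have "indicator \<Omega> x * (indicator K x)\<^sup>2 = (indicator K x :: real)" for x
      using K by (auto simp: indicator_def)
    moreover have "(indicator K :: 'a \<Rightarrow> real) \<in> borel_measurable (lebesgue_on \<Omega>)"
      using m by (intro measurable_restrict_space1 borel_measurable_indicator)
    ultimately show ?thesis using m
      by (simp add: square_integrable_def integrable_lebesgue_on_indicator)
  qed
  from square_integrable_mult[OF this] assms(2)
  have "integrable lebesgue (\<lambda>x. indicator \<Omega> x * (indicator K x * u x))"
    using m by (simp add: L2_def integrable_lebesgue_on_indicator)
  also have "(\<lambda>x. indicator \<Omega> x * (indicator K x * u x)) = (\<lambda>x. indicator K x * u x)"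
    using K by (auto simp: indicator_def fun_eq_iff)
  finally show "integrable (lebesgue_on K) u" using m by (simp add: integrable_lebesgue_on_indicator)
qed

lemma H1_D:
  assumes "open \<Omega>" "H1 \<Omega> u" "i \<in> Basis"
  shows "has_weak_partial \<Omega> i u (weak_partial \<Omega> i u)" "L2 \<Omega> u"
proof -
  obtain g where g: "L2 \<Omega> g" "has_weak_partial \<Omega> i u g"
    using assms by (auto simp: H1_def)
  show "has_weak_partial \<Omega> i u (weak_partial \<Omega> i u)"
    by (rule has_weak_partial_weak_partial[OF g(2)])
  show "L2 \<Omega> u" using assms by (auto simp: H1_def)
qed

lemma AE_lebesgue_on_measurable_cong:
  fixes u v :: "'a::euclidean_space \<Rightarrow> real"
  assumes "open \<Omega>" "u \<in> borel_measurable (lebesgue_on \<Omega>)" "AE x in lebesgue_on \<Omega>. u x = v x"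
  shows "v \<in> borel_measurable (lebesgue_on \<Omega>)"
proof -
  have \<Omega>: "\<Omega> \<in> sets lebesgue" using assms by auto
  have m: "(\<lambda>x. if x \<in> \<Omega> then u x else 0) \<in> borel_measurable lebesgue"
    using assms(2) borel_measurable_if[OF \<Omega>] by blast
  have "AE x in lebesgue. (if x \<in> \<Omega> then u x else 0) = (if x \<in> \<Omega> then v x else 0)"
    using assms(3) \<Omega> by (subst (asm) AE_restrict_space_iff) (auto elim: eventually_mono)
  then have "(\<lambda>x. if x \<in> \<Omega> then v x else 0) \<in> borel_measurable lebesgue"
    by (rule borel_measurable_AE[OF m])
  then show ?thesis using borel_measurable_if[OF \<Omega>] by blast
qed

lemma L2_cong_AE:
  assumes "open \<Omega>" "L2 \<Omega> u" "AE x in lebesgue_on \<Omega>. u x = v x"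
  shows "L2 \<Omega> v"
proof -
  have "u \<in> borel_measurable (lebesgue_on \<Omega>)"
    using assms(2) by (simp add: L2_def square_integrable_def)
  from AE_lebesgue_on_measurable_cong[OF assms(1) this assms(3)] show ?thesis
    unfolding L2_def by (rule square_integrable_cong_AE[OF assms(2)[unfolded L2_def] _ assms(3)])
qed

text \<open>Membership in \<open>H\<^sup>1\<close> only asserts that some weak derivative is square integrable. By uniqueness
the chosen one is too.\<close>

lemma H1_weak_partial_L2:
  assumes "open \<Omega>" "H1 \<Omega> u" "i \<in> Basis"
  shows "L2 \<Omega> (weak_partial \<Omega> i u)"
proof -
  obtain g where g: "L2 \<Omega> g" "has_weak_partial \<Omega> i u g"
    using assms by (auto simp: H1_def)
  have "AE x in lebesgue_on \<Omega>. g x = weak_partial \<Omega> i u x"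
    by (rule weak_partial_unique[OF assms(1,3) g(2) has_weak_partial_weak_partial[OF g(2)]]) simp
  from L2_cong_AE[OF assms(1) g(1) this] show ?thesis .
qed

lemma has_weak_partial_diff:
  assumes "open \<Omega>" "i \<in> Basis" "has_weak_partial \<Omega> i u g" "has_weak_partial \<Omega> i v h"
  shows "has_weak_partial \<Omega> i (\<lambda>x. u x - v x) (\<lambda>x. g x - h x)"
proof -
  have loc: "locally_integrable \<Omega> u" "locally_integrable \<Omega> v" "locally_integrable \<Omega> g" "locally_integrable \<Omega> h"
    using assms by (auto simp: has_weak_partial_def)
  show ?thesis
    unfolding has_weak_partial_def
  proof (intro conjI allI impI)
    show "locally_integrable \<Omega> (\<lambda>x. u x - v x)" "locally_integrable \<Omega> (\<lambda>x. g x - h x)"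
      using loc by (auto simp: locally_integrable_def)
    fix \<eta> assume t: "test_function \<Omega> \<eta>"
    show "(LINT x|lebesgue_on \<Omega>. (u x - v x) * partial_deriv i \<eta> x)
        = - (LINT x|lebesgue_on \<Omega>. (g x - h x) * \<eta> x)"
      using assms(3,4) t
      by (simp add: left_diff_distrib integrable_mult_test_function loc t assms has_weak_partial_def)
  qed
qed

lemma H1_diff:
  assumes "open \<Omega>" "H1 \<Omega> u" "H1 \<Omega> v"
  shows "H1 \<Omega> (\<lambda>x. u x - v x)"
    and "i \<in> Basis \<Longrightarrow> AE x in lebesgue_on \<Omega>.
      weak_partial \<Omega> i (\<lambda>x. u x - v x) x = weak_partial \<Omega> i u x - weak_partial \<Omega> i v x"
proof -
  have d: "has_weak_partial \<Omega> i (\<lambda>x. u x - v x) (\<lambda>x. weak_partial \<Omega> i u x - weak_partial \<Omega> i v x)"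
    if "i \<in> Basis" for i
    by (intro has_weak_partial_diff H1_D(1) that assms)
  have "L2 \<Omega> (\<lambda>x. weak_partial \<Omega> i u x - weak_partial \<Omega> i v x)" if "i \<in> Basis" for i
    using H1_weak_partial_L2[OF assms(1) _ that] assms
    by (auto simp: L2_def intro: square_integrable_diff)
  then show "H1 \<Omega> (\<lambda>x. u x - v x)"
    using d assms by (auto simp: H1_def L2_def intro: square_integrable_diff)
  show "AE x in lebesgue_on \<Omega>.
      weak_partial \<Omega> i (\<lambda>x. u x - v x) x = weak_partial \<Omega> i u x - weak_partial \<Omega> i v x"
    if "i \<in> Basis"
    by (rule weak_partial_AE_eq[OF assms(1) that d[OF that] _ d[OF that]]) simp
qed

lemma H2_D:
  assumes "H2 \<Omega> u"
  shows "H1 \<Omega> u" "i \<in> Basis \<Longrightarrow> H1 \<Omega> (weak_partial \<Omega> i u)"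
  using assms by (auto simp: H2_def)

lemma norm_weak_gradient_squared:
  "(norm (weak_gradient \<Omega> u x))\<^sup>2 = (\<Sum>i\<in>Basis. (weak_partial \<Omega> i u x)\<^sup>2)"
  unfolding power2_norm_eq_inner weak_gradient_def
  by (subst euclidean_inner) (simp add: power2_eq_square)

section \<open>Green's formula under the Neumann condition\<close>

lemma square_integrable_if_AE_bounded:
  assumes "finite_measure N" "f \<in> borel_measurable N" "AE x in N. \<bar>f x\<bar> \<le> C"
  shows "square_integrable N f"
proof -
  interpret finite_measure N by fact
  have "square_integrable N (\<lambda>_. 1)" by (simp add: square_integrable_def)
  from square_integrable_bounded_mult[OF this assms(2,3)] show ?thesis by simp
qed

lemma continuous_bounded_on_bounded:
  fixes f :: "'a::euclidean_space \<Rightarrow> real"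
  assumes "continuous_on UNIV f" "bounded S"
  obtains C where "\<And>x. x \<in> S \<Longrightarrow> \<bar>f x\<bar> \<le> C"
proof -
  have "compact (f ` closure S)"
    using assms by (intro compact_continuous_image) (auto intro: continuous_on_subset)
  then obtain C where "\<And>y. y \<in> f ` closure S \<Longrightarrow> norm y \<le> C"
    using compact_imp_bounded bounded_iff by metis
  then have "\<bar>f x\<bar> \<le> C" if "x \<in> S" for x
    using that closure_subset[of S] by (metis imageI real_norm_def subsetD)
  then show thesis by (rule that)
qed

lemma C_1_continuous:
  assumes "C_k 1 f"
  shows "continuous_on UNIV f" "i \<in> Basis \<Longrightarrow> continuous_on UNIV (partial_deriv i f)"
    "f differentiable (at x)"
proof -
  have "C_k (Suc 0) f" using assms by simp
  from C_k_SucD[OF this] this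
  show "continuous_on UNIV f" "i \<in> Basis \<Longrightarrow> continuous_on UNIV (partial_deriv i f)"
    "f differentiable (at x)" by auto
qed

lemma continuous_L2:
  fixes f :: "'a::euclidean_space \<Rightarrow> real"
  assumes "open \<Omega>" "bounded \<Omega>" "continuous_on UNIV f"
  shows "L2 \<Omega> f"
proof -
  obtain C where C: "\<And>x. x \<in> \<Omega> \<Longrightarrow> \<bar>f x\<bar> \<le> C"
    using continuous_bounded_on_bounded[OF assms(3,2)] by blast
  have "AE x in lebesgue_on \<Omega>. \<bar>f x\<bar> \<le> C"
    using C by (intro AE_I2) auto
  then show ?thesis
    unfolding L2_def
    by (intro square_integrable_if_AE_bounded finite_measure_lebesgue_on_bounded assms
        continuous_on_UNIV_measurable_lebesgue)
qed

lemma space_surface_measure: "space (surface_measure \<Omega>) = frontier \<Omega>"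
  by (simp add: surface_measure_def space_restrict_space)

lemma finite_measure_surface_measure:
  fixes \<Omega> :: "'a::euclidean_space set"
  assumes "regular_boundary \<Omega>"
  shows "finite_measure (surface_measure \<Omega>)"
proof (rule finite_measureI)
  have "emeasure (hausdorff_measure (DIM('a) - 1)) (frontier \<Omega>) < \<infinity>"
    using assms by (simp add: regular_boundary_def)
  then show "emeasure (surface_measure \<Omega>) (space (surface_measure \<Omega>)) \<noteq> \<infinity>"
    unfolding space_surface_measure unfolding surface_measure_def
    by (subst emeasure_restrict_space) auto
qed

lemma continuous_measurable_surface:
  fixes f :: "'a::euclidean_space \<Rightarrow> real"
  assumes "continuous_on UNIV f"
  shows "f \<in> borel_measurable (surface_measure \<Omega>)"
proof -
  have "f \<in> borel_measurable borel" using assms by (rule borel_measurable_continuous_onI)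
  then have "f \<in> borel_measurable (hausdorff_measure (DIM('a) - 1))"
    by (simp add: measurable_def)
  then show ?thesis unfolding surface_measure_def by (rule measurable_restrict_space1)
qed

lemma continuous_square_integrable_surface:
  fixes f :: "'a::euclidean_space \<Rightarrow> real"
  assumes "regular_boundary \<Omega>" "bounded \<Omega>" "continuous_on UNIV f"
  shows "square_integrable (surface_measure \<Omega>) f"
proof -
  obtain C where C: "\<And>x. x \<in> frontier \<Omega> \<Longrightarrow> \<bar>f x\<bar> \<le> C"
    using continuous_bounded_on_bounded[OF assms(3), of "frontier \<Omega>"] assms(2)
    by (metis bounded_closure bounded_subset frontier_def Diff_subset)
  have "AE x in surface_measure \<Omega>. \<bar>f x\<bar> \<le> C"
    using C by (intro AE_I2) (simp add: space_surface_measure)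
  then show ?thesis
    by (intro square_integrable_if_AE_bounded finite_measure_surface_measure assms
        continuous_measurable_surface)
qed

lemma partial_deriv_prod_C1:
  assumes "C_k 1 f" "C_k 1 g"
  shows "partial_deriv i (\<lambda>x. f x * g x) = (\<lambda>x. f x * partial_deriv i g x + partial_deriv i f x * g x)"
  using C_1_continuous(3)[OF assms(1)] C_1_continuous(3)[OF assms(2)]
  by (intro ext partial_deriv_mult)

text \<open>The divergence theorem for the product \<open>f g\<close>.\<close>

lemma regular_boundary_integration_by_parts_C1:
  fixes \<Omega> :: "'a::euclidean_space set"
  assumes "open \<Omega>" "bounded \<Omega>" "regular_boundary \<Omega>" "i \<in> Basis"
    and f: "C_k 1 f" and g: "C_k 1 g"
  shows "(LINT x|lebesgue_on \<Omega>. f x * partial_deriv i g x)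
      + (LINT x|lebesgue_on \<Omega>. partial_deriv i f x * g x)
    = (LINT x|surface_measure \<Omega>. f x * g x * (outward_normal \<Omega> x \<bullet> i))"
proof -
  have "C_k 1 (\<lambda>x. f x * g x)" by (intro C_k_mult f g)
  then have "(LINT x|lebesgue_on \<Omega>. partial_deriv i (\<lambda>x. f x * g x) x)
      = (LINT x|surface_measure \<Omega>. f x * g x * (outward_normal \<Omega> x \<bullet> i))"
    using assms(3,4) unfolding regular_boundary_def by blast
  moreover have "integrable (lebesgue_on \<Omega>) (\<lambda>x. f x * partial_deriv i g x)"
    "integrable (lebesgue_on \<Omega>) (\<lambda>x. partial_deriv i f x * g x)"
    using continuous_L2[OF assms(1,2)] C_1_continuous f g assms(4)
    by (auto simp: L2_def intro!: square_integrable_mult)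
  ultimately show ?thesis
    by (simp add: partial_deriv_prod_C1[OF f g])
qed

text \<open>In the integration by parts formula with a test function the boundary term vanishes, as the
support of the test function avoids the frontier.\<close>

lemma C1_has_weak_partial:
  fixes \<Omega> :: "'a::euclidean_space set"
  assumes "open \<Omega>" "bounded \<Omega>" "regular_boundary \<Omega>" "i \<in> Basis" and f: "C_k 1 f"
  shows "has_weak_partial \<Omega> i f (partial_deriv i f)"
  unfolding has_weak_partial_def
proof (intro conjI allI impI)
  show "locally_integrable \<Omega> f" "locally_integrable \<Omega> (partial_deriv i f)"
    using C_1_continuous[OF f] assms by (auto intro!: L2_locally_integrable continuous_L2)
  fix \<eta> assume t: "test_function \<Omega> \<eta>"
  obtain K where K: "K \<subseteq> \<Omega>" "\<And>x. x \<notin> K \<Longrightarrow> \<eta> x = 0"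
    using test_function_support[OF t] by metis
  have "\<eta> x = 0" if "x \<in> frontier \<Omega>" for x
    using that K assms(1) by (auto simp: frontier_def interior_open)
  then have "(LINT x|surface_measure \<Omega>. f x * \<eta> x * (outward_normal \<Omega> x \<bullet> i))
      = (LINT x|surface_measure \<Omega>. 0)"
    by (intro Bochner_Integration.integral_cong) (auto simp: space_surface_measure)
  moreover have "C_k 1 \<eta>" using t by (simp add: test_function_def)
  ultimately show "(LINT x|lebesgue_on \<Omega>. f x * partial_deriv i \<eta> x)
      = - (LINT x|lebesgue_on \<Omega>. partial_deriv i f x * \<eta> x)"
    using regular_boundary_integration_by_parts_C1[OF assms(1-4) f, of \<eta>] by simp
qed

lemma C1_H1:
  fixes \<Omega> :: "'a::euclidean_space set"
  assumes "open \<Omega>" "bounded \<Omega>" "regular_boundary \<Omega>" and f: "C_k 1 f"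
  shows "H1 \<Omega> f"
    and "i \<in> Basis \<Longrightarrow> AE x in lebesgue_on \<Omega>. weak_partial \<Omega> i f x = partial_deriv i f x"
proof -
  show "H1 \<Omega> f"
    using C_1_continuous[OF f] C1_has_weak_partial[OF assms(1-3) _ f] continuous_L2[OF assms(1,2)]
    unfolding H1_def by blast
  show "AE x in lebesgue_on \<Omega>. weak_partial \<Omega> i f x = partial_deriv i f x" if "i \<in> Basis"
    by (rule weak_partial_AE_eq[OF assms(1) that C1_has_weak_partial[OF assms(1-3) that f] _
          C1_has_weak_partial[OF assms(1-3) that f]]) simp
qed

lemma H1_norm_squared:
  fixes \<Omega> :: "'a::euclidean_space set"
  assumes "open \<Omega>" "H1 \<Omega> u"
  shows "(H1_norm \<Omega> u)\<^sup>2 = (LINT x|lebesgue_on \<Omega>. (u x)\<^sup>2)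
    + (\<Sum>i\<in>Basis. LINT x|lebesgue_on \<Omega>. (weak_partial \<Omega> i u x)\<^sup>2)"
proof -
  have "0 \<le> (LINT x|lebesgue_on \<Omega>. (u x)\<^sup>2 + (norm (weak_gradient \<Omega> u x))\<^sup>2)"
    by (intro Bochner_Integration.integral_nonneg) auto
  moreover have "integrable (lebesgue_on \<Omega>) (\<lambda>x. (u x)\<^sup>2)"
    "\<And>i. i \<in> Basis \<Longrightarrow> integrable (lebesgue_on \<Omega>) (\<lambda>x. (weak_partial \<Omega> i u x)\<^sup>2)"
    using H1_weak_partial_L2[OF assms] assms by (auto simp: L2_def square_integrable_def H1_def)
  ultimately show ?thesis
    unfolding H1_norm_def norm_weak_gradient_squared
    by (simp add: Bochner_Integration.integral_sum)
qed

text \<open>The squared \<open>H\<^sup>1\<close> norm of the difference is the sum of the squared \<open>L\<^sup>2\<close> distances of the functions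
and of their derivatives, once the weak derivative of the difference is identified with the
difference of the classical and the weak one.\<close>

lemma H1_convergence_C1:
  fixes \<Omega> :: "'a::euclidean_space set"
  assumes \<Omega>: "open \<Omega>" "bounded \<Omega>" "regular_boundary \<Omega>" and u: "H1 \<Omega> u"
    and w: "\<And>k. C_k 1 (w k)" and lim: "(\<lambda>k. H1_norm \<Omega> (\<lambda>x. w k x - u x)) \<longlonglongrightarrow> 0"
  shows "(\<lambda>k. LINT x|lebesgue_on \<Omega>. (w k x - u x)\<^sup>2) \<longlonglongrightarrow> 0"
    and "i \<in> Basis \<Longrightarrow>
      (\<lambda>k. LINT x|lebesgue_on \<Omega>. (partial_deriv i (w k) x - weak_partial \<Omega> i u x)\<^sup>2) \<longlonglongrightarrow> 0"
proof -
  define a where "a k = (LINT x|lebesgue_on \<Omega>. (w k x - u x)\<^sup>2)" for k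
  define b where "b i k = (LINT x|lebesgue_on \<Omega>. (partial_deriv i (w k) x - weak_partial \<Omega> i u x)\<^sup>2)" for i k
  have "(H1_norm \<Omega> (\<lambda>x. w k x - u x))\<^sup>2 = a k + (\<Sum>i\<in>Basis. b i k)" for k
  proof -
    have "(LINT x|lebesgue_on \<Omega>. (weak_partial \<Omega> i (\<lambda>x. w k x - u x) x)\<^sup>2) = b i k"
      if i: "i \<in> Basis" for i
      unfolding b_def
    proof (rule integral_cong_AE)
      show "AE x in lebesgue_on \<Omega>. (weak_partial \<Omega> i (\<lambda>x. w k x - u x) x)\<^sup>2
          = (partial_deriv i (w k) x - weak_partial \<Omega> i u x)\<^sup>2"
        using H1_diff(2)[OF \<Omega>(1) C1_H1(1)[OF \<Omega> w[of k]] u i] C1_H1(2)[OF \<Omega> w[of k] i]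
        by eventually_elim simp
      show "(\<lambda>x. (weak_partial \<Omega> i (\<lambda>x. w k x - u x) x)\<^sup>2) \<in> borel_measurable (lebesgue_on \<Omega>)"
        using H1_weak_partial_L2[OF \<Omega>(1) H1_diff(1)[OF \<Omega>(1) C1_H1(1)[OF \<Omega> w[of k]] u] i]
        by (auto simp: L2_def square_integrable_def)
      show "(\<lambda>x. (partial_deriv i (w k) x - weak_partial \<Omega> i u x)\<^sup>2) \<in> borel_measurable (lebesgue_on \<Omega>)"
        using H1_weak_partial_L2[OF \<Omega>(1) u i]
          continuous_on_UNIV_measurable_lebesgue[OF C_1_continuous(2)[OF w[of k] i]]
        by (auto simp: L2_def square_integrable_def)
    qed
    then show ?thesis
      using H1_norm_squared[OF \<Omega>(1) H1_diff(1)[OF \<Omega>(1) C1_H1(1)[OF \<Omega> w[of k]] u]]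
      by (simp add: a_def)
  qed
  then have L: "(\<lambda>k. a k + (\<Sum>i\<in>Basis. b i k)) \<longlonglongrightarrow> 0"
    using tendsto_power[OF lim, of 2] by simp
  have nn: "0 \<le> a k" "0 \<le> b i k" for i k
    by (simp_all add: a_def b_def)
  show "(\<lambda>k. LINT x|lebesgue_on \<Omega>. (w k x - u x)\<^sup>2) \<longlonglongrightarrow> 0"
    unfolding a_def[symmetric]
    by (rule tendsto_sandwich[OF _ _ tendsto_const L]) (use nn in \<open>auto intro!: sum_nonneg always_eventually\<close>)
  show "(\<lambda>k. LINT x|lebesgue_on \<Omega>. (partial_deriv i (w k) x - weak_partial \<Omega> i u x)\<^sup>2) \<longlonglongrightarrow> 0"
    if i: "i \<in> Basis"
    unfolding b_def[symmetric]
  proof (rule tendsto_sandwich[OF _ _ tendsto_const L])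
    have "b i k \<le> a k + (\<Sum>i\<in>Basis. b i k)" for k
      using nn(1)[of k] member_le_sum[of i Basis "\<lambda>i. b i k"] i nn(2) by (auto intro: add_increasing)
    then show "\<forall>\<^sub>F k in sequentially. b i k \<le> a k + (\<Sum>i\<in>Basis. b i k)" by simp
  qed (use nn in auto)
qed

lemma square_integral_tendsto:
  assumes "\<And>k. square_integrable N (u k)" "square_integrable N u'"
    "(\<lambda>k. LINT x|N. (u k x - u' x)\<^sup>2) \<longlonglongrightarrow> 0"
  shows "(\<lambda>k. LINT x|N. (u k x)\<^sup>2) \<longlonglongrightarrow> (LINT x|N. (u' x)\<^sup>2)"
  using L2_limit_product[of N u u u' u'] assms by (simp add: power2_eq_square)

lemma H1_bounded_C1:
  fixes \<Omega> :: "'a::euclidean_space set"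
  assumes \<Omega>: "open \<Omega>" "bounded \<Omega>" "regular_boundary \<Omega>" and u: "H1 \<Omega> u"
    and w: "\<And>k. C_k 1 (w k)" and lim: "(\<lambda>k. H1_norm \<Omega> (\<lambda>x. w k x - u x)) \<longlonglongrightarrow> 0"
  obtains C where "\<And>k. (H1_norm \<Omega> (w k))\<^sup>2 \<le> C"
proof -
  note L = H1_convergence_C1[OF \<Omega> u w lim]
  have s: "square_integrable (lebesgue_on \<Omega>) (w k)"
     "i \<in> Basis \<Longrightarrow> square_integrable (lebesgue_on \<Omega>) (partial_deriv i (w k))"
     "square_integrable (lebesgue_on \<Omega>) u"
     "i \<in> Basis \<Longrightarrow> square_integrable (lebesgue_on \<Omega>) (weak_partial \<Omega> i u)" for i k
    using continuous_L2[OF \<Omega>(1,2)] C_1_continuous[OF w] H1_weak_partial_L2[OF \<Omega>(1) u] u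
    by (auto simp: L2_def H1_def)
  have "(\<lambda>k. (LINT x|lebesgue_on \<Omega>. (w k x)\<^sup>2) + (\<Sum>i\<in>Basis. LINT x|lebesgue_on \<Omega>. (partial_deriv i (w k) x)\<^sup>2))
     \<longlonglongrightarrow> (LINT x|lebesgue_on \<Omega>. (u x)\<^sup>2) + (\<Sum>i\<in>Basis. LINT x|lebesgue_on \<Omega>. (weak_partial \<Omega> i u x)\<^sup>2)"
    by (intro tendsto_add tendsto_sum square_integral_tendsto s L)
  moreover have "(LINT x|lebesgue_on \<Omega>. (partial_deriv i (w k) x)\<^sup>2)
      = (LINT x|lebesgue_on \<Omega>. (weak_partial \<Omega> i (w k) x)\<^sup>2)" if i: "i \<in> Basis" for i k
  proof (rule integral_cong_AE)
    show "AE x in lebesgue_on \<Omega>. (partial_deriv i (w k) x)\<^sup>2 = (weak_partial \<Omega> i (w k) x)\<^sup>2"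
      using C1_H1(2)[OF \<Omega> w[of k] i] by eventually_elim simp
    show "(\<lambda>x. (weak_partial \<Omega> i (w k) x)\<^sup>2) \<in> borel_measurable (lebesgue_on \<Omega>)"
      using H1_weak_partial_L2[OF \<Omega>(1) C1_H1(1)[OF \<Omega> w[of k]] i]
      by (auto simp: L2_def square_integrable_def)
  qed (use s(2)[OF i] in \<open>auto simp: square_integrable_def\<close>)
  ultimately have "convergent (\<lambda>k. (H1_norm \<Omega> (w k))\<^sup>2)"
    unfolding H1_norm_squared[OF \<Omega>(1) C1_H1(1)[OF \<Omega> w]]
    by (auto simp: convergent_def)
  then obtain C where "\<And>k. norm ((H1_norm \<Omega> (w k))\<^sup>2) \<le> C"
    using convergent_imp_Bseq BseqE by blast
  then show thesis using that[of C] by simp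
qed

lemma outward_normal_bounded:
  assumes "regular_boundary \<Omega>" "i \<in> Basis"
  shows "AE x in surface_measure \<Omega>. \<bar>outward_normal \<Omega> x \<bullet> i\<bar> \<le> 1"
proof -
  have "AE x in surface_measure \<Omega>. \<exists>\<nu>. is_outward_normal \<Omega> x \<nu>"
    using assms by (simp add: regular_boundary_def)
  then show ?thesis
  proof eventually_elim
    case (elim x)
    then have "is_outward_normal \<Omega> x (outward_normal \<Omega> x)"
      unfolding outward_normal_def by (rule someI_ex)
    then have "norm (outward_normal \<Omega> x) = 1" by (simp add: is_outward_normal_def)
    then show ?case using Basis_le_norm[OF assms(2), of "outward_normal \<Omega> x"] by simp
  qed
qed

text \<open>Let \<open>P i k \<rightarrow> \<partial>\<^sub>i u\<close> be the approximations that define the traces \<open>g i\<close>, and \<open>W k \<rightarrow> w\<close> any \<open>C\<^sup>1\<close>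
approximation in \<open>H\<^sup>1\<close>. The volume integrals converge. The boundary integral of
\<open>\<Sum>i. P i k \<nu>\<^sub>i W k\<close> tends to zero: replacing \<open>P i k\<close> by \<open>g i\<close> costs a vanishing error since \<open>W k\<close> is
bounded in \<open>L\<^sup>2\<close> of the boundary by the trace inequality, and \<open>\<Sum>i. g i \<nu>\<^sub>i = 0\<close> is the Neumann
condition.\<close>

lemma green_neumann:
  fixes \<Omega> :: "'a::euclidean_space set"
  assumes \<Omega>: "open \<Omega>" "bounded \<Omega>" "regular_boundary \<Omega>"
    and u: "H2 \<Omega> u" "neumann_bc \<Omega> u" and w: "H1 \<Omega> w"
  shows "(\<Sum>i\<in>Basis. (LINT x|lebesgue_on \<Omega>. weak_partial \<Omega> i (weak_partial \<Omega> i u) x * w x)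
      + (LINT x|lebesgue_on \<Omega>. weak_partial \<Omega> i u x * weak_partial \<Omega> i w x)) = 0"
proof -
  let ?N = "lebesgue_on \<Omega>" and ?S = "surface_measure \<Omega>"
  let ?\<nu> = "\<lambda>i x. outward_normal \<Omega> x \<bullet> i"
  define p where "p i = weak_partial \<Omega> i u" for i
  have p: "H1 \<Omega> (p i)" if "i \<in> Basis" for i using H2_D(2)[OF u(1) that] by (simp add: p_def)
  obtain g where g: "\<And>i. i \<in> Basis \<Longrightarrow> has_trace \<Omega> (p i) (g i)"
    and gn: "AE x in ?S. (\<Sum>i\<in>Basis. g i x * ?\<nu> i x) = 0"
    using u(2) unfolding neumann_bc_def p_def by blast
  have "\<forall>i\<in>Basis. \<exists>P :: nat \<Rightarrow> 'a \<Rightarrow> real. (\<forall>k. C_k 1 (P k)) \<and>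
        (\<lambda>k. H1_norm \<Omega> (\<lambda>x. P k x - p i x)) \<longlonglongrightarrow> 0 \<and>
        (\<lambda>k. LINT x|?S. (P k x - g i x)\<^sup>2) \<longlonglongrightarrow> 0"
    using g unfolding has_trace_def by blast
  from bchoice[OF this] obtain P :: "'a \<Rightarrow> nat \<Rightarrow> 'a \<Rightarrow> real" where P:
    "\<And>i k. i \<in> Basis \<Longrightarrow> C_k 1 (P i k)"
    "\<And>i. i \<in> Basis \<Longrightarrow> (\<lambda>k. H1_norm \<Omega> (\<lambda>x. P i k x - p i x)) \<longlonglongrightarrow> 0"
    "\<And>i. i \<in> Basis \<Longrightarrow> (\<lambda>k. LINT x|?S. (P i k x - g i x)\<^sup>2) \<longlonglongrightarrow> 0"
    by blast
  have "\<exists>v. C_k 1 v \<and> H1_norm \<Omega> (\<lambda>x. v x - w x) < 1 / real (Suc k)" for k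
    using \<Omega>(3) w unfolding regular_boundary_def by (metis of_nat_0_less_iff zero_less_Suc zero_less_divide_1_iff)
  then obtain W where W: "\<And>k. C_k 1 (W k)" "\<And>k. H1_norm \<Omega> (\<lambda>x. W k x - w x) < 1 / real (Suc k)"
    by metis
  have Wlim: "(\<lambda>k. H1_norm \<Omega> (\<lambda>x. W k x - w x)) \<longlonglongrightarrow> 0"
  proof (rule tendsto_sandwich[OF _ _ tendsto_const LIMSEQ_Suc[OF lim_1_over_n]])
    show "\<forall>\<^sub>F k in sequentially. 0 \<le> H1_norm \<Omega> (\<lambda>x. W k x - w x)"
      by (auto simp: H1_norm_def intro!: always_eventually Bochner_Integration.integral_nonneg)
    show "\<forall>\<^sub>F k in sequentially. H1_norm \<Omega> (\<lambda>x. W k x - w x) \<le> 1 / real (Suc k)"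
      using W(2) by (intro always_eventually allI less_imp_le)
  qed
  obtain C where C: "\<And>k. (LINT x|?S. (W k x)\<^sup>2) \<le> C"
  proof -
    obtain C1 where C1: "\<And>v. C_k 1 v \<Longrightarrow> sqrt (LINT x|?S. (v x)\<^sup>2) \<le> C1 * H1_norm \<Omega> v"
      using \<Omega>(3) unfolding regular_boundary_def by blast
    obtain C2 where C2: "\<And>k. (H1_norm \<Omega> (W k))\<^sup>2 \<le> C2"
      using H1_bounded_C1[OF \<Omega> w W(1) Wlim] by blast
    have "(LINT x|?S. (W k x)\<^sup>2) \<le> C1\<^sup>2 * C2" for k
    proof -
      have "(sqrt (LINT x|?S. (W k x)\<^sup>2))\<^sup>2 \<le> (C1 * H1_norm \<Omega> (W k))\<^sup>2"
        by (intro power_mono C1 W) simp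
      also have "\<dots> \<le> C1\<^sup>2 * C2" using C2 by (auto simp: power_mult_distrib intro!: mult_left_mono)
      finally show ?thesis by simp
    qed
    then show thesis using that by blast
  qed
  have sN: "square_integrable ?N (W k)" "square_integrable ?N w"
    "i \<in> Basis \<Longrightarrow> square_integrable ?N (partial_deriv i (W k))"
    "i \<in> Basis \<Longrightarrow> square_integrable ?N (weak_partial \<Omega> i w)"
    "i \<in> Basis \<Longrightarrow> square_integrable ?N (P i k)"
    "i \<in> Basis \<Longrightarrow> square_integrable ?N (p i)"
    "i \<in> Basis \<Longrightarrow> square_integrable ?N (partial_deriv i (P i k))"
    "i \<in> Basis \<Longrightarrow> square_integrable ?N (weak_partial \<Omega> i (p i))" for i k
    using continuous_L2[OF \<Omega>(1,2)] C_1_continuous[OF W(1)] C_1_continuous[OF P(1)]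
      H1_weak_partial_L2[OF \<Omega>(1)] w p
    by (auto simp: L2_def H1_def)
  define A where "A k = (\<Sum>i\<in>Basis. (LINT x|?N. partial_deriv i (P i k) x * W k x)
      + (LINT x|?N. P i k x * partial_deriv i (W k) x))" for k
  have 1: "A \<longlonglongrightarrow> (\<Sum>i\<in>Basis. (LINT x|?N. weak_partial \<Omega> i (p i) x * w x)
      + (LINT x|?N. p i x * weak_partial \<Omega> i w x))"
    unfolding A_def
    by (intro tendsto_sum tendsto_add L2_limit_product sN
        H1_convergence_C1[OF \<Omega> w W(1) Wlim] H1_convergence_C1[OF \<Omega> p P(1,2)])
  have sS: "square_integrable ?S (W k)" "i \<in> Basis \<Longrightarrow> square_integrable ?S (P i k)"
    "i \<in> Basis \<Longrightarrow> square_integrable ?S (g i)" for i k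
    using continuous_square_integrable_surface[OF \<Omega>(3,2)] C_1_continuous[OF W(1)]
      C_1_continuous[OF P(1)] g by (auto simp: has_trace_def)
  have \<nu>W: "square_integrable ?S (\<lambda>x. ?\<nu> i x * W k x)" if "i \<in> Basis" for i k
  proof (rule square_integrable_bounded_mult[OF sS(1) _ outward_normal_bounded[OF \<Omega>(3) that]])
    show "?\<nu> i \<in> borel_measurable ?S"
      using \<Omega>(3) by (auto simp: regular_boundary_def)
  qed
  have \<nu>W_le: "(LINT x|?S. (?\<nu> i x * W k x)\<^sup>2) \<le> C" if "i \<in> Basis" for i k
  proof -
    have "(LINT x|?S. (?\<nu> i x * W k x)\<^sup>2) \<le> (LINT x|?S. (W k x)\<^sup>2)"
    proof (rule integral_mono_AE)
      show "AE x in ?S. (?\<nu> i x * W k x)\<^sup>2 \<le> (W k x)\<^sup>2"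
        using outward_normal_bounded[OF \<Omega>(3) that]
      proof eventually_elim
        case (elim x)
        then have "(?\<nu> i x)\<^sup>2 \<le> 1" by (simp add: abs_square_le_1)
        then show ?case by (simp add: power_mult_distrib mult_left_le_one_le)
      qed
    qed (use \<nu>W[OF that] sS(1) in \<open>auto simp: square_integrable_def\<close>)
    then show ?thesis using C[of k] by linarith
  qed
  have A_eq: "A k = (\<Sum>i\<in>Basis. LINT x|?S. (P i k x - g i x) * (?\<nu> i x * W k x))" for k
  proof -
    have "A k = (\<Sum>i\<in>Basis. LINT x|?S. P i k x * (?\<nu> i x * W k x))"
      unfolding A_def
    proof (rule sum.cong[OF refl])
      fix i :: 'a assume i: "i \<in> Basis"
      show "(LINT x|?N. partial_deriv i (P i k) x * W k x) + (LINT x|?N. P i k x * partial_deriv i (W k) x)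
        = (LINT x|?S. P i k x * (?\<nu> i x * W k x))"
        using regular_boundary_integration_by_parts_C1[OF \<Omega> i P(1)[OF i] W(1), of k k]
        by (simp add: ac_simps)
    qed
    also have "\<dots> = (\<Sum>i\<in>Basis. (LINT x|?S. (P i k x - g i x) * (?\<nu> i x * W k x))
       + (LINT x|?S. g i x * (?\<nu> i x * W k x)))"
    proof (rule sum.cong[OF refl])
      fix i :: 'a assume i: "i \<in> Basis"
      show "(LINT x|?S. P i k x * (?\<nu> i x * W k x)) = (LINT x|?S. (P i k x - g i x) * (?\<nu> i x * W k x))
       + (LINT x|?S. g i x * (?\<nu> i x * W k x))"
        using square_integrable_mult[OF sS(2)[OF i] \<nu>W[OF i]] square_integrable_mult[OF sS(3)[OF i] \<nu>W[OF i]]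
        by (simp only: left_diff_distrib Bochner_Integration.integral_diff diff_add_cancel)
    qed
    also have "\<dots> = (\<Sum>i\<in>Basis. LINT x|?S. (P i k x - g i x) * (?\<nu> i x * W k x))
       + (LINT x|?S. (\<Sum>i\<in>Basis. g i x * (?\<nu> i x * W k x)))"
      unfolding sum.distrib
      by (subst (2) Bochner_Integration.integral_sum[symmetric])
        (auto intro!: square_integrable_mult sS \<nu>W)
    also have "(LINT x|?S. (\<Sum>i\<in>Basis. g i x * (?\<nu> i x * W k x))) = 0"
    proof (rule integral_eq_zero_AE)
      show "AE x in ?S. (\<Sum>i\<in>Basis. g i x * (?\<nu> i x * W k x)) = 0"
        using gn
      proof eventually_elim
        case (elim x)
        have "(\<Sum>i\<in>Basis. g i x * (?\<nu> i x * W k x)) = (\<Sum>i\<in>Basis. g i x * ?\<nu> i x) * W k x"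
          by (simp add: sum_distrib_right mult.assoc)
        then show ?case using elim by simp
      qed
    qed
    finally show ?thesis by simp
  qed
  have "(\<lambda>k. \<Sum>i\<in>Basis. LINT x|?S. (P i k x - g i x) * (?\<nu> i x * W k x)) \<longlonglongrightarrow> (\<Sum>i\<in>(Basis::'a set). 0)"
    by (intro tendsto_sum integral_mult_tendsto_0[where C = C] square_integrable_diff sS \<nu>W \<nu>W_le P)
  then have "A \<longlonglongrightarrow> 0" unfolding A_eq[symmetric] by simp
  from LIMSEQ_unique[OF 1 this] show ?thesis by (simp add: p_def)
qed

section \<open>Translations and weak derivatives\<close>

lemma lborel_integral_shift:
  fixes f :: "'a::euclidean_space \<Rightarrow> real"
  assumes "f \<in> borel_measurable borel"
  shows "integrable lborel (\<lambda>x. f (x + c)) \<longleftrightarrow> integrable lborel f"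
    and "(LINT x|lborel. f (x + c)) = (LINT x|lborel. f x)"
proof -
  have "integrable (distr lborel borel ((+) c)) f \<longleftrightarrow> integrable lborel (\<lambda>x. f (c + x))"
    by (rule integrable_distr_eq) (use assms in auto)
  then show "integrable lborel (\<lambda>x. f (x + c)) \<longleftrightarrow> integrable lborel f"
    by (simp add: lborel_distr_plus add.commute)
  have "integral\<^sup>L (distr lborel borel ((+) c)) f = (LINT x|lborel. f (c + x))"
    by (rule integral_distr) (use assms in auto)
  then show "(LINT x|lborel. f (x + c)) = (LINT x|lborel. f x)"
    by (simp add: lborel_distr_plus add.commute)
qed

lemma AE_lborel_shift:
  fixes c :: "'a::euclidean_space"
  assumes "AE x in lborel. P x"
  shows "AE x in lborel. P (x + c)"
proof -
  have "AE x in distr lborel borel ((+) c). P x" unfolding lborel_distr_plus by (rule assms)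
  then have "AE x in lborel. P (c + x)" by (rule AE_distrD[rotated]) simp
  then show ?thesis by (simp add: add.commute)
qed

lemma square_integrable_shift:
  fixes f :: "'a::euclidean_space \<Rightarrow> real"
  assumes "square_integrable lborel f"
  shows "square_integrable lborel (\<lambda>x. f (x + c))"
    and "(LINT x|lborel. (f (x + c))\<^sup>2) = (LINT x|lborel. (f x)\<^sup>2)"
proof -
  have m: "f \<in> borel_measurable borel" and i: "integrable lborel (\<lambda>x. (f x)\<^sup>2)"
    using assms by (auto simp: square_integrable_def)
  have "(\<lambda>x. f (x + c)) \<in> borel_measurable borel" using m by measurable
  then show "square_integrable lborel (\<lambda>x. f (x + c))"
    using lborel_integral_shift(1)[of "\<lambda>x. (f x)\<^sup>2" c] m i
    by (simp add: square_integrable_def)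
  show "(LINT x|lborel. (f (x + c))\<^sup>2) = (LINT x|lborel. (f x)\<^sup>2)"
    using lborel_integral_shift(2)[of "\<lambda>x. (f x)\<^sup>2" c] m by simp
qed

lemma square_integrable_indicator_mult:
  assumes "square_integrable N f" "S \<in> sets N"
  shows "square_integrable N (\<lambda>x. indicator S x * f x)"
  by (rule square_integrable_bounded_mult[where C = 1]) (use assms in \<open>auto simp: indicator_def\<close>)

lemma abs_integral_mult_le:
  assumes "square_integrable N u" "square_integrable N v"
  shows "\<bar>LINT x|N. u x * v x\<bar> \<le> (LINT x|N. (u x)\<^sup>2) + (LINT x|N. (v x)\<^sup>2)"
    and "(LINT x|N. \<bar>u x * v x\<bar>) \<le> (LINT x|N. (u x)\<^sup>2) + (LINT x|N. (v x)\<^sup>2)"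
proof -
  have i: "integrable N (\<lambda>x. (u x)\<^sup>2)" "integrable N (\<lambda>x. (v x)\<^sup>2)" "integrable N (\<lambda>x. u x * v x)"
    using assms square_integrable_mult[OF assms] by (auto simp: square_integrable_def)
  have "(LINT x|N. \<bar>u x * v x\<bar>) \<le> (LINT x|N. (u x)\<^sup>2 + (v x)\<^sup>2)"
    using i by (intro integral_mono) (auto intro: abs_mult_le_sum_squares)
  also have "\<dots> = (LINT x|N. (u x)\<^sup>2) + (LINT x|N. (v x)\<^sup>2)" using i by simp
  finally show "(LINT x|N. \<bar>u x * v x\<bar>) \<le> (LINT x|N. (u x)\<^sup>2) + (LINT x|N. (v x)\<^sup>2)" .
  then show "\<bar>LINT x|N. u x * v x\<bar> \<le> (LINT x|N. (u x)\<^sup>2) + (LINT x|N. (v x)\<^sup>2)"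
    using integral_abs_bound[of N "\<lambda>x. u x * v x"] by linarith
qed

lemma integrable_const_on_interval: "integrable lborel (\<lambda>s::real. indicator {0..h} s * (C::real))"
  by (intro integrable_mult_left integrable_real_indicator) (auto simp: emeasure_lborel_Icc_eq)

lemma integral_const_on_interval:
  "0 \<le> h \<Longrightarrow> (LINT s|lborel. indicator {0..h} s * C) = h * (C::real)"
  by simp

text \<open>Gives access to Fubini's theorem for translates: each section is integrable with a norm bounded
by \<open>\<parallel>u\<parallel>\<^sup>2 + \<parallel>k\<parallel>\<^sup>2\<close> independently of \<open>s\<close>, since Lebesgue measure is translation invariant.\<close>

lemma integrable_translation_product:
  fixes u k :: "'a::euclidean_space \<Rightarrow> real"
  assumes u: "square_integrable lborel u" and k: "square_integrable lborel k"
  shows "integrable (lborel \<Otimes>\<^sub>M lborel)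
    (\<lambda>(s::real, x). indicator {0..h} s * (u (x + s *\<^sub>R e) * k x))"
proof -
  have [measurable]: "u \<in> borel_measurable borel" "k \<in> borel_measurable borel"
    using u k by (auto simp: square_integrable_def)
  have i: "integrable lborel (\<lambda>x. indicator {0..h} s * (u (x + s *\<^sub>R e) * k x))" for s :: real
    by (intro integrable_mult_right square_integrable_mult square_integrable_shift u k)
  have m: "(\<lambda>(s::real, x). indicator {0..h} s * (u (x + s *\<^sub>R e) * k x))
      \<in> borel_measurable (lborel \<Otimes>\<^sub>M lborel)"
    by measurable
  show ?thesis
  proof (rule lborel_pair.Fubini_integrable[OF m])
    let ?C = "(LINT x|lborel. (u x)\<^sup>2) + (LINT x|lborel. (k x)\<^sup>2)"
    show "integrable lborel (\<lambda>s. LINT x|lborel. norm (case (s, x) of (s, x) \<Rightarrow> indicator {0..h} s * (u (x + s *\<^sub>R e) * k x)))"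
    proof (rule Bochner_Integration.integrable_bound)
      show "integrable lborel (\<lambda>s::real. indicator {0..h} s * ?C)"
        by (rule integrable_const_on_interval)
      show "(\<lambda>s. LINT x|lborel. norm (case (s, x) of (s, x) \<Rightarrow> indicator {0..h} s * (u (x + s *\<^sub>R e) * k x)))
          \<in> borel_measurable lborel"
        by (rule lborel.borel_measurable_lebesgue_integral) (use m in measurable)
      have "(LINT x|lborel. norm (indicator {0..h} s * (u (x + s *\<^sub>R e) * k x)))
          = indicator {0..h} s * (LINT x|lborel. \<bar>u (x + s *\<^sub>R e) * k x\<bar>)" for s :: real
        by (simp add: abs_mult indicator_def)
      moreover have "(LINT x|lborel. \<bar>u (x + s *\<^sub>R e) * k x\<bar>) \<le> ?C" for s
        using abs_integral_mult_le(2)[OF square_integrable_shift(1)[OF u] k] square_integrable_shift(2)[OF u]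
        by simp
      ultimately show "AE s in lborel. norm (LINT x|lborel. norm (case (s, x) of (s, x) \<Rightarrow> indicator {0..h} s * (u (x + s *\<^sub>R e) * k x)))
          \<le> norm (indicator {0..h} s * ?C)"
        by (intro always_eventually allI) (auto simp: indicator_def)
    qed
  qed (use i in simp)
qed

lemma Fubini_translation_product:
  fixes u k :: "'a::euclidean_space \<Rightarrow> real"
  assumes u: "square_integrable lborel u" and k: "square_integrable lborel k"
  shows "(LINT x|lborel. (LINT s|lborel. indicator {0..h} s * u (x + s *\<^sub>R e)) * k x)
     = (LINT s|lborel. indicator {0..h} s * (LINT x|lborel. u (x + s *\<^sub>R e) * k x))"
    and "integrable lborel (\<lambda>x. (LINT s|lborel. indicator {0..h} s * u (x + s *\<^sub>R e)) * k x)"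
    and "integrable lborel (\<lambda>s. indicator {0..h} s * (LINT x|lborel. u (x + s *\<^sub>R e) * k x))"
proof -
  note i = integrable_translation_product[OF u k, of h e]
  have x: "(LINT s|lborel. indicator {0..h} s * (u (x + s *\<^sub>R e) * k x))
      = (LINT s|lborel. indicator {0..h} s * u (x + s *\<^sub>R e)) * k x" for x
    by (simp add: mult.assoc[symmetric])
  have s: "(LINT x|lborel. indicator {0..h} s * (u (x + s *\<^sub>R e) * k x))
      = indicator {0..h} s * (LINT x|lborel. u (x + s *\<^sub>R e) * k x)" for s :: real
    by simp
  show "(LINT x|lborel. (LINT s|lborel. indicator {0..h} s * u (x + s *\<^sub>R e)) * k x)
     = (LINT s|lborel. indicator {0..h} s * (LINT x|lborel. u (x + s *\<^sub>R e) * k x))"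
    using lborel_pair.Fubini_integral[OF i] unfolding x s .
  show "integrable lborel (\<lambda>x. (LINT s|lborel. indicator {0..h} s * u (x + s *\<^sub>R e)) * k x)"
    using lborel_pair.integrable_snd[OF i] unfolding x .
  show "integrable lborel (\<lambda>s. indicator {0..h} s * (LINT x|lborel. u (x + s *\<^sub>R e) * k x))"
    using lborel_pair.integrable_fst'[OF i] unfolding prod.case s .
qed

text \<open>A variant of \<^const>\<open>has_weak_partial\<close> for Borel functions that are square integrable on the whole
space; functions on \<open>V\<close> are extended by zero. Borel measurability makes \<open>(s, x) \<mapsto> u (x + s e)\<close>
jointly measurable, and working on the whole space lets translations act without tracking
domains.\<close>

definition has_weak_derivative_lborel ::
  "'a::euclidean_space set \<Rightarrow> 'a \<Rightarrow> ('a \<Rightarrow> real) \<Rightarrow> ('a \<Rightarrow> real) \<Rightarrow> bool" where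
  "has_weak_derivative_lborel V e u g \<longleftrightarrow>
     square_integrable lborel u \<and> square_integrable lborel g \<and>
     (\<forall>\<eta>. test_function V \<eta> \<longrightarrow>
       (LINT x|lborel. u x * partial_deriv e \<eta> x) = - (LINT x|lborel. g x * \<eta> x))"

lemma test_function_square_integrable:
  fixes \<eta> :: "'a::euclidean_space \<Rightarrow> real"
  assumes t: "test_function V \<eta>"
  shows "square_integrable lborel \<eta>" "i \<in> Basis \<Longrightarrow> square_integrable lborel (partial_deriv i \<eta>)"
proof -
  obtain K where K: "compact K" "\<And>x. x \<notin> K \<Longrightarrow> \<eta> x = 0" "\<And>x i. x \<notin> K \<Longrightarrow> partial_deriv i \<eta> x = 0"
    using test_function_support[OF t] by metis
  have *: "square_integrable lborel f" if f: "continuous_on UNIV f" "\<And>x. x \<notin> K \<Longrightarrow> f x = 0"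
    for f :: "'a \<Rightarrow> real"
  proof -
    have "integrable lborel (\<lambda>x. indicator K x *\<^sub>R (f x)\<^sup>2)"
      using borel_integrable_compact[OF K(1), of "\<lambda>x. (f x)\<^sup>2"] f(1)
      by (auto simp: continuous_on_power continuous_on_subset)
    also have "(\<lambda>x. indicator K x *\<^sub>R (f x)\<^sup>2) = (\<lambda>x. (f x)\<^sup>2)"
      using f(2) by (auto simp: fun_eq_iff indicator_def)
    finally show ?thesis
      using borel_measurable_continuous_onI[OF f(1)] by (simp add: square_integrable_def)
  qed
  show "square_integrable lborel \<eta>" "i \<in> Basis \<Longrightarrow> square_integrable lborel (partial_deriv i \<eta>)"
    using * K test_function_continuous[OF t] by blast+
qed

text \<open>The support of \<open>x \<mapsto> \<eta> (x + c)\<close> is the support of \<open>\<eta>\<close> translated by \<open>- c\<close>.\<close>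

lemma test_function_shift:
  fixes \<eta> :: "'a::euclidean_space \<Rightarrow> real"
  assumes t: "test_function \<Omega> \<eta>" and V: "\<And>x. x \<in> \<Omega> \<Longrightarrow> x - c \<in> V"
  shows "test_function V (\<lambda>x. \<eta> (x + c))"
    and "partial_deriv i (\<lambda>x. \<eta> (x + c)) x = partial_deriv i \<eta> (x + c)"
proof -
  show "partial_deriv i (\<lambda>x. \<eta> (x + c)) x = partial_deriv i \<eta> (x + c)"
    by (rule partial_deriv_shift[OF test_function_continuous(3)[OF t]])
  have "{x. \<eta> (x + c) \<noteq> 0} = (\<lambda>x. x - c) ` {x. \<eta> x \<noteq> 0}"
    by (auto simp: image_iff) (metis add_diff_cancel)
  then have "closure {x. \<eta> (x + c) \<noteq> 0} = (\<lambda>x. x - c) ` closure {x. \<eta> x \<noteq> 0}"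
    using closure_translation_subtract by metis
  then show "test_function V (\<lambda>x. \<eta> (x + c))"
    using t V by (auto simp: test_function_def C_k_shift compact_translation_subtract)
qed

text \<open>The fundamental theorem of calculus along the line through \<open>x\<close> in direction \<open>e\<close>.\<close>

lemma test_function_increment:
  fixes \<eta> :: "'a::euclidean_space \<Rightarrow> real"
  assumes t: "test_function \<Omega> \<eta>" and e: "e \<in> Basis" and "0 \<le> h"
  shows "(LINT s|lborel. indicator {0..h} s * partial_deriv e \<eta> (x + s *\<^sub>R (- e))) = \<eta> x - \<eta> (x - h *\<^sub>R e)"
proof -
  have der: "((\<lambda>s. - \<eta> (x - s *\<^sub>R e)) has_real_derivative partial_deriv e \<eta> (x + s *\<^sub>R (- e))) (at s)" for s
  proof -
    let ?D = "frechet_derivative \<eta> (at (x - s *\<^sub>R e))"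
    have D: "(\<eta> has_derivative ?D) (at (x - s *\<^sub>R e))"
      using test_function_continuous(3)[OF t] by (simp add: frechet_derivative_works)
    have "((\<lambda>s. x - s *\<^sub>R e) has_derivative (\<lambda>y. - (y *\<^sub>R e))) (at s)"
      by (auto intro!: derivative_eq_intros)
    from has_derivative_minus[OF has_derivative_compose[OF this D]]
    have "((\<lambda>s. - \<eta> (x - s *\<^sub>R e)) has_derivative (\<lambda>y. - ?D (- (y *\<^sub>R e)))) (at s)" .
    moreover have "(\<lambda>y. - ?D (- (y *\<^sub>R e))) = (*) (partial_deriv e \<eta> (x + s *\<^sub>R (- e)))"
      using has_derivative_bounded_linear[OF D]
      by (auto simp: fun_eq_iff partial_deriv_def linear_neg linear_scale bounded_linear.linear)
    ultimately show ?thesis by (simp add: has_field_derivative_def)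
  qed
  have cont: "isCont (\<lambda>s. partial_deriv e \<eta> (x + s *\<^sub>R (- e))) s" for s
  proof -
    have "continuous_on UNIV (\<lambda>s. partial_deriv e \<eta> (x + s *\<^sub>R (- e)))"
      by (rule continuous_on_compose2[OF test_function_continuous(2)[OF t e]])
        (auto intro!: continuous_intros)
    then show ?thesis by (simp add: continuous_on_eq_continuous_at)
  qed
  have "(LINT s|lborel. partial_deriv e \<eta> (x + s *\<^sub>R (- e)) * indicator {0..h} s)
      = - \<eta> (x - h *\<^sub>R e) - (- \<eta> (x - 0 *\<^sub>R e))"
    by (rule integral_FTC_Icc_real[OF \<open>0 \<le> h\<close> der cont])
  then show ?thesis by (simp add: mult.commute)
qed

section \<open>Green's formula for periodic functions\<close>

text \<open>Difference quotients of step at most \<open>L\<close> and the comparison of a function with its translate by a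
period \<open>L\<close> only involve translates of the box within the set \<open>V\<close> on which weak derivatives are
known.\<close>

locale sliding_box =
  fixes a b e :: "'a::euclidean_space" and V :: "'a set" and L :: real
  assumes e: "e \<in> Basis" and V: "open V"
    and L: "L = (b - a) \<bullet> e" "L > 0"
    and slide: "\<And>x s. x \<in> box a b \<Longrightarrow> 0 \<le> s \<Longrightarrow> s \<le> L \<Longrightarrow> x + s *\<^sub>R e \<in> V"
begin

abbreviation "\<Omega> \<equiv> box a b"

definition periodic_AE :: "('a \<Rightarrow> real) \<Rightarrow> bool" where
  "periodic_AE f \<longleftrightarrow> (AE x in lborel. x \<in> \<Omega> \<longrightarrow> f (x + L *\<^sub>R e) = f x)"

lemma \<Omega>_subset_V: "\<Omega> \<subseteq> V"
  using slide[of _ 0] L by auto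

text \<open>Weak form of \<open>p (x + h e) - p x = \<integral>\<^sub>0\<^sup>h g (x + s e) ds\<close>: the translation is moved to the test
function, whose increment is an integral of its derivative; the definition of the weak
derivative then applies for each \<open>s\<close> to a translated test function.\<close>

lemma weak_increment:
  assumes pg: "has_weak_derivative_lborel V e p g" and t: "test_function \<Omega> \<eta>" and h: "0 \<le> h" "h \<le> L"
  shows "(LINT x|lborel. (p (x + h *\<^sub>R e) - p x) * \<eta> x)
    = (LINT x|lborel. (LINT s|lborel. indicator {0..h} s * g (x + s *\<^sub>R e)) * \<eta> x)"
proof -
  have p: "square_integrable lborel p" and g: "square_integrable lborel g"
    using pg by (auto simp: has_weak_derivative_lborel_def)
  have pm: "p \<in> borel_measurable borel" "g \<in> borel_measurable borel"
    using p g by (auto simp: square_integrable_def)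
  note \<eta> = test_function_square_integrable[OF t]
  have \<eta>m: "\<eta> \<in> borel_measurable borel" "partial_deriv e \<eta> \<in> borel_measurable borel"
    using \<eta> e by (auto simp: square_integrable_def)
  have \<eta>h: "square_integrable lborel (\<lambda>x. \<eta> (x - h *\<^sub>R e))"
    using square_integrable_shift(1)[OF \<eta>(1), of "- (h *\<^sub>R e)"] by simp
  have sh: "(LINT x|lborel. f (x + s *\<^sub>R e) * \<eta> x) = (LINT x|lborel. f x * \<eta> (x - s *\<^sub>R e))"
    if [measurable]: "f \<in> borel_measurable borel" for f s
    using lborel_integral_shift(2)[of "\<lambda>x. f x * \<eta> (x - s *\<^sub>R e)" "s *\<^sub>R e"] \<eta>m by simp
  have "(LINT x|lborel. (p (x + h *\<^sub>R e) - p x) * \<eta> x)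
      = (LINT x|lborel. p (x + h *\<^sub>R e) * \<eta> x) - (LINT x|lborel. p x * \<eta> x)"
    using square_integrable_mult[OF square_integrable_shift(1)[OF p] \<eta>(1)] square_integrable_mult[OF p \<eta>(1)]
    by (simp add: left_diff_distrib)
  also have "\<dots> = (LINT x|lborel. p x * \<eta> (x - h *\<^sub>R e)) - (LINT x|lborel. p x * \<eta> x)"
    by (simp add: sh[OF pm(1)])
  also have "\<dots> = - (LINT x|lborel. (\<eta> x - \<eta> (x - h *\<^sub>R e)) * p x)"
    using square_integrable_mult[OF p \<eta>(1)] square_integrable_mult[OF p \<eta>h]
    by (simp only: mult.commute[of _ "p _"] right_diff_distrib Bochner_Integration.integral_diff minus_diff_eq)
  also have "\<dots> = - (LINT x|lborel. (LINT s|lborel. indicator {0..h} s * partial_deriv e \<eta> (x + s *\<^sub>R (- e))) * p x)"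
    by (simp only: test_function_increment[OF t e h(1)])
  also have "\<dots> = - (LINT s|lborel. indicator {0..h} s * (LINT x|lborel. partial_deriv e \<eta> (x + s *\<^sub>R (- e)) * p x))"
    by (simp only: Fubini_translation_product(1)[OF \<eta>(2)[OF e] p])
  also have "\<dots> = - (LINT s|lborel. - (indicator {0..h} s * (LINT x|lborel. g (x + s *\<^sub>R e) * \<eta> x)))"
  proof -
    have "indicator {0..h} s * (LINT x|lborel. partial_deriv e \<eta> (x + s *\<^sub>R (- e)) * p x)
        = - (indicator {0..h} s * (LINT x|lborel. g (x + s *\<^sub>R e) * \<eta> x))" for s :: real
    proof (cases "s \<in> {0..h}")
      case True
      then have V': "\<And>x. x \<in> \<Omega> \<Longrightarrow> x - (- (s *\<^sub>R e)) \<in> V" using slide h by simp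
      have "(LINT x|lborel. p x * partial_deriv e (\<lambda>x. \<eta> (x + - (s *\<^sub>R e))) x)
          = - (LINT x|lborel. g x * \<eta> (x + - (s *\<^sub>R e)))"
        using pg test_function_shift(1)[OF t V'] unfolding has_weak_derivative_lborel_def by blast
      moreover have "partial_deriv e (\<lambda>x. \<eta> (x + - (s *\<^sub>R e))) x = partial_deriv e \<eta> (x - s *\<^sub>R e)" for x
        using test_function_shift(2)[OF t V'] by simp
      ultimately show ?thesis
        unfolding sh[OF pm(2)] by (simp add: mult.commute)
    qed simp
    then show ?thesis by simp
  qed
  also have "\<dots> = (LINT s|lborel. indicator {0..h} s * (LINT x|lborel. g (x + s *\<^sub>R e) * \<eta> x))"
    by simp
  also have "\<dots> = (LINT x|lborel. (LINT s|lborel. indicator {0..h} s * g (x + s *\<^sub>R e)) * \<eta> x)"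
    by (simp only: Fubini_translation_product(1)[OF g \<eta>(1)])
  finally show ?thesis .
qed

lemma AE_zero_on_box:
  assumes f: "f \<in> borel_measurable borel" "integrable lborel (\<lambda>x. indicator \<Omega> x * f x)"
    and weak: "\<And>\<eta>. test_function \<Omega> \<eta> \<Longrightarrow> (LINT x|lborel. f x * \<eta> x) = 0"
  shows "AE x in lborel. x \<in> \<Omega> \<longrightarrow> f x = 0"
proof -
  have i: "integrable (lebesgue_on \<Omega>) f"
    using f by (subst integrable_lebesgue_on_indicator) (auto simp: integrable_completion)
  have "AE x in lebesgue_on \<Omega>. f x = 0"
  proof (rule fundamental_lemma_calculus_of_variations)
    show "locally_integrable \<Omega> f"
      unfolding locally_integrable_def
    proof (intro allI impI)
      fix K assume "compact K \<and> K \<subseteq> \<Omega>"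
      then have K: "K \<in> sets borel" "\<And>x. indicator K x * (indicator \<Omega> x * f x) = indicator K x * f x"
        by (auto simp: indicator_def borel_compact)
      have "integrable lborel (\<lambda>x. indicator K x * f x)"
        using integrable_mult_indicator[OF _ f(2), of K] K by simp
      then show "integrable (lebesgue_on K) f"
        using f K by (subst integrable_lebesgue_on_indicator) (auto simp: integrable_completion)
    qed
    fix \<eta> assume t: "test_function \<Omega> \<eta>"
    have eq: "indicator \<Omega> x * (f x * \<eta> x) = f x * \<eta> x" for x
      using test_function_support[OF t] by (metis indicator_simps mult_1 mult_eq_0_iff subsetD)
    have "(LINT x|lebesgue_on \<Omega>. f x * \<eta> x) = (LINT x|lebesgue. indicator \<Omega> x * (f x * \<eta> x))"
      by (rule integral_lebesgue_on_indicator) auto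
    also have "\<dots> = (LINT x|lebesgue. f x * \<eta> x)" by (simp only: eq)
    also have "\<dots> = (LINT x|lborel. f x * \<eta> x)"
      using f test_function_square_integrable(1)[OF t]
      by (intro integral_completion) (auto simp: square_integrable_def)
    finally show "(LINT x|lebesgue_on \<Omega>. f x * \<eta> x) = 0" using weak[OF t] by simp
  qed (rule open_box)
  then have "AE x in lebesgue. x \<in> \<Omega> \<longrightarrow> f x = 0"
    by (subst (asm) AE_restrict_space_iff) auto
  then show ?thesis by (simp add: AE_completion_iff)
qed

lemma square_integrable_indicator_box: "square_integrable lborel (indicator \<Omega>)"
proof -
  have "integrable lborel (indicator \<Omega> :: 'a \<Rightarrow> real)"
    by (intro integrable_real_indicator) (auto simp: emeasure_lborel_box_eq)
  moreover have "(\<lambda>x. (indicator \<Omega> x)\<^sup>2) = (indicator \<Omega> :: 'a \<Rightarrow> real)"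
    by (auto simp: indicator_def fun_eq_iff)
  ultimately show ?thesis by (simp add: square_integrable_def)
qed

lemma AE_increment:
  assumes pg: "has_weak_derivative_lborel V e p g" and h: "0 \<le> h" "h \<le> L"
  shows "AE x in lborel. x \<in> \<Omega> \<longrightarrow>
    p (x + h *\<^sub>R e) - p x = (LINT s|lborel. indicator {0..h} s * g (x + s *\<^sub>R e))"
proof -
  have p: "square_integrable lborel p" and g: "square_integrable lborel g"
    using pg by (auto simp: has_weak_derivative_lborel_def)
  have [measurable]: "p \<in> borel_measurable borel" "g \<in> borel_measurable borel"
    using p g by (auto simp: square_integrable_def)
  let ?A = "\<lambda>x. LINT s|lborel. indicator {0..h} s * g (x + s *\<^sub>R e)"
  let ?d = "\<lambda>x. p (x + h *\<^sub>R e) - p x"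
  have d: "square_integrable lborel ?d"
    by (intro square_integrable_diff square_integrable_shift p)
  have "AE x in lborel. x \<in> \<Omega> \<longrightarrow> ?d x - ?A x = 0"
  proof (rule AE_zero_on_box)
    show "(\<lambda>x. ?d x - ?A x) \<in> borel_measurable borel" by measurable
    have "integrable lborel (\<lambda>x. ?d x * indicator \<Omega> x - ?A x * indicator \<Omega> x)"
      by (intro Bochner_Integration.integrable_diff square_integrable_mult[OF d]
          Fubini_translation_product(2)[OF g] square_integrable_indicator_box)
    then show "integrable lborel (\<lambda>x. indicator \<Omega> x * (?d x - ?A x))"
      by (simp add: algebra_simps)
    fix \<eta> assume t: "test_function \<Omega> \<eta>"
    note \<eta> = test_function_square_integrable(1)[OF t]
    have "(LINT x|lborel. (?d x - ?A x) * \<eta> x) = (LINT x|lborel. ?d x * \<eta> x) - (LINT x|lborel. ?A x * \<eta> x)"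
      using square_integrable_mult[OF d \<eta>] Fubini_translation_product(2)[OF g \<eta>, of h e]
      by (simp only: left_diff_distrib Bochner_Integration.integral_diff)
    then show "(LINT x|lborel. (?d x - ?A x) * \<eta> x) = 0"
      using weak_increment[OF pg t h] by simp
  qed
  then show ?thesis by simp
qed

text \<open>The increment formula tested with an arbitrary \<open>L\<^sup>2\<close> function. Passing through the pointwise
formula removes the restriction to smooth \<open>k\<close>.\<close>

lemma integral_increment:
  assumes pg: "has_weak_derivative_lborel V e p g" and h: "0 \<le> h" "h \<le> L"
    and k: "square_integrable lborel k"
  shows "(LINT x|lborel. indicator \<Omega> x * ((p (x + h *\<^sub>R e) - p x) * k x))
    = (LINT s|lborel. indicator {0..h} s * (LINT x|lborel. indicator \<Omega> x * (g (x + s *\<^sub>R e) * k x)))"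
    and "integrable lborel (\<lambda>s. indicator {0..h} s * (LINT x|lborel. indicator \<Omega> x * (g (x + s *\<^sub>R e) * k x)))"
proof -
  have p: "square_integrable lborel p" and g: "square_integrable lborel g"
    using pg by (auto simp: has_weak_derivative_lborel_def)
  have [measurable]: "p \<in> borel_measurable borel" "g \<in> borel_measurable borel" "k \<in> borel_measurable borel"
    using p g k by (auto simp: square_integrable_def)
  let ?A = "\<lambda>x. LINT s|lborel. indicator {0..h} s * g (x + s *\<^sub>R e)"
  have k': "square_integrable lborel (\<lambda>x. indicator \<Omega> x * k x)"
    by (intro square_integrable_indicator_mult k) auto
  have "(LINT x|lborel. indicator \<Omega> x * ((p (x + h *\<^sub>R e) - p x) * k x))
      = (LINT x|lborel. ?A x * (indicator \<Omega> x * k x))"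
  proof (rule integral_cong_AE)
    show "AE x in lborel. indicator \<Omega> x * ((p (x + h *\<^sub>R e) - p x) * k x) = ?A x * (indicator \<Omega> x * k x)"
      using AE_increment[OF pg h] by eventually_elim (auto simp: indicator_def)
  qed measurable
  also have "\<dots> = (LINT s|lborel. indicator {0..h} s * (LINT x|lborel. g (x + s *\<^sub>R e) * (indicator \<Omega> x * k x)))"
    by (rule Fubini_translation_product(1)[OF g k'])
  finally show "(LINT x|lborel. indicator \<Omega> x * ((p (x + h *\<^sub>R e) - p x) * k x))
    = (LINT s|lborel. indicator {0..h} s * (LINT x|lborel. indicator \<Omega> x * (g (x + s *\<^sub>R e) * k x)))"
    by (simp add: ac_simps)
  show "integrable lborel (\<lambda>s. indicator {0..h} s * (LINT x|lborel. indicator \<Omega> x * (g (x + s *\<^sub>R e) * k x)))"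
    using Fubini_translation_product(3)[OF g k', of h e] by (simp add: ac_simps)
qed

text \<open>The Lipschitz estimate for translations of an \<open>H\<^sup>1\<close> function.\<close>

lemma increment_bound:
  assumes pg: "has_weak_derivative_lborel V e p g" and h: "0 \<le> h" "h \<le> L"
    and k: "square_integrable lborel k"
  shows "\<bar>LINT x|lborel. indicator \<Omega> x * ((p (x + h *\<^sub>R e) - p x) * k x)\<bar>
    \<le> h * ((LINT x|lborel. (g x)\<^sup>2) + (LINT x|lborel. (k x)\<^sup>2))" (is "_ \<le> h * ?C")
proof -
  have g: "square_integrable lborel g"
    using pg by (auto simp: has_weak_derivative_lborel_def)
  let ?f = "\<lambda>s. LINT x|lborel. indicator \<Omega> x * (g (x + s *\<^sub>R e) * k x)"
  have C: "\<bar>?f s\<bar> \<le> ?C" for s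
  proof -
    have k': "square_integrable lborel (\<lambda>x. indicator \<Omega> x * k x)"
      by (intro square_integrable_indicator_mult k) auto
    have "\<bar>LINT x|lborel. g (x + s *\<^sub>R e) * (indicator \<Omega> x * k x)\<bar>
      \<le> (LINT x|lborel. (g x)\<^sup>2) + (LINT x|lborel. (indicator \<Omega> x * k x)\<^sup>2)"
      using abs_integral_mult_le(1)[OF square_integrable_shift(1)[OF g] k'] square_integrable_shift(2)[OF g]
      by simp
    also have "(LINT x|lborel. (indicator \<Omega> x * k x)\<^sup>2) \<le> (LINT x|lborel. (k x)\<^sup>2)"
      using k k' by (intro integral_mono) (auto simp: square_integrable_def indicator_def)
    finally show ?thesis by (simp add: ac_simps)
  qed
  have "\<bar>LINT s|lborel. indicator {0..h} s * ?f s\<bar> \<le> (LINT s|lborel. \<bar>indicator {0..h} s * ?f s\<bar>)"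
    by (rule integral_abs_bound)
  also have "\<dots> \<le> (LINT s|lborel. indicator {0..h} s * ?C)"
    using integral_increment(2)[OF pg h k] C
    by (intro integral_mono integrable_abs integrable_const_on_interval)
      (auto simp: abs_mult indicator_def)
  also have "\<dots> = h * ?C" by (rule integral_const_on_interval[OF h(1)])
  finally show ?thesis unfolding integral_increment(1)[OF pg h k] .
qed

text \<open>Translating the box by \<open>t e\<close> removes the slab \<open>A\<close> of width \<open>t\<close> at its lower face and adds the
translate \<open>A + L e\<close> at its upper face, up to hyperplanes of measure zero; by periodicity \<open>f\<close> has
the same integral over both slabs.\<close>

lemma integral_periodic_shift:
  assumes f: "integrable lborel f" and per: "periodic_AE f" and t: "0 \<le> t" "t \<le> L"
  shows "(LINT x|lborel. indicator \<Omega> x * f (x + t *\<^sub>R e)) = (LINT x|lborel. indicator \<Omega> x * f x)"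
proof -
  have [measurable]: "f \<in> borel_measurable borel" using f by auto
  define A where "A = {x \<in> \<Omega>. x \<bullet> e \<le> a \<bullet> e + t}"
  have [measurable]: "A \<in> sets borel"
  proof -
    have "A = \<Omega> \<inter> {x. x \<bullet> e \<le> a \<bullet> e + t}" by (auto simp: A_def)
    then show ?thesis by (simp add: borel_closed closed_halfspace_component_le)
  qed
  have be: "b \<bullet> e = a \<bullet> e + L" using L by (simp add: inner_diff_left)
  have ind: "integrable lborel (\<lambda>x. indicator S x * f x)" if "S \<in> sets borel" for S
    using integrable_mult_indicator[OF _ f, of S] that by simp
  have shift_ind: "(LINT x|lborel. indicator S x * f (x + r *\<^sub>R e)) = (LINT x|lborel. indicator S (x - r *\<^sub>R e) * f x)"
    "integrable lborel (\<lambda>x. indicator S (x - r *\<^sub>R e) * f x)"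
    if [measurable]: "S \<in> sets borel" for S r
  proof -
    have eq: "(\<lambda>x. indicator S (x - r *\<^sub>R e) :: real) = indicator ((\<lambda>x. x - r *\<^sub>R e) -` S)"
      by (auto simp: indicator_def)
    have m: "(\<lambda>x. x - r *\<^sub>R e) -` S \<in> sets borel"
      using measurable_sets[of "\<lambda>x. x - r *\<^sub>R e" borel borel S] that by simp
    show "(LINT x|lborel. indicator S x * f (x + r *\<^sub>R e)) = (LINT x|lborel. indicator S (x - r *\<^sub>R e) * f x)"
      using lborel_integral_shift(2)[of "\<lambda>x. indicator S (x - r *\<^sub>R e) * f x" "r *\<^sub>R e"] by simp
    show "integrable lborel (\<lambda>x. indicator S (x - r *\<^sub>R e) * f x)"
      using ind[OF m] unfolding eq[symmetric, THEN fun_cong] by simp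
  qed
  have mem: "x - r *\<^sub>R e \<in> \<Omega> \<longleftrightarrow> (\<forall>j\<in>Basis - {e}. a \<bullet> j < x \<bullet> j \<and> x \<bullet> j < b \<bullet> j)
      \<and> a \<bullet> e + r < x \<bullet> e \<and> x \<bullet> e < b \<bullet> e + r" for x r
  proof -
    have "e \<bullet> j = (if j = e then 1 else 0)" if "j \<in> Basis" for j
      using that e by (simp add: inner_Basis)
    then show ?thesis
      using e by (auto simp: mem_box inner_diff_left algebra_simps split: if_splits)
  qed
  have "(LINT x|lborel. indicator \<Omega> (x - t *\<^sub>R e) * f x)
      = (LINT x|lborel. indicator \<Omega> x * f x - indicator A x * f x + indicator A (x - L *\<^sub>R e) * f x)"
  proof (rule integral_cong_AE)
    show "AE x in lborel. indicator \<Omega> (x - t *\<^sub>R e) * f x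
        = indicator \<Omega> x * f x - indicator A x * f x + indicator A (x - L *\<^sub>R e) * f x"
      using AE_lborel_inner_neq[OF e, of "b \<bullet> e"] AE_lborel_inner_neq[OF e, of "b \<bullet> e + t"]
    proof eventually_elim
      case (elim x)
      have e2: "(x - L *\<^sub>R e) \<bullet> e = x \<bullet> e - L" using e by (simp add: inner_diff_left)
      let ?Q = "\<forall>j\<in>Basis - {e}. a \<bullet> j < x \<bullet> j \<and> x \<bullet> j < b \<bullet> j"
      have 1: "x - t *\<^sub>R e \<in> \<Omega> \<longleftrightarrow> ?Q \<and> a \<bullet> e + t < x \<bullet> e \<and> x \<bullet> e < b \<bullet> e + t" by (rule mem)
      have 2: "x \<in> \<Omega> \<longleftrightarrow> ?Q \<and> a \<bullet> e < x \<bullet> e \<and> x \<bullet> e < b \<bullet> e" using mem[of x 0] by simp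
      have 3: "x \<in> A \<longleftrightarrow> ?Q \<and> a \<bullet> e < x \<bullet> e \<and> x \<bullet> e < b \<bullet> e \<and> x \<bullet> e \<le> a \<bullet> e + t"
        using 2 by (auto simp: A_def)
      have 4: "x - L *\<^sub>R e \<in> A \<longleftrightarrow> ?Q \<and> b \<bullet> e < x \<bullet> e \<and> x \<bullet> e < b \<bullet> e + L \<and> x \<bullet> e \<le> b \<bullet> e + t"
        unfolding A_def using mem[of x L] be e2 by auto
      show ?case
        unfolding indicator_def of_bool_def 1 2 3 4 using elim be t by auto
    qed
  qed measurable
  also have "\<dots> = (LINT x|lborel. indicator \<Omega> x * f x) - (LINT x|lborel. indicator A x * f x)
      + (LINT x|lborel. indicator A (x - L *\<^sub>R e) * f x)"
    using ind[of \<Omega>] ind[of A] shift_ind(2)[of A L] by simp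
  also have "(LINT x|lborel. indicator A (x - L *\<^sub>R e) * f x) = (LINT x|lborel. indicator A x * f (x + L *\<^sub>R e))"
    by (rule shift_ind(1)[symmetric]) simp
  also have "\<dots> = (LINT x|lborel. indicator A x * f x)"
  proof (rule integral_cong_AE)
    show "AE x in lborel. indicator A x * f (x + L *\<^sub>R e) = indicator A x * f x"
      using per unfolding periodic_AE_def
      by eventually_elim (auto simp: indicator_def A_def)
  qed measurable
  finally show ?thesis using shift_ind(1)[of \<Omega> t] by simp
qed

lemma periodic_AE_mult: "periodic_AE f \<Longrightarrow> periodic_AE g \<Longrightarrow> periodic_AE (\<lambda>x. f x * g x)"
  unfolding periodic_AE_def by (erule (1) eventually_elim2) auto

text \<open>The weak derivative of the increment \<open>p (\<cdot> + L e) - p\<close>, which vanishes in the box, is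
\<open>g (\<cdot> + L e) - g\<close>; the fundamental lemma applies.\<close>

lemma periodic_AE_weak_derivative:
  assumes pg: "has_weak_derivative_lborel V e p g" and per: "periodic_AE p"
  shows "periodic_AE g"
proof -
  have p: "square_integrable lborel p" and g: "square_integrable lborel g"
    using pg by (auto simp: has_weak_derivative_lborel_def)
  have [measurable]: "p \<in> borel_measurable borel" "g \<in> borel_measurable borel"
    using p g by (auto simp: square_integrable_def)
  have d: "square_integrable lborel (\<lambda>x. f (x + L *\<^sub>R e) - f x)" if "square_integrable lborel f" for f :: "'a \<Rightarrow> real"
    by (intro square_integrable_diff square_integrable_shift that)
  have "AE x in lborel. x \<in> \<Omega> \<longrightarrow> g (x + L *\<^sub>R e) - g x = 0"
  proof (rule AE_zero_on_box)
    show "(\<lambda>x. g (x + L *\<^sub>R e) - g x) \<in> borel_measurable borel" by measurable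
    show "integrable lborel (\<lambda>x. indicator \<Omega> x * (g (x + L *\<^sub>R e) - g x))"
      by (intro square_integrable_mult square_integrable_indicator_box d g)
    fix \<eta> assume t: "test_function \<Omega> \<eta>"
    note \<eta> = test_function_square_integrable[OF t]
    have \<eta>m [measurable]: "\<eta> \<in> borel_measurable borel" "partial_deriv e \<eta> \<in> borel_measurable borel"
      using \<eta> e by (auto simp: square_integrable_def)
    have V': "\<And>x. x \<in> \<Omega> \<Longrightarrow> x - (- (L *\<^sub>R e)) \<in> V" using slide L by simp
    have shifted: "(LINT x|lborel. p x * partial_deriv e \<eta> (x + - (L *\<^sub>R e))) = - (LINT x|lborel. g x * \<eta> (x + - (L *\<^sub>R e)))"
      using pg test_function_shift(1)[OF t V'] unfolding has_weak_derivative_lborel_def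
      by (metis (no_types, lifting) test_function_shift(2)[OF t V'] Bochner_Integration.integral_cong)
    have plain: "(LINT x|lborel. p x * partial_deriv e \<eta> x) = - (LINT x|lborel. g x * \<eta> x)"
      using pg test_function_mono[OF t \<Omega>_subset_V] by (simp add: has_weak_derivative_lborel_def)
    have diff: "(LINT x|lborel. (f (x + L *\<^sub>R e) - f x) * z x)
        = (LINT x|lborel. f x * z (x + - (L *\<^sub>R e))) - (LINT x|lborel. f x * z x)"
      if f: "square_integrable lborel f" and z: "square_integrable lborel z" for f z :: "'a \<Rightarrow> real"
    proof -
      have [measurable]: "f \<in> borel_measurable borel" "z \<in> borel_measurable borel"
        using f z by (auto simp: square_integrable_def)
      have "(LINT x|lborel. (f (x + L *\<^sub>R e) - f x) * z x)
          = (LINT x|lborel. f (x + L *\<^sub>R e) * z x) - (LINT x|lborel. f x * z x)"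
        using square_integrable_mult[OF square_integrable_shift(1)[OF f] z] square_integrable_mult[OF f z]
        by (simp add: left_diff_distrib)
      also have "(LINT x|lborel. f (x + L *\<^sub>R e) * z x) = (LINT x|lborel. f x * z (x + - (L *\<^sub>R e)))"
        using lborel_integral_shift(2)[of "\<lambda>x. f x * z (x + - (L *\<^sub>R e))" "L *\<^sub>R e"] by simp
      finally show ?thesis .
    qed
    have "(LINT x|lborel. (g (x + L *\<^sub>R e) - g x) * \<eta> x)
        = - (LINT x|lborel. (p (x + L *\<^sub>R e) - p x) * partial_deriv e \<eta> x)"
      unfolding diff[OF g \<eta>(1)] diff[OF p \<eta>(2)[OF e]] shifted plain by simp
    also have "(LINT x|lborel. (p (x + L *\<^sub>R e) - p x) * partial_deriv e \<eta> x) = 0"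
    proof (rule integral_eq_zero_AE)
      have "partial_deriv e \<eta> x = 0" if "x \<notin> \<Omega>" for x
        using test_function_support[OF t] that by (metis subsetD)
      then show "AE x in lborel. (p (x + L *\<^sub>R e) - p x) * partial_deriv e \<eta> x = 0"
        using per unfolding periodic_AE_def by (auto elim: eventually_mono)
    qed
    finally show "(LINT x|lborel. (g (x + L *\<^sub>R e) - g x) * \<eta> x) = 0" by simp
  qed
  then show ?thesis unfolding periodic_AE_def by simp
qed

text \<open>The left side is \<open>\<integral>\<^sub>0\<^sup>h (\<langle>g (\<cdot> + s e), w\<rangle> - \<langle>g, w\<rangle>) ds\<close>. By periodicity \<open>\<langle>g, w\<rangle>\<close> equals
\<open>\<langle>g (\<cdot> + s e), w (\<cdot> + s e)\<rangle>\<close>, so the integrand is an increment of \<open>w\<close> and hence \<open>O(s)\<close>. This replaces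
continuity of translations in \<open>L\<^sup>2\<close>, which would give no rate.\<close>

lemma first_order_increment:
  assumes pg: "has_weak_derivative_lborel V e p g" and wq: "has_weak_derivative_lborel V e w q"
    and per: "periodic_AE g" "periodic_AE w" and h: "0 \<le> h" "h \<le> L"
  shows "\<bar>(LINT x|lborel. indicator \<Omega> x * ((p (x + h *\<^sub>R e) - p x) * w x))
      - h * (LINT x|lborel. indicator \<Omega> x * (g x * w x))\<bar>
    \<le> h * (h * ((LINT x|lborel. (q x)\<^sup>2) + (LINT x|lborel. (g x)\<^sup>2)))" (is "_ \<le> h * (h * ?C)")
proof -
  have g: "square_integrable lborel g" and w: "square_integrable lborel w"
    using pg wq by (auto simp: has_weak_derivative_lborel_def)
  let ?f = "\<lambda>s. LINT x|lborel. indicator \<Omega> x * (g (x + s *\<^sub>R e) * w x)"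
  let ?I = "LINT x|lborel. indicator \<Omega> x * (g x * w x)"
  have C0: "0 \<le> ?C" by simp
  have near: "\<bar>?f s - ?I\<bar> \<le> h * ?C" if s: "s \<in> {0..h}" for s
  proof -
    have s': "0 \<le> s" "s \<le> L" using s h by auto
    note gs = square_integrable_shift[OF g, of "s *\<^sub>R e"] and ws = square_integrable_shift(1)[OF w, of "s *\<^sub>R e"]
    have "?I = (LINT x|lborel. indicator \<Omega> x * (g (x + s *\<^sub>R e) * w (x + s *\<^sub>R e)))"
      by (rule integral_periodic_shift[OF square_integrable_mult[OF g w] periodic_AE_mult[OF per] s', symmetric])
    moreover have "integrable lborel (\<lambda>x. indicator \<Omega> x * (g (x + s *\<^sub>R e) * w x))"
      "integrable lborel (\<lambda>x. indicator \<Omega> x * (g (x + s *\<^sub>R e) * w (x + s *\<^sub>R e)))"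
      using integrable_mult_indicator[OF _ square_integrable_mult[OF gs(1) w], of \<Omega>]
        integrable_mult_indicator[OF _ square_integrable_mult[OF gs(1) ws], of \<Omega>] by auto
    ultimately have "?I - ?f s = (LINT x|lborel. indicator \<Omega> x * ((w (x + s *\<^sub>R e) - w x) * g (x + s *\<^sub>R e)))"
      by (simp add: algebra_simps flip: Bochner_Integration.integral_diff)
    then have "\<bar>?I - ?f s\<bar> \<le> s * ?C"
      using increment_bound[OF wq s' gs(1)] gs(2) by simp
    also have "\<dots> \<le> h * ?C" using s C0 by (intro mult_right_mono) auto
    finally show ?thesis by (simp add: abs_minus_commute)
  qed
  have i: "integrable lborel (\<lambda>s. indicator {0..h} s * ?f s)"
    by (rule integral_increment(2)[OF pg h w])
  have c: "integrable lborel (\<lambda>s. indicator {0..h} s * c)" for c :: real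
    by (rule integrable_const_on_interval)
  have "(LINT x|lborel. indicator \<Omega> x * ((p (x + h *\<^sub>R e) - p x) * w x)) - h * ?I
      = (LINT s|lborel. indicator {0..h} s * ?f s) - (LINT s|lborel. indicator {0..h} s * ?I)"
    unfolding integral_increment(1)[OF pg h w] integral_const_on_interval[OF h(1)] ..
  also have "\<dots> = (LINT s|lborel. indicator {0..h} s * (?f s - ?I))"
    using i c[of ?I] by (simp only: right_diff_distrib Bochner_Integration.integral_diff)
  finally have "\<bar>(LINT x|lborel. indicator \<Omega> x * ((p (x + h *\<^sub>R e) - p x) * w x)) - h * ?I\<bar>
      \<le> (LINT s|lborel. \<bar>indicator {0..h} s * (?f s - ?I)\<bar>)"
    by (simp only: integral_abs_bound)
  also have "\<dots> \<le> (LINT s|lborel. indicator {0..h} s * (h * ?C))"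
  proof (rule integral_mono)
    show "integrable lborel (\<lambda>s. \<bar>indicator {0..h} s * (?f s - ?I)\<bar>)"
      using Bochner_Integration.integrable_diff[OF i c[of ?I]]
      by (intro integrable_abs) (simp only: right_diff_distrib)
    show "\<bar>indicator {0..h} s * (?f s - ?I)\<bar> \<le> indicator {0..h} s * (h * ?C)" for s
      using near[of s] by (cases "s \<in> {0..h}") auto
  qed (rule c)
  also have "\<dots> = h * (h * ?C)" by (rule integral_const_on_interval[OF h(1)])
  finally show ?thesis .
qed

text \<open>Expand \<open>\<langle>p (\<cdot> + h e), w (\<cdot> + h e)\<rangle> - \<langle>p, w\<rangle> = 0\<close> to first order in \<open>h\<close>.\<close>

lemma periodic_integration_by_parts:
  assumes pg: "has_weak_derivative_lborel V e p g" and wq: "has_weak_derivative_lborel V e w q"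
    and per: "periodic_AE p" "periodic_AE w"
  shows "(LINT x|lborel. indicator \<Omega> x * (g x * w x)) + (LINT x|lborel. indicator \<Omega> x * (p x * q x)) = 0"
    (is "?X + ?Y = 0")
proof -
  have p: "square_integrable lborel p" and g: "square_integrable lborel g"
    and w: "square_integrable lborel w" and q: "square_integrable lborel q"
    using pg wq by (auto simp: has_weak_derivative_lborel_def)
  note per' = periodic_AE_weak_derivative[OF pg per(1)] periodic_AE_weak_derivative[OF wq per(2)]
  define C where "C = (LINT x|lborel. (q x)\<^sup>2) + (LINT x|lborel. (g x)\<^sup>2)"
  have C0: "0 \<le> C" by (simp add: C_def)
  have ii: "integrable lborel (\<lambda>x. indicator \<Omega> x * (u x * v x))"
    if "square_integrable lborel u" "square_integrable lborel v" for u v :: "'a \<Rightarrow> real"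
    using integrable_mult_indicator[OF _ square_integrable_mult[OF that], of \<Omega>] by auto
  have main: "h * \<bar>?X + ?Y\<bar> \<le> h * (3 * C * h)" if h: "0 < h" "h \<le> L" for h
  proof -
    have h0: "0 \<le> h" using h by simp
    note ph = square_integrable_shift(1)[OF p, of "h *\<^sub>R e"] and wh = square_integrable_shift(1)[OF w, of "h *\<^sub>R e"]
    note gs = square_integrable_shift[OF g]
    define P where "P = (LINT x|lborel. indicator \<Omega> x * ((p (x + h *\<^sub>R e) - p x) * w x))"
    define W where "W = (LINT x|lborel. indicator \<Omega> x * ((w (x + h *\<^sub>R e) - w x) * p x))"
    define D where "D = (LINT x|lborel. indicator \<Omega> x * ((p (x + h *\<^sub>R e) - p x) * (w (x + h *\<^sub>R e) - w x)))"
    have 1: "\<bar>P - h * ?X\<bar> \<le> h * (h * C)"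
      using first_order_increment[OF pg wq per'(1) per(2) h0 h(2)] by (simp add: P_def C_def)
    have 2: "\<bar>W - h * ?Y\<bar> \<le> h * (h * C)"
      using first_order_increment[OF wq pg per'(2) per(1) h0 h(2)] by (simp add: W_def C_def ac_simps)
    have 3: "\<bar>D\<bar> \<le> h * (h * C)"
    proof -
      let ?k = "\<lambda>x. w (x + h *\<^sub>R e) - w x"
      let ?f = "\<lambda>s. LINT x|lborel. indicator \<Omega> x * (g (x + s *\<^sub>R e) * ?k x)"
      have k: "square_integrable lborel ?k" by (intro square_integrable_diff wh w)
      have f: "\<bar>?f s\<bar> \<le> h * C" for s
        using increment_bound[OF wq h0 h(2) gs(1)[of "s *\<^sub>R e"]] gs(2)[of "s *\<^sub>R e"]
        by (simp add: C_def mult.commute)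
      have "D = (LINT s|lborel. indicator {0..h} s * ?f s)"
        unfolding D_def by (rule integral_increment(1)[OF pg h0 h(2) k])
      then have "\<bar>D\<bar> \<le> (LINT s|lborel. \<bar>indicator {0..h} s * ?f s\<bar>)"
        by (simp only: integral_abs_bound)
      also have "\<dots> \<le> (LINT s|lborel. indicator {0..h} s * (h * C))"
        using integral_increment(2)[OF pg h0 h(2) k] f
        by (intro integral_mono integrable_abs integrable_const_on_interval)
          (auto simp: abs_mult indicator_def)
      also have "\<dots> = h * (h * C)" by (rule integral_const_on_interval[OF h0])
      finally show ?thesis .
    qed
    \<comment> \<open>\<open>P + W + D\<close> is the expansion of the increment of \<open>\<langle>p, w\<rangle>\<close> under translation of both factors.\<close>
    have "P + W + D = (LINT x|lborel. indicator \<Omega> x * (p (x + h *\<^sub>R e) * w (x + h *\<^sub>R e)))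
        - (LINT x|lborel. indicator \<Omega> x * (p x * w x))"
    proof -
      have i: "integrable lborel (\<lambda>x. indicator \<Omega> x * ((p (x + h *\<^sub>R e) - p x) * w x))"
        "integrable lborel (\<lambda>x. indicator \<Omega> x * ((w (x + h *\<^sub>R e) - w x) * p x))"
        "integrable lborel (\<lambda>x. indicator \<Omega> x * ((p (x + h *\<^sub>R e) - p x) * (w (x + h *\<^sub>R e) - w x)))"
        "integrable lborel (\<lambda>x. indicator \<Omega> x * (p (x + h *\<^sub>R e) * w (x + h *\<^sub>R e)))"
        "integrable lborel (\<lambda>x. indicator \<Omega> x * (p x * w x))"
        by (intro ii square_integrable_diff p w ph wh)+
      show ?thesis
        unfolding P_def W_def D_def
        unfolding Bochner_Integration.integral_add[OF i(1,2), symmetric]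
          Bochner_Integration.integral_add[OF Bochner_Integration.integrable_add[OF i(1,2)] i(3), symmetric]
          Bochner_Integration.integral_diff[OF i(4,5), symmetric]
        by (intro Bochner_Integration.integral_cong refl) (simp add: algebra_simps)
    qed
    also have "\<dots> = 0"
      using integral_periodic_shift[OF square_integrable_mult[OF p w] periodic_AE_mult[OF per] h0 h(2)] by simp
    finally have "P + W + D = 0" .
    then have "h * (?X + ?Y) = - (P - h * ?X) - (W - h * ?Y) - D" by (simp add: algebra_simps)
    then have "\<bar>h * (?X + ?Y)\<bar> \<le> 3 * (h * (h * C))" using 1 2 3 by linarith
    moreover have "\<bar>h * (?X + ?Y)\<bar> = h * \<bar>?X + ?Y\<bar>" using h by (simp only: abs_mult abs_of_pos)
    moreover have "3 * (h * (h * C)) = h * (3 * C * h)" by simp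
    ultimately show ?thesis by simp
  qed
  have "\<bar>?X + ?Y\<bar> \<le> 3 * C * h" if "0 < h" "h \<le> L" for h
    by (rule mult_left_le_imp_le[OF main[OF that] that(1)])
  then have "\<bar>?X + ?Y\<bar> \<le> \<epsilon>" if "\<epsilon> > 0" for \<epsilon>
  proof -
    define h where "h = min L (\<epsilon> / (3 * C + 1))"
    have "0 < h" "h \<le> L" using that C0 L by (auto simp: h_def)
    then have "\<bar>?X + ?Y\<bar> \<le> 3 * C * h" by fact
    also have "\<dots> \<le> (3 * C + 1) * h" using \<open>0 < h\<close> by (simp add: algebra_simps)
    also have "\<dots> \<le> (3 * C + 1) * (\<epsilon> / (3 * C + 1))" using C0 by (intro mult_left_mono) (auto simp: h_def)
    also have "\<dots> = \<epsilon>" using C0 by simp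
    finally show ?thesis .
  qed
  then have "\<bar>?X + ?Y\<bar> \<le> 0" by (rule field_le_epsilon[of _ 0, simplified])
  then show ?thesis by simp
qed

end

lemma borel_measurable_indicator_mult_lebesgue:
  fixes V :: "'a::euclidean_space set" and f :: "'a \<Rightarrow> real"
  assumes "open V" "f \<in> borel_measurable (lebesgue_on V)"
  shows "(\<lambda>x. indicator V x * f x) \<in> borel_measurable lebesgue"
proof -
  have "(\<lambda>x. if x \<in> V then f x else 0) \<in> borel_measurable lebesgue"
    using borel_measurable_if[of V f] assms by auto
  also have "(\<lambda>x. if x \<in> V then f x else 0) = (\<lambda>x. indicator V x * f x)"
    by (auto simp: fun_eq_iff)
  finally show ?thesis .
qed

lemma L2_borel_representative:
  fixes V :: "'a::euclidean_space set"
  assumes "open V" "L2 V f"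
  obtains f' where "square_integrable lborel f'" "AE x in lborel. f' x = indicator V x * f x"
proof -
  have V: "V \<in> sets lebesgue" using assms by auto
  have m: "(\<lambda>x. indicator V x * f x) \<in> borel_measurable lebesgue"
    using assms by (intro borel_measurable_indicator_mult_lebesgue) (auto simp: L2_def square_integrable_def)
  obtain f' where f': "f' \<in> borel_measurable lborel" "AE x in lborel. indicator V x * f x = f' x"
    using completion_ex_borel_measurable_real[OF m] by blast
  have "integrable lebesgue (\<lambda>x. indicator V x * (f x)\<^sup>2)"
    using assms(2) V by (simp add: L2_def square_integrable_def integrable_lebesgue_on_indicator)
  moreover have "AE x in lebesgue. indicator V x * (f x)\<^sup>2 = (f' x)\<^sup>2"
    using f'(2) unfolding AE_completion_iff by eventually_elim (auto simp: indicator_def split: if_splits)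
  moreover have m2: "(\<lambda>x. (f' x)\<^sup>2) \<in> borel_measurable lborel" using f'(1) by simp
  ultimately have "integrable lebesgue (\<lambda>x. (f' x)\<^sup>2)"
    using integrable_cong_AE_imp measurable_completion by blast
  then have "square_integrable lborel f'"
    using f'(1) m2 by (simp add: square_integrable_def integrable_completion)
  with f'(2) show thesis using that by (auto simp: eq_commute)
qed

lemma integral_lborel_eq_lebesgue_on:
  fixes V :: "'a::euclidean_space set" and F G :: "'a \<Rightarrow> real"
  assumes "open V" "F \<in> borel_measurable lborel" "G \<in> borel_measurable (lebesgue_on V)"
    "AE x in lborel. F x = indicator V x * G x"
  shows "(LINT x|lborel. F x) = (LINT x|lebesgue_on V. G x)"
proof -
  have V: "V \<in> sets lebesgue" using assms by auto
  have m: "(\<lambda>x. indicator V x * G x) \<in> borel_measurable lebesgue"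
    using assms by (intro borel_measurable_indicator_mult_lebesgue)
  have "(LINT x|lborel. F x) = (LINT x|lebesgue. F x)"
    using assms(2) by (rule integral_completion[symmetric])
  also have "\<dots> = (LINT x|lebesgue. indicator V x * G x)"
    by (intro integral_cong_AE measurable_completion AE_completion assms m)
  also have "\<dots> = (LINT x|lebesgue_on V. G x)"
    using V by (simp add: integral_lebesgue_on_indicator)
  finally show ?thesis .
qed

lemma has_weak_derivative_lborel_representative:
  assumes V: "open V" and e: "e \<in> Basis" and ug: "has_weak_partial V e u g"
    and u': "square_integrable lborel u'" "AE x in lborel. u' x = indicator V x * u x"
    and g': "square_integrable lborel g'" "AE x in lborel. g' x = indicator V x * g x"
  shows "has_weak_derivative_lborel V e u' g'"
  unfolding has_weak_derivative_lborel_def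
proof (intro conjI allI impI u' g')
  fix \<eta> assume t: "test_function V \<eta>"
  note \<eta> = test_function_square_integrable[OF t]
  have loc: "locally_integrable V u" "locally_integrable V g"
    using ug by (auto simp: has_weak_partial_def)
  have "(LINT x|lborel. u' x * partial_deriv e \<eta> x) = (LINT x|lebesgue_on V. u x * partial_deriv e \<eta> x)"
  proof (rule integral_lborel_eq_lebesgue_on[OF V])
    show "AE x in lborel. u' x * partial_deriv e \<eta> x = indicator V x * (u x * partial_deriv e \<eta> x)"
      using u'(2) by eventually_elim simp
  qed (use u' \<eta>(2)[OF e] integrable_mult_test_function(2)[OF loc(1) V t e] in \<open>auto simp: square_integrable_def\<close>)
  moreover have "(LINT x|lborel. g' x * \<eta> x) = (LINT x|lebesgue_on V. g x * \<eta> x)"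
  proof (rule integral_lborel_eq_lebesgue_on[OF V])
    show "AE x in lborel. g' x * \<eta> x = indicator V x * (g x * \<eta> x)"
      using g'(2) by eventually_elim simp
  qed (use g' \<eta>(1) integrable_mult_test_function(1)[OF loc(2) V t] in \<open>auto simp: square_integrable_def\<close>)
  ultimately show "(LINT x|lborel. u' x * partial_deriv e \<eta> x) = - (LINT x|lborel. g' x * \<eta> x)"
    using ug t by (simp add: has_weak_partial_def)
qed

lemma has_weak_partial_subset:
  assumes "open V" "open \<Omega>" "\<Omega> \<subseteq> V" "i \<in> Basis" "has_weak_partial V i u g"
  shows "has_weak_partial \<Omega> i u g"
  unfolding has_weak_partial_def
proof (intro conjI allI impI)
  show "locally_integrable \<Omega> u" "locally_integrable \<Omega> g"
    using assms by (auto simp: has_weak_partial_def locally_integrable_def)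
  fix \<eta> assume t: "test_function \<Omega> \<eta>"
  have S: "V \<in> sets lebesgue" "\<Omega> \<in> sets lebesgue" using assms by auto
  obtain K where K: "K \<subseteq> \<Omega>" "\<And>x. x \<notin> K \<Longrightarrow> \<eta> x = 0" "\<And>x. x \<notin> K \<Longrightarrow> partial_deriv i \<eta> x = 0"
    using test_function_support[OF t] by metis
  have eq: "indicator V x * (u x * partial_deriv i \<eta> x) = indicator \<Omega> x * (u x * partial_deriv i \<eta> x)"
    "indicator V x * (g x * \<eta> x) = indicator \<Omega> x * (g x * \<eta> x)" for x
    using K assms(3) by (cases "x \<in> K"; auto simp: indicator_def)+
  have "(LINT x|lebesgue_on V. u x * partial_deriv i \<eta> x) = - (LINT x|lebesgue_on V. g x * \<eta> x)"
    using assms(5) test_function_mono[OF t assms(3)] by (simp add: has_weak_partial_def)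
  then show "(LINT x|lebesgue_on \<Omega>. u x * partial_deriv i \<eta> x) = - (LINT x|lebesgue_on \<Omega>. g x * \<eta> x)"
    unfolding integral_lebesgue_on_indicator[OF S(1)] integral_lebesgue_on_indicator[OF S(2)] eq .
qed

lemma periodic_bcE:
  assumes "periodic_bc a b u" "i \<in> Basis"
  obtains v where "\<And>x. x \<in> box a b \<Longrightarrow> v x = u x" "\<And>x. v (x + ((b - a) \<bullet> i) *\<^sub>R i) = v x"
    "\<And>V. open V \<Longrightarrow> bounded V \<Longrightarrow> H2 V v"
proof -
  from assms(1) obtain v where v: "(\<forall>x\<in>box a b. v x = u x) \<and>
      (\<forall>x. \<forall>i\<in>Basis. v (x + ((b - a) \<bullet> i) *\<^sub>R i) = v x) \<and> (\<forall>V. open V \<and> bounded V \<longrightarrow> H2 V v)"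
    unfolding periodic_bc_def by (rule exE)
  then have "\<And>x. v (x + ((b - a) \<bullet> i) *\<^sub>R i) = v x" using assms(2) by (meson v)
  with v show thesis by (intro that[of v]) (meson v)+
qed

text \<open>The formula holds for each coordinate direction separately. The periodic extensions are \<open>H\<^sup>2\<close> on
the box \<open>V\<close> prolonged by one period in direction \<open>i\<close>, and their weak derivatives on \<open>V\<close> restrict to
those on \<open>\<Omega>\<close>. The derivative inherits periodicity from the function.\<close>

lemma green_periodic:
  fixes a b :: "'a::euclidean_space"
  defines "\<Omega> \<equiv> box a b"
  assumes ne: "\<Omega> \<noteq> {}" and u: "H2 \<Omega> u" "periodic_bc a b u" and w: "H1 \<Omega> w" "periodic_bc a b w"
    and i: "i \<in> Basis"
  shows "(LINT x|lebesgue_on \<Omega>. weak_partial \<Omega> i (weak_partial \<Omega> i u) x * w x)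
      + (LINT x|lebesgue_on \<Omega>. weak_partial \<Omega> i u x * weak_partial \<Omega> i w x) = 0"
proof -
  have \<Omega>: "open \<Omega>" unfolding \<Omega>_def by (rule open_box)
  obtain y where y: "\<And>x. x \<in> \<Omega> \<Longrightarrow> y x = u x" "\<And>x. y (x + ((b - a) \<bullet> i) *\<^sub>R i) = y x"
    "\<And>V. open V \<Longrightarrow> bounded V \<Longrightarrow> H2 V y"
    using periodic_bcE[OF u(2) i] unfolding \<Omega>_def by metis
  obtain z where z: "\<And>x. x \<in> \<Omega> \<Longrightarrow> z x = w x" "\<And>x. z (x + ((b - a) \<bullet> i) *\<^sub>R i) = z x"
    "\<And>V. open V \<Longrightarrow> bounded V \<Longrightarrow> H2 V z"
    using periodic_bcE[OF w(2) i] unfolding \<Omega>_def by metis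
  define L where "L = (b - a) \<bullet> i"
  define V where "V = box a (b + L *\<^sub>R i)"
  have L0: "L > 0"
    using ne i by (auto simp: L_def \<Omega>_def box_ne_empty inner_diff_left)
  have V': "open V" "bounded V" by (auto simp: V_def)
  have slide: "x + s *\<^sub>R i \<in> V" if "x \<in> \<Omega>" "0 \<le> s" "s \<le> L" for x s
    unfolding V_def mem_box
  proof (intro ballI)
    fix j :: 'a assume j: "j \<in> Basis"
    have "a \<bullet> j < x \<bullet> j" "x \<bullet> j < b \<bullet> j" using that j by (auto simp: \<Omega>_def mem_box)
    then show "a \<bullet> j < (x + s *\<^sub>R i) \<bullet> j \<and> (x + s *\<^sub>R i) \<bullet> j < (b + L *\<^sub>R i) \<bullet> j"
      using that L0 i j by (cases "j = i") (auto simp: inner_add_left inner_Basis)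
  qed
  have sub: "\<Omega> \<subseteq> V" using slide[of _ 0] L0 by auto
  interpret sliding_box a b i V L
    by unfold_locales (use i V' L0 slide in \<open>auto simp: L_def \<Omega>_def\<close>)
  have H1y: "H1 V y" "H1 V (weak_partial V i y)" "H1 V z"
    using H2_D[OF y(3)[OF V']] H2_D[OF z(3)[OF V']] i by auto
  define P G Q where "P = weak_partial V i y" "G = weak_partial V i P" "Q = weak_partial V i z"
  have wp: "has_weak_partial V i y P" "has_weak_partial V i P G" "has_weak_partial V i z Q"
    using H1_D(1)[OF V'(1) _ i] H1y by (auto simp: P_G_Q_def)
  have L2: "L2 V y" "L2 V P" "L2 V G" "L2 V z" "L2 V Q"
    using H1_weak_partial_L2[OF V'(1) _ i] H1y by (auto simp: P_G_Q_def H1_def)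
  obtain y' where y': "square_integrable lborel y'" "AE x in lborel. y' x = indicator V x * y x"
    using L2_borel_representative[OF V'(1) L2(1)] .
  obtain p where p: "square_integrable lborel p" "AE x in lborel. p x = indicator V x * P x"
    using L2_borel_representative[OF V'(1) L2(2)] .
  obtain g where g: "square_integrable lborel g" "AE x in lborel. g x = indicator V x * G x"
    using L2_borel_representative[OF V'(1) L2(3)] .
  obtain z' where z': "square_integrable lborel z'" "AE x in lborel. z' x = indicator V x * z x"
    using L2_borel_representative[OF V'(1) L2(4)] .
  obtain q where q: "square_integrable lborel q" "AE x in lborel. q x = indicator V x * Q x"
    using L2_borel_representative[OF V'(1) L2(5)] .
  have wd: "has_weak_derivative_lborel V i y' p" "has_weak_derivative_lborel V i p g"
    "has_weak_derivative_lborel V i z' q"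
    using has_weak_derivative_lborel_representative[OF V'(1) i] wp y' p g z' q by blast+
  have per: "periodic_AE f'" if "AE x in lborel. f' x = indicator V x * f x"
    "\<And>x. f (x + L *\<^sub>R i) = f x" for f f' :: "'a \<Rightarrow> real"
    unfolding periodic_AE_def
    using that(1) AE_lborel_shift[OF that(1), of "L *\<^sub>R i"]
  proof eventually_elim
    case (elim x)
    show ?case
    proof
      assume "x \<in> box a b"
      then have "x \<in> V" "x + L *\<^sub>R i \<in> V" using slide[of x L] sub L0 by (auto simp: \<Omega>_def)
      then show "f' (x + L *\<^sub>R i) = f' x" using elim that(2) by simp
    qed
  qed
  have pery: "periodic_AE y'" "periodic_AE z'"
    using per[OF y'(2)] per[OF z'(2)] y(2) z(2) by (auto simp: L_def)
  have ibp: "(LINT x|lborel. indicator \<Omega> x * (g x * z' x)) + (LINT x|lborel. indicator \<Omega> x * (p x * q x)) = 0"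
    using periodic_integration_by_parts[OF wd(2,3) periodic_AE_weak_derivative[OF wd(1) pery(1)] pery(2)]
    by (simp add: \<Omega>_def)
  have Pu: "AE x in lebesgue_on \<Omega>. weak_partial \<Omega> i u x = P x"
    by (rule weak_partial_AE_eq[OF \<Omega> i has_weak_partial_subset[OF V'(1) \<Omega> sub i wp(1)] _ H1_D(1)[OF \<Omega> H2_D(1)[OF u(1)] i]])
      (auto intro!: AE_I2 simp: y(1))
  have Gu: "AE x in lebesgue_on \<Omega>. weak_partial \<Omega> i (weak_partial \<Omega> i u) x = G x"
    by (rule weak_partial_AE_eq[OF \<Omega> i has_weak_partial_subset[OF V'(1) \<Omega> sub i wp(2)] Pu H1_D(1)[OF \<Omega> H2_D(2)[OF u(1) i] i]])
  have Qw: "AE x in lebesgue_on \<Omega>. weak_partial \<Omega> i w x = Q x"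
    by (rule weak_partial_AE_eq[OF \<Omega> i has_weak_partial_subset[OF V'(1) \<Omega> sub i wp(3)] _ H1_D(1)[OF \<Omega> w(1) i]])
      (auto intro!: AE_I2 simp: z(1))
  have transfer: "(LINT x|lborel. indicator \<Omega> x * (r x * s x)) = (LINT x|lebesgue_on \<Omega>. r' x * s' x)"
    if m: "square_integrable lborel r" "square_integrable lborel s" "L2 \<Omega> r'" "L2 \<Omega> s'"
      and ae: "AE x in lborel. r x = indicator V x * R x" "AE x in lborel. s x = indicator V x * S x"
        "AE x in lebesgue_on \<Omega>. r' x = R x" "AE x in lebesgue_on \<Omega>. s' x = S x"
    for r s r' s' R S :: "'a \<Rightarrow> real"
  proof (rule integral_lborel_eq_lebesgue_on[OF \<Omega>])
    have "AE x in lebesgue. x \<in> \<Omega> \<longrightarrow> r' x = R x" "AE x in lebesgue. x \<in> \<Omega> \<longrightarrow> s' x = S x"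
      using ae(3,4) \<Omega> by (auto simp: AE_restrict_space_iff)
    then have "AE x in lborel. x \<in> \<Omega> \<longrightarrow> r' x = R x" "AE x in lborel. x \<in> \<Omega> \<longrightarrow> s' x = S x"
      by (simp_all add: AE_completion_iff)
    with ae(1,2) show "AE x in lborel. indicator \<Omega> x * (r x * s x) = indicator \<Omega> x * (r' x * s' x)"
      by eventually_elim (use sub in \<open>auto simp: indicator_def\<close>)
    show "(\<lambda>x. indicator \<Omega> x * (r x * s x)) \<in> borel_measurable lborel"
      using m \<Omega> by (auto simp: square_integrable_def)
    show "(\<lambda>x. r' x * s' x) \<in> borel_measurable (lebesgue_on \<Omega>)"
      using m by (auto simp: L2_def square_integrable_def)
  qed
  have L2\<Omega>: "L2 \<Omega> (weak_partial \<Omega> i (weak_partial \<Omega> i u))" "L2 \<Omega> (weak_partial \<Omega> i u)"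
    "L2 \<Omega> (weak_partial \<Omega> i w)" "L2 \<Omega> w"
    using H1_weak_partial_L2[OF \<Omega> _ i] H2_D(1)[OF u(1)] H2_D(2)[OF u(1) i] w(1) by (auto simp: H1_def)
  have wz: "AE x in lebesgue_on \<Omega>. w x = z x" using z(1) by (auto intro!: AE_I2)
  show ?thesis
    using ibp unfolding transfer[OF g(1) z'(1) L2\<Omega>(1,4) g(2) z'(2) Gu wz]
      transfer[OF p(1) q(1) L2\<Omega>(2,3) p(2) q(2) Pu Qw] .
qed

section \<open>The energy estimate\<close>

lemma green_difference:
  fixes \<Omega> :: "'a::euclidean_space set"
  assumes \<Omega>: "open \<Omega>" and H: "H2 \<Omega> \<phi>0" "H2 \<Omega> \<phi>1"
    and green: "\<And>w. w \<in> {\<phi>0, \<phi>1} \<Longrightarrow>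
      (\<Sum>i\<in>Basis. (LINT x|lebesgue_on \<Omega>. weak_partial \<Omega> i (weak_partial \<Omega> i \<phi>1) x * w x)
        + (LINT x|lebesgue_on \<Omega>. weak_partial \<Omega> i \<phi>1 x * weak_partial \<Omega> i w x)) = 0"
  shows "(LINT x|lebesgue_on \<Omega>. weak_laplacian \<Omega> \<phi>1 x * (\<phi>1 x - \<phi>0 x))
      = - (LINT x|lebesgue_on \<Omega>. (\<Sum>i\<in>Basis. weak_partial \<Omega> i \<phi>1 x *
            (weak_partial \<Omega> i \<phi>1 x - weak_partial \<Omega> i \<phi>0 x)))"
proof -
  let ?N = "lebesgue_on \<Omega>"
  let ?S = "square_integrable ?N"
  define D where "D \<phi> i = weak_partial \<Omega> i \<phi>" for \<phi> i
  have D: "?S (D \<phi>0 i)" "?S (D \<phi>1 i)" "?S (weak_partial \<Omega> i (D \<phi>1 i))" if "i \<in> Basis" for i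
    using H1_weak_partial_L2[OF \<Omega> _ that] H2_D[OF H(1)] H2_D[OF H(2)] that by (auto simp: L2_def D_def)
  have \<phi>: "?S \<phi>0" "?S \<phi>1" using H2_D(1) H by (auto simp: L2_def H1_def)
  have int: "integrable ?N (\<lambda>x. weak_partial \<Omega> i (D \<phi>1 i) x * \<phi>0 x)" "integrable ?N (\<lambda>x. weak_partial \<Omega> i (D \<phi>1 i) x * \<phi>1 x)"
    "integrable ?N (\<lambda>x. D \<phi>1 i x * D \<phi>0 i x)" "integrable ?N (\<lambda>x. D \<phi>1 i x * D \<phi>1 i x)" if "i \<in> Basis" for i
    by (intro square_integrable_mult D \<phi> that)+
  have "(LINT x|?N. weak_laplacian \<Omega> \<phi>1 x * (\<phi>1 x - \<phi>0 x))
     = (LINT x|?N. (\<Sum>i\<in>Basis. weak_partial \<Omega> i (D \<phi>1 i) x * \<phi>1 x - weak_partial \<Omega> i (D \<phi>1 i) x * \<phi>0 x))"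
    by (simp add: weak_laplacian_def D_def sum_distrib_right right_diff_distrib sum_subtractf)
  also have "\<dots> = (\<Sum>i\<in>Basis. (LINT x|?N. weak_partial \<Omega> i (D \<phi>1 i) x * \<phi>1 x) - (LINT x|?N. weak_partial \<Omega> i (D \<phi>1 i) x * \<phi>0 x))"
    using int by (simp add: Bochner_Integration.integral_sum)
  finally have 1: "(LINT x|?N. weak_laplacian \<Omega> \<phi>1 x * (\<phi>1 x - \<phi>0 x)) = \<dots>" .
  have "(LINT x|?N. (\<Sum>i\<in>Basis. D \<phi>1 i x * (D \<phi>1 i x - D \<phi>0 i x)))
     = (LINT x|?N. (\<Sum>i\<in>Basis. D \<phi>1 i x * D \<phi>1 i x - D \<phi>1 i x * D \<phi>0 i x))"
    by (simp add: right_diff_distrib)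
  also have "\<dots> = (\<Sum>i\<in>Basis. (LINT x|?N. D \<phi>1 i x * D \<phi>1 i x) - (LINT x|?N. D \<phi>1 i x * D \<phi>0 i x))"
    using int by (simp add: Bochner_Integration.integral_sum)
  finally have 2: "(LINT x|?N. (\<Sum>i\<in>Basis. D \<phi>1 i x * (D \<phi>1 i x - D \<phi>0 i x))) = \<dots>" .
  show ?thesis
    using green[of \<phi>0] green[of \<phi>1]
    unfolding 1 2[unfolded D_def] D_def sum.distrib sum_subtractf by simp
qed

text \<open>The boundary condition enters only through Green's formula for the increment. The second scheme
equation turns \<open>h (\<phi>1 - \<phi>0)\<close> into \<open>2 (U1 - U0)\<close>, so the coefficient drops out before anything is
integrated.\<close>

lemma energy_decay_from_green:
  fixes \<Omega> :: "'a::euclidean_space set"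
  assumes "open \<Omega>" and pos: "M > 0" "\<delta>t > 0"
    and H2: "H2 \<Omega> \<phi>0" "H2 \<Omega> \<phi>1" and U: "L2 \<Omega> U0" "L2 \<Omega> U1"
    and green: "(LINT x|lebesgue_on \<Omega>. weak_laplacian \<Omega> \<phi>1 x * (\<phi>1 x - \<phi>0 x))
      = - (LINT x|lebesgue_on \<Omega>. (\<Sum>i\<in>Basis. weak_partial \<Omega> i \<phi>1 x *
            (weak_partial \<Omega> i \<phi>1 x - weak_partial \<Omega> i \<phi>0 x)))"
    and scheme_phi:
      "AE x in lebesgue_on \<Omega>.
         (\<phi>1 x - \<phi>0 x) / \<delta>t + M * (- (\<epsilon>\<^sup>2) * weak_laplacian \<Omega> \<phi>1 x + h x * U1 x) = 0"
    and scheme_U: "AE x in lebesgue_on \<Omega>. U1 x - U0 x = 1 / 2 * h x * (\<phi>1 x - \<phi>0 x)"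
  shows "energy \<Omega> \<epsilon> \<phi>1 U1
      \<le> energy \<Omega> \<epsilon> \<phi>0 U0 - 1 / (M * \<delta>t) * (L2_norm \<Omega> (\<lambda>x. \<phi>1 x - \<phi>0 x))\<^sup>2"
proof -
  let ?N = "lebesgue_on \<Omega>"
  let ?S = "square_integrable ?N"
  define w where "w x = \<phi>1 x - \<phi>0 x" for x
  define D0 D1 where "D0 = (\<lambda>i. weak_partial \<Omega> i \<phi>0)" "D1 = (\<lambda>i. weak_partial \<Omega> i \<phi>1)"
  have D: "?S (D0 i)" "?S (D1 i)" if "i \<in> Basis" for i
    using H1_weak_partial_L2[OF assms(1) _ that] H2_D(1) H2 by (auto simp: L2_def D0_D1_def)
  have w: "?S w"
    using H1_D(2)[OF assms(1) _ SOME_Basis] H2_D(1) H2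
    unfolding w_def L2_def by (intro square_integrable_diff) auto
  have U': "?S U0" "?S U1" using U by (auto simp: L2_def)
  have "?S (weak_partial \<Omega> i (D1 i))" if "i \<in> Basis" for i
    using H1_weak_partial_L2[OF assms(1) H2_D(2)[OF H2(2) that] that] by (auto simp: L2_def D0_D1_def)
  then have lap: "?S (weak_laplacian \<Omega> \<phi>1)"
    unfolding weak_laplacian_def D0_D1_def by (intro square_integrable_sum) auto
  have int: "integrable ?N (\<lambda>x. weak_laplacian \<Omega> \<phi>1 x * w x)" "integrable ?N (\<lambda>x. (w x)\<^sup>2)"
    "integrable ?N (\<lambda>x. (U0 x)\<^sup>2)" "integrable ?N (\<lambda>x. (U1 x)\<^sup>2)" "integrable ?N (\<lambda>x. (U1 x - U0 x)\<^sup>2)"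
    using square_integrable_mult[OF lap w] w U' square_integrable_diff[OF U'(2,1)]
    by (auto simp: square_integrable_def)
  have intD: "integrable ?N (\<lambda>x. \<Sum>i\<in>Basis. (D0 i x)\<^sup>2)" "integrable ?N (\<lambda>x. \<Sum>i\<in>Basis. (D1 i x)\<^sup>2)"
    "integrable ?N (\<lambda>x. \<Sum>i\<in>Basis. (D1 i x - D0 i x)\<^sup>2)"
    using D square_integrable_diff[OF D(2,1)]
    by (auto simp: square_integrable_def intro!: Bochner_Integration.integrable_sum)
  let ?E = "\<lambda>\<phi>. (LINT x|?N. (\<Sum>i\<in>Basis. (weak_partial \<Omega> i \<phi> x)\<^sup>2))"
  have E0: "energy \<Omega> \<epsilon> \<phi>0 U0 = \<epsilon>\<^sup>2 / 2 * ?E \<phi>0 + (LINT x|?N. (U0 x)\<^sup>2)"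
    using int intD unfolding energy_def norm_weak_gradient_squared D0_D1_def by simp
  have E1: "energy \<Omega> \<epsilon> \<phi>1 U1 = \<epsilon>\<^sup>2 / 2 * ?E \<phi>1 + (LINT x|?N. (U1 x)\<^sup>2)"
    using int intD unfolding energy_def norm_weak_gradient_squared D0_D1_def by simp
  \<comment> \<open>Green's formula combined with \<open>2 x (x - y) = x\<^sup>2 - y\<^sup>2 + (x - y)\<^sup>2\<close>\<close>
  have G: "(LINT x|?N. weak_laplacian \<Omega> \<phi>1 x * w x)
    = - 1/2 * (?E \<phi>1 - ?E \<phi>0 + (LINT x|?N. (\<Sum>i\<in>Basis. (D1 i x - D0 i x)\<^sup>2)))"
  proof -
    have "(LINT x|?N. (\<Sum>i\<in>Basis. D1 i x * (D1 i x - D0 i x)))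
      = (LINT x|?N. 1/2 * ((\<Sum>i\<in>Basis. (D1 i x)\<^sup>2) - (\<Sum>i\<in>Basis. (D0 i x)\<^sup>2)
          + (\<Sum>i\<in>Basis. (D1 i x - D0 i x)\<^sup>2)))"
    proof (rule Bochner_Integration.integral_cong[OF refl])
      fix x
      have "(\<Sum>i\<in>Basis. D1 i x * (D1 i x - D0 i x))
        = (\<Sum>i\<in>Basis. 1/2 * ((D1 i x)\<^sup>2 - (D0 i x)\<^sup>2 + (D1 i x - D0 i x)\<^sup>2))"
        by (intro sum.cong) (auto simp: power2_eq_square algebra_simps)
      then show "(\<Sum>i\<in>Basis. D1 i x * (D1 i x - D0 i x))
         = 1/2 * ((\<Sum>i\<in>Basis. (D1 i x)\<^sup>2) - (\<Sum>i\<in>Basis. (D0 i x)\<^sup>2)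
          + (\<Sum>i\<in>Basis. (D1 i x - D0 i x)\<^sup>2))"
        by (simp only: sum_distrib_left[symmetric] sum.distrib sum_subtractf)
    qed
    also have "\<dots> = 1/2 * (?E \<phi>1 - ?E \<phi>0 + (LINT x|?N. (\<Sum>i\<in>Basis. (D1 i x - D0 i x)\<^sup>2)))"
      using intD by (simp add: D0_D1_def)
    finally show ?thesis using green by (simp add: D0_D1_def w_def)
  qed
  have "AE x in ?N. \<epsilon>\<^sup>2 * (weak_laplacian \<Omega> \<phi>1 x * w x)
     = 1 / (M * \<delta>t) * (w x)\<^sup>2 + ((U1 x)\<^sup>2 - (U0 x)\<^sup>2 + (U1 x - U0 x)\<^sup>2)"
    using scheme_phi scheme_U
  proof eventually_elim
    case (elim x)
    have "\<epsilon>\<^sup>2 * weak_laplacian \<Omega> \<phi>1 x = w x / (M * \<delta>t) + h x * U1 x"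
      using elim(1) pos by (simp add: w_def field_simps)
    then have "\<epsilon>\<^sup>2 * (weak_laplacian \<Omega> \<phi>1 x * w x) = (w x / (M * \<delta>t) + h x * U1 x) * w x"
      by (simp add: mult.assoc[symmetric])
    also have "\<dots> = 1 / (M * \<delta>t) * (w x)\<^sup>2 + (h x * w x) * U1 x"
      by (simp add: power2_eq_square algebra_simps)
    also have "h x * w x = 2 * (U1 x - U0 x)"
      using elim(2) by (simp add: w_def)
    also have "2 * (U1 x - U0 x) * U1 x = (U1 x)\<^sup>2 - (U0 x)\<^sup>2 + (U1 x - U0 x)\<^sup>2"
      by (simp add: power2_eq_square algebra_simps)
    finally show ?case .
  qed
  then have "(LINT x|?N. \<epsilon>\<^sup>2 * (weak_laplacian \<Omega> \<phi>1 x * w x))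
    = (LINT x|?N. 1 / (M * \<delta>t) * (w x)\<^sup>2 + ((U1 x)\<^sup>2 - (U0 x)\<^sup>2 + (U1 x - U0 x)\<^sup>2))"
    using int by (intro integral_cong_AE) auto
  then have "\<epsilon>\<^sup>2 * (LINT x|?N. weak_laplacian \<Omega> \<phi>1 x * w x)
    = 1 / (M * \<delta>t) * (LINT x|?N. (w x)\<^sup>2) + (LINT x|?N. (U1 x)\<^sup>2) - (LINT x|?N. (U0 x)\<^sup>2)
      + (LINT x|?N. (U1 x - U0 x)\<^sup>2)"
    using int by simp
  moreover have "(L2_norm \<Omega> (\<lambda>x. \<phi>1 x - \<phi>0 x))\<^sup>2 = (LINT x|?N. (w x)\<^sup>2)"
    by (simp add: L2_norm_def w_def)
  moreover have "0 \<le> (LINT x|?N. (U1 x - U0 x)\<^sup>2)"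
    "0 \<le> \<epsilon>\<^sup>2 / 2 * (LINT x|?N. (\<Sum>i\<in>Basis. (D1 i x - D0 i x)\<^sup>2))"
    by (auto intro!: mult_nonneg_nonneg Bochner_Integration.integral_nonneg sum_nonneg)
  ultimately show ?thesis
    unfolding E0 E1 G by (simp add: algebra_simps)
qed

theorem theorem4p1:
  fixes \<Omega> :: "'a::euclidean_space set"
    and F :: "real \<Rightarrow> real" and I :: "real set"
    and A B M \<epsilon> \<delta>t :: real
    and \<phi>0 \<phi>1 U0 U1 :: "'a \<Rightarrow> real"
  assumes "DIM('a) = 2 \<or> DIM('a) = 3"
    and "open \<Omega>" "connected \<Omega>" "bounded \<Omega>" "\<Omega> \<noteq> {}"
    and "M > 0" "\<epsilon> > 0" "\<delta>t > 0"
    and "open I" "is_interval I" "F differentiable_on I" "continuous_on I (deriv F)"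
    and "A > 0" "\<forall>s\<in>I. F s > - A" "B > A"
    and "H2 \<Omega> \<phi>0" "H2 \<Omega> \<phi>1" "L2 \<Omega> U0" "L2 \<Omega> U1"
    and "AE x in lebesgue_on \<Omega>. \<phi>0 x \<in> I"
    and "L_infinity \<Omega> (\<lambda>x. H_fun F B (\<phi>0 x))"
    and boundary_condition:
      "(\<exists>a b. \<Omega> = box a b \<and> periodic_bc a b \<phi>0 \<and> periodic_bc a b \<phi>1)
        \<or> (regular_boundary \<Omega> \<and> neumann_bc \<Omega> \<phi>0 \<and> neumann_bc \<Omega> \<phi>1)"
    and scheme_phi:
      "AE x in lebesgue_on \<Omega>.
         (\<phi>1 x - \<phi>0 x) / \<delta>t
           + M * (- (\<epsilon>\<^sup>2) * weak_laplacian \<Omega> \<phi>1 x + H_fun F B (\<phi>0 x) * U1 x) = 0"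
    and scheme_U:
      "AE x in lebesgue_on \<Omega>. U1 x - U0 x = 1 / 2 * H_fun F B (\<phi>0 x) * (\<phi>1 x - \<phi>0 x)"
  shows "energy \<Omega> \<epsilon> \<phi>1 U1
      \<le> energy \<Omega> \<epsilon> \<phi>0 U0 - 1 / (M * \<delta>t) * (L2_norm \<Omega> (\<lambda>x. \<phi>1 x - \<phi>0 x))\<^sup>2"
proof (rule energy_decay_from_green)
  show "(LINT x|lebesgue_on \<Omega>. weak_laplacian \<Omega> \<phi>1 x * (\<phi>1 x - \<phi>0 x))
      = - (LINT x|lebesgue_on \<Omega>. (\<Sum>i\<in>Basis. weak_partial \<Omega> i \<phi>1 x *
            (weak_partial \<Omega> i \<phi>1 x - weak_partial \<Omega> i \<phi>0 x)))"
  proof (rule green_difference)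
    fix w assume w: "w \<in> {\<phi>0, \<phi>1}"
    have Hw: "H1 \<Omega> w" using w H2_D(1) assms by blast
    show "(\<Sum>i\<in>Basis. (LINT x|lebesgue_on \<Omega>. weak_partial \<Omega> i (weak_partial \<Omega> i \<phi>1) x * w x)
        + (LINT x|lebesgue_on \<Omega>. weak_partial \<Omega> i \<phi>1 x * weak_partial \<Omega> i w x)) = 0"
      using boundary_condition
    proof (elim disjE exE conjE)
      fix a b assume ab: "\<Omega> = box a b" "periodic_bc a b \<phi>0" "periodic_bc a b \<phi>1"
      show ?thesis
      proof (rule sum.neutral, rule ballI)
        fix i :: 'a assume "i \<in> Basis"
        have "periodic_bc a b w" using w ab by blast
        with green_periodic[of a b \<phi>1 w i] \<open>i \<in> Basis\<close> ab assms Hw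
        show "(LINT x|lebesgue_on \<Omega>. weak_partial \<Omega> i (weak_partial \<Omega> i \<phi>1) x * w x)
          + (LINT x|lebesgue_on \<Omega>. weak_partial \<Omega> i \<phi>1 x * weak_partial \<Omega> i w x) = 0" by simp
      qed
    next
      assume "regular_boundary \<Omega>" "neumann_bc \<Omega> \<phi>1"
      then show ?thesis using green_neumann assms Hw by blast
    qed
  qed fact+
qed fact+

end
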